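(* Let $u_0\in H$ and assume Hypothesis H (stated in the context). Then for every $h\in L^2([0,T],U)$ there exists a solution $u_h$ to the equation $$du_h+\mathrm{div}(B(u_h))\,dt=\mathrm{div}(A(u_h)\nabla u_h)\,dt+\sigma(u_h)h(t)\,dt,\qquad u_h(0)=u_0,$$ on $\mathbb{T}^d\times[0,T]$, and it satisfies $$\sup_{0\le t\le T}\|u_h(t)\|_H^2+\int_0^T\|u_h(t)\|_{H^1}^2\,dt<\infty.$$
   Context: Notation: $T>0$ is fixed, $\mathbb{T}^d=[0,1]^d$ is the $d$-dimensional torus (periodic boundary conditions), $H=L^2(\mathbb{T}^d)$ with inner product $\langle\cdot,\cdot\rangle$, $H^1=H^1(\mathbb{T}^d)$ is the usual Sobolev space. $C^1_{lip}$ denotes the Lipschitz functions that are continuously differentiable. $U$ is a separable Hilbert space with norm $|\cdot|_U$ and orthonormal basis $(\bar e_k)_{k\ge1}$. Hypothesis H: (i) $B=(B_1,\dots,B_d):\mathbb{R}\to\mathbb{R}^d$ is of class $C^1_{lip}$. (ii) $A=(A_{ij})_{i,j=1}^d:\mathbb{R}\to\mathbb{R}^{d\times d}$ is of class $C^1_{lip}$, uniformly positive definite and bounded, i.e. $\delta I\le A\le CI$ for constants $\delta,C>0$. (iii) For each $u\in H$, $\sigma(u):U\to H$ is defined by $\sigma(u)\bar e_k=\sigma_k(u(\cdot))$ with $\sigma_k:\mathbb{R}\to\mathbb{R}$ satisfying, for all $y,y_1,y_2\in\mathbb{R}$, $\sum_{k\ge1}|\sigma_k(y)|^2\le C(1+|y|^2)$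 and $\sum_{k\ge1}|\sigma_k(y_1)-\sigma_k(y_2)|^2\le C|y_1-y_2|^2$. Solution: a function $u\in C([0,T],H)\cap L^2([0,T],H^1)$ such that for every $\phi\in C^\infty(\mathbb{T}^d)$ and $t\in[0,T]$, $$\langle u(t),\phi\rangle-\langle u_0,\phi\rangle-\int_0^t\langle B(u(s)),\nabla\phi\rangle ds=-\int_0^t\langle A(u(s))\nabla u(s),\nabla\phi\rangle ds+\int_0^t\langle\sigma(u(s))h(s),\phi\rangle ds.$$ *)

theory Defs
  imports "HOL-Analysis.Analysis"
begin

text \<open>
  The torus is the cube [0,1]^d with opposite faces identified, where d is the cardinality of the
  index type. Elements of Lebesgue and Sobolev spaces on it are represented by functions on real^'d,
  of which only the values almost everywhere on the cube matter; periodicity enters through the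
  test functions.
\<close>

abbreviation torus :: "(real^'d) measure" where
  "torus \<equiv> lebesgue_on (cbox 0 1)"


subsection \<open>The space H = L^2 of the torus, for scalar and for vector-valued functions\<close>

definition L2 :: "(real^'d \<Rightarrow> 'b::euclidean_space) set" where
  "L2 = {f. f \<in> borel_measurable torus \<and> integrable torus (\<lambda>x. (norm (f x))\<^sup>2)}"

definition L2_inner :: "(real^'d \<Rightarrow> 'b::euclidean_space) \<Rightarrow> (real^'d \<Rightarrow> 'b) \<Rightarrow> real" where
  "L2_inner f g = (LINT x|torus. f x \<bullet> g x)"

definition L2_norm :: "(real^'d \<Rightarrow> 'b::euclidean_space) \<Rightarrow> real" where
  "L2_norm f = sqrt (L2_inner f f)"


subsection \<open>Smooth functions on the torus\<close>

definition grad :: "(real^'d \<Rightarrow> real) \<Rightarrow> real^'d \<Rightarrow> real^'d" where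
  "grad f x = (THE D. GDERIV f x :> D)"

primrec Ck :: "nat \<Rightarrow> (real^'d \<Rightarrow> real) \<Rightarrow> bool" where
  "Ck 0 f \<longleftrightarrow> continuous_on UNIV f"
| "Ck (Suc k) f \<longleftrightarrow> (\<exists>g. (\<forall>x. GDERIV f x :> g x) \<and> (\<forall>i. Ck k (\<lambda>x. g x $ i)))"

definition Cinf_torus :: "(real^'d \<Rightarrow> real) set" where
  "Cinf_torus = {\<phi>. (\<forall>k. Ck k \<phi>) \<and> (\<forall>x i. \<phi> (x + axis i 1) = \<phi> x)}"


subsection \<open>The Sobolev space H^1 of the torus\<close>

text \<open>Test functions are periodic and need not vanish on the boundary of the cube, so the weak
  derivatives are those of the torus: a jump across identified faces is excluded.\<close>

definition weak_gradient :: "(real^'d \<Rightarrow> real) \<Rightarrow> (real^'d \<Rightarrow> real^'d) \<Rightarrow> bool" where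
  "weak_gradient f g \<longleftrightarrow> g \<in> L2 \<and>
     (\<forall>\<phi>\<in>Cinf_torus. \<forall>i. L2_inner f (\<lambda>x. grad \<phi> x $ i) = - L2_inner (\<lambda>x. g x $ i) \<phi>)"

definition H1 :: "(real^'d \<Rightarrow> real) set" where
  "H1 = {f \<in> L2. \<exists>g. weak_gradient f g}"

text \<open>A weak gradient is unique up to a null set; this picks a representative, and is meaningful
  only on \<^const>\<open>H1\<close>.\<close>

definition wgrad :: "(real^'d \<Rightarrow> real) \<Rightarrow> real^'d \<Rightarrow> real^'d" where
  "wgrad f = (SOME g. weak_gradient f g)"

definition H1_norm :: "(real^'d \<Rightarrow> real) \<Rightarrow> real" where
  "H1_norm f = sqrt ((L2_norm f)\<^sup>2 + (L2_norm (wgrad f))\<^sup>2)"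


subsection \<open>Spaces of functions of time\<close>

definition C_H :: "real \<Rightarrow> (real \<Rightarrow> real^'d \<Rightarrow> real) set" where
  "C_H T = {u. (\<forall>t\<in>{0..T}. u t \<in> L2) \<and>
     (\<forall>t\<in>{0..T}. ((\<lambda>s. L2_norm (\<lambda>x. u s x - u t x)) \<longlongrightarrow> 0) (at t within {0..T}))}"

text \<open>Strong (Bochner) measurability: almost everywhere limit, in the norm of \<^const>\<open>H1\<close>, of
  \<^const>\<open>H1\<close>-valued simple functions.\<close>

definition strongly_measurable_H1 :: "real \<Rightarrow> (real \<Rightarrow> real^'d \<Rightarrow> real) \<Rightarrow> bool" where
  "strongly_measurable_H1 T u \<longleftrightarrow>
     (\<exists>s :: nat \<Rightarrow> real \<Rightarrow> real^'d \<Rightarrow> real.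
        (\<forall>n. simple_function (lebesgue_on {0..T}) (s n) \<and> (\<forall>t\<in>{0..T}. s n t \<in> H1)) \<and>
        (AE t in lebesgue_on {0..T}. (\<lambda>n. H1_norm (\<lambda>x. s n t x - u t x)) \<longlonglongrightarrow> 0))"

definition L2_H1 :: "real \<Rightarrow> (real \<Rightarrow> real^'d \<Rightarrow> real) set" where
  "L2_H1 T = {u. (AE t in lebesgue_on {0..T}. u t \<in> H1) \<and> strongly_measurable_H1 T u \<and>
     integrable (lebesgue_on {0..T}) (\<lambda>t. (H1_norm (u t))\<^sup>2)}"

text \<open>For values in a separable Hilbert space Borel and strong measurability agree.\<close>

definition L2_U ::
    "real \<Rightarrow> (real \<Rightarrow> 'u::{real_inner, banach, second_countable_topology}) set" where
  "L2_U T = {h. h \<in> borel_measurable (lebesgue_on {0..T}) \<and>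
     integrable (lebesgue_on {0..T}) (\<lambda>t. (norm (h t))\<^sup>2)}"


subsection \<open>The coefficients\<close>

definition C1_lip :: "(real \<Rightarrow> 'b::real_normed_vector) set" where
  "C1_lip = {f. f C1_differentiable_on UNIV \<and> (\<exists>L. L-lipschitz_on UNIV f)}"

text \<open>The index type of the basis is countable rather than fixed to be the naturals, so that
  finite-dimensional Hilbert spaces are included.\<close>

definition orthonormal_basis :: "('k::countable \<Rightarrow> 'u::real_inner) \<Rightarrow> bool" where
  "orthonormal_basis e \<longleftrightarrow>
     (\<forall>j k. e j \<bullet> e k = (if j = k then 1 else 0)) \<and> closure (span (range e)) = UNIV"

text \<open>The matrix A is not required to be symmetric. For symmetric A the two bounds on the quadratic
  form already imply that A is bounded; in general boundedness is a separate requirement.\<close>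

definition hypothesis_H ::
    "(real \<Rightarrow> real^'d) \<Rightarrow> (real \<Rightarrow> real^'d^'d) \<Rightarrow> ('k::countable \<Rightarrow> real \<Rightarrow> real) \<Rightarrow> bool" where
  "hypothesis_H B A \<sigma> \<longleftrightarrow>
     B \<in> C1_lip \<and>
     A \<in> C1_lip \<and>
     (\<exists>\<delta>>0. \<exists>C>0. \<forall>y \<xi>. \<delta> * (norm \<xi>)\<^sup>2 \<le> \<xi> \<bullet> (A y *v \<xi>) \<and> \<xi> \<bullet> (A y *v \<xi>) \<le> C * (norm \<xi>)\<^sup>2) \<and>
     bounded (range A) \<and>
     (\<exists>C>0.
        (\<forall>y. (\<lambda>k. (\<sigma> k y)\<^sup>2) summable_on UNIV \<and>
             (\<Sum>\<^sub>\<infinity>k. (\<sigma> k y)\<^sup>2) \<le> C * (1 + y\<^sup>2)) \<and>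
        (\<forall>y z. (\<lambda>k. (\<sigma> k y - \<sigma> k z)\<^sup>2) summable_on UNIV \<and>
             (\<Sum>\<^sub>\<infinity>k. (\<sigma> k y - \<sigma> k z)\<^sup>2) \<le> C * (y - z)\<^sup>2))"

text \<open>\<open>noise_op e \<sigma> u\<close> is the bounded linear operator from U to H that maps \<open>e k\<close> to \<open>\<sigma> k \<circ> u\<close>.
  Since \<open>\<sigma>\<close> is square summable in \<open>k\<close> at every point, the series converges absolutely at every
  point; by dominated convergence the sum is also the limit in H.\<close>

definition noise_op ::
    "('k::countable \<Rightarrow> 'u::real_inner) \<Rightarrow> ('k \<Rightarrow> real \<Rightarrow> real) \<Rightarrow>
     (real^'d \<Rightarrow> real) \<Rightarrow> 'u \<Rightarrow> (real^'d \<Rightarrow> real)" where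
  "noise_op e \<sigma> u v = (\<lambda>x. \<Sum>\<^sub>\<infinity>k. (v \<bullet> e k) * \<sigma> k (u x))"

lemma noise_op_basis:
  assumes "orthonormal_basis e"
  shows "noise_op e \<sigma> u (e k) = (\<lambda>x. \<sigma> k (u x))"
proof
  fix x
  have "noise_op e \<sigma> u (e k) x = (\<Sum>\<^sub>\<infinity>j\<in>{k}. (e k \<bullet> e j) * \<sigma> j (u x))"
    unfolding noise_op_def using assms
    by (intro infsum_cong_neutral) (auto simp: orthonormal_basis_def)
  then show "noise_op e \<sigma> u (e k) x = \<sigma> k (u x)"
    using assms by (simp add: orthonormal_basis_def)
qed


subsection \<open>Solutions\<close>

definition is_solution ::
    "real \<Rightarrow> (real \<Rightarrow> real^'d) \<Rightarrow> (real \<Rightarrow> real^'d^'d) \<Rightarrow>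
     ('k::countable \<Rightarrow> 'u::real_inner) \<Rightarrow> ('k \<Rightarrow> real \<Rightarrow> real) \<Rightarrow>
     (real^'d \<Rightarrow> real) \<Rightarrow> (real \<Rightarrow> 'u) \<Rightarrow> (real \<Rightarrow> real^'d \<Rightarrow> real) \<Rightarrow> bool" where
  "is_solution T B A e \<sigma> u0 h u \<longleftrightarrow>
     u \<in> C_H T \<inter> L2_H1 T \<and>
     (\<forall>\<phi>\<in>Cinf_torus. \<forall>t\<in>{0..T}.
        L2_inner (u t) \<phi> - L2_inner u0 \<phi>
          - (LINT s|lebesgue_on {0..t}. L2_inner (\<lambda>x. B (u s x)) (grad \<phi>))
        = - (LINT s|lebesgue_on {0..t}. L2_inner (\<lambda>x. A (u s x) *v wgrad (u s) x) (grad \<phi>))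
          + (LINT s|lebesgue_on {0..t}. L2_inner (noise_op e \<sigma> (u s) (h s)) \<phi>))"

end

theory Submission
  imports Defs "HOL-Complex_Analysis.Great_Picard"
begin

text \<open>
  The existence proof rests on an energy bound and on compactness. Testing the equation with the
  solution itself, the coercivity of A controls the drift and the forcing, which grow at most
  linearly, and Gronwall's inequality bounds the solution in L-infinity(0,T;H) and in L2(0,T;H1).
  The bound holds uniformly for Galerkin approximations, and a subsequence of these converges to a
  solution.

  The Galerkin spaces are spanned by the Hartley functions cos(2 pi k.x) + sin(2 pi k.x), one for
  each lattice point k. They are orthonormal, complete by the Stone--Weierstrass theorem
  (\<open>hartley_complete\<close>), and each derivative maps the function of index k to a multiple of the one
  of index -k. Hence H1 regularity, weak gradients and norms can be read off from Fourier
  coefficients (\<open>Riesz_Fischer\<close>, \<open>Parseval\<close>, \<open>H1_fourierI\<close>). The forcing is only square integrable in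
  time, so each Galerkin system is discretised by an explicit Euler scheme with exact integration of
  the forcing over a step. Under a step restriction that depends on the number of modes, the energy
  bound survives as an algebraic inequality for a single step (\<open>euler_step\<close>).

  A fixed Fourier mode of the approximations is Hoelder continuous in time with exponent 1/2 and a
  constant independent of the approximation, so a subsequence converges in every mode at every time
  (\<open>galerkin_subsequence\<close>). The bound in H1 makes the high modes uniformly small, which upgrades this to
  strong convergence in L2(0,T;H) (\<open>gap_tendsto\<close>). The gradients converge only weakly. In the
  diffusion term they are multiplied by A(u) applied to the gradient of a Hartley function, which
  converges strongly because A is Lipschitz and the gradient is bounded; the product of a weakly and
  a strongly convergent family converges (\<open>weak_strong_convergence\<close>). All other terms are Lipschitz in
  the solution. So the limit satisfies the equation in each mode (\<open>c_equation\<close>) and then for every smooth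
  test function (\<open>weak_formulation\<close>).

  Continuity with values in H comes from the energy identity for single modes: the energy in the
  high modes is at most their initial energy plus twice the work done on them, and the total work is
  finite, so the tails of the Fourier series are small uniformly in time (\<open>uniform_tail\<close>). Measurability
  in time is likewise reduced to that of Fourier coefficients.
\<close>

section \<open>Square integrable functions\<close>

text \<open>The measure is arbitrary because the same estimates serve the torus and the time interval.\<close>

definition sq_integrable :: "'a measure \<Rightarrow> ('a \<Rightarrow> real) \<Rightarrow> bool" where
  "sq_integrable M f \<longleftrightarrow> f \<in> borel_measurable M \<and> integrable M (\<lambda>x. (f x)\<^sup>2)"

definition lnorm :: "'a measure \<Rightarrow> ('a \<Rightarrow> real) \<Rightarrow> real" where
  "lnorm M f = sqrt (LINT x|M. (f x)\<^sup>2)"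

lemma sq_integrableD:
  assumes "sq_integrable M f"
  shows "f \<in> borel_measurable M" "integrable M (\<lambda>x. (f x)\<^sup>2)"
  using assms by (auto simp: sq_integrable_def)

lemma lnorm_nonneg [simp]: "0 \<le> lnorm M f"
  by (simp add: lnorm_def)

lemma lnorm_power2: "(lnorm M f)\<^sup>2 = (LINT x|M. (f x)\<^sup>2)"
  by (simp add: lnorm_def)

lemma sq_integrable_bound:
  assumes "sq_integrable M g" "f \<in> borel_measurable M" "AE x in M. \<bar>f x\<bar> \<le> \<bar>g x\<bar>"
  shows "sq_integrable M f"
  unfolding sq_integrable_def
proof
  have "AE x in M. norm ((f x)\<^sup>2) \<le> norm ((g x)\<^sup>2)"
    using assms(3) by eventually_elim (use abs_le_square_iff in force)
  moreover have "(\<lambda>x. (f x)\<^sup>2) \<in> borel_measurable M" using assms(2) by measurable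
  ultimately show "integrable M (\<lambda>x. (f x)\<^sup>2)"
    using Bochner_Integration.integrable_bound[OF sq_integrableD(2)[OF assms(1)]] by metis
qed (rule assms(2))

lemma lnorm_mono:
  assumes "sq_integrable M g" "f \<in> borel_measurable M" "AE x in M. \<bar>f x\<bar> \<le> \<bar>g x\<bar>"
  shows "lnorm M f \<le> lnorm M g"
proof -
  have "AE x in M. (f x)\<^sup>2 \<le> (g x)\<^sup>2"
    using assms(3) by eventually_elim (use abs_le_square_iff in blast)
  then have "(LINT x|M. (f x)\<^sup>2) \<le> (LINT x|M. (g x)\<^sup>2)"
    using sq_integrableD(2)[OF sq_integrable_bound[OF assms]] sq_integrableD(2)[OF assms(1)]
    by (intro integral_mono_AE) auto
  then show ?thesis by (simp add: lnorm_def)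
qed

lemma sq_integrable_mult:
  assumes "sq_integrable M f" "sq_integrable M g"
  shows "integrable M (\<lambda>x. f x * g x)"
proof (rule Bochner_Integration.integrable_bound)
  show "integrable M (\<lambda>x. (f x)\<^sup>2 + (g x)\<^sup>2)"
    using assms[THEN sq_integrableD(2)] by simp
  show "(\<lambda>x. f x * g x) \<in> borel_measurable M"
    using assms[THEN sq_integrableD(1)] by measurable
  have "\<bar>f x * g x\<bar> \<le> (f x)\<^sup>2 + (g x)\<^sup>2" for x
    using sum_squares_bound[of "\<bar>f x\<bar>" "\<bar>g x\<bar>"] mult_nonneg_nonneg[OF abs_ge_zero[of "f x"] abs_ge_zero[of "g x"]]
    unfolding abs_mult by (simp del: mult_nonneg_nonneg)
  then show "AE x in M. norm (f x * g x) \<le> norm ((f x)\<^sup>2 + (g x)\<^sup>2)" by (auto simp: sum_power2_ge_zero)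
qed

lemma sq_integrable_cmult:
  assumes "sq_integrable M f"
  shows "sq_integrable M (\<lambda>x. c * f x)"
  using assms unfolding sq_integrable_def by (auto simp: power_mult_distrib)

lemma sq_integrable_add:
  assumes "sq_integrable M f" "sq_integrable M g"
  shows "sq_integrable M (\<lambda>x. f x + g x)"
  using assms sq_integrable_mult[OF assms] unfolding sq_integrable_def
  by (auto simp: power2_sum mult.assoc)

lemma sq_integrable_diff:
  assumes "sq_integrable M f" "sq_integrable M g"
  shows "sq_integrable M (\<lambda>x. f x - g x)"
  using sq_integrable_add[OF assms(1) sq_integrable_cmult[OF assms(2), of "-1"]] by simp

lemma sq_integrable_zero [simp]: "sq_integrable M (\<lambda>x. 0)"
  by (simp add: sq_integrable_def)

lemma sq_integrable_sum:
  assumes "\<And>i. i \<in> I \<Longrightarrow> sq_integrable M (f i)"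
  shows "sq_integrable M (\<lambda>x. \<Sum>i\<in>I. f i x)"
  using assms by (induction I rule: infinite_finite_induct) (auto intro: sq_integrable_add)

lemma sq_integrable_abs:
  assumes "sq_integrable M f" shows "sq_integrable M (\<lambda>x. \<bar>f x\<bar>)"
  using assms by (auto simp: sq_integrable_def)

lemma sq_integrable_uminus:
  assumes "sq_integrable M f" shows "sq_integrable M (\<lambda>x. - f x)"
  using assms by (auto simp: sq_integrable_def)

text \<open>The discriminant of the nonnegative quadratic \<open>t \<mapsto> \<integral>(t f + g)\<^sup>2\<close> cannot be positive.\<close>

lemma Cauchy_Schwarz_lnorm:
  assumes f: "sq_integrable M f" and g: "sq_integrable M g"
  shows "\<bar>LINT x|M. f x * g x\<bar> \<le> lnorm M f * lnorm M g"
proof -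
  define a b c where "a = (LINT x|M. (f x)\<^sup>2)" and "b = (LINT x|M. f x * g x)"
    and "c = (LINT x|M. (g x)\<^sup>2)"
  note [simp] = sq_integrable_mult[OF f g] sq_integrableD(2)[OF f] sq_integrableD(2)[OF g]
  have ac: "0 \<le> a" "0 \<le> c" by (auto simp: a_def c_def)
  have q: "0 \<le> t\<^sup>2 * a + 2 * t * b + c" for t :: real
  proof -
    have "(LINT x|M. (t * f x + g x)\<^sup>2) = (LINT x|M. t\<^sup>2 * (f x)\<^sup>2 + 2 * t * (f x * g x) + (g x)\<^sup>2)"
      by (intro Bochner_Integration.integral_cong) (auto simp: power2_eq_square algebra_simps)
    also have "\<dots> = t\<^sup>2 * a + 2 * t * b + c"
      by (simp add: a_def b_def c_def)
    finally show ?thesis using Bochner_Integration.integral_nonneg[of M "\<lambda>x. (t * f x + g x)\<^sup>2"] by simp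
  qed
  have "b\<^sup>2 \<le> a * c"
  proof (cases "a = 0")
    case True
    have "b = 0"
    proof (rule ccontr)
      assume "b \<noteq> 0"
      then show False using q[of "- (c + 1) / (2 * b)"] True by (simp add: field_simps)
    qed
    then show ?thesis using True by simp
  next
    case False
    then have "a > 0" using ac by simp
    have "0 \<le> a * (((-b/a)\<^sup>2 * a + 2 * (-b/a) * b + c))" using q[of "-b/a"] \<open>a > 0\<close> by (intro mult_nonneg_nonneg) auto
    also have "\<dots> = a * c - b\<^sup>2" using \<open>a > 0\<close> by (simp add: field_simps power2_eq_square)
    finally show ?thesis by simp
  qed
  then have "\<bar>b\<bar> \<le> sqrt (a * c)" by (simp add: real_le_rsqrt)
  then show ?thesis by (simp add: lnorm_def a_def b_def c_def real_sqrt_mult)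
qed

lemma lnorm_add_le:
  assumes f: "sq_integrable M f" and g: "sq_integrable M g"
  shows "lnorm M (\<lambda>x. f x + g x) \<le> lnorm M f + lnorm M g"
proof (rule power2_le_imp_le)
  note [simp] = sq_integrable_mult[OF f g] sq_integrableD(2)[OF f] sq_integrableD(2)[OF g]
  have "(lnorm M (\<lambda>x. f x + g x))\<^sup>2 = (LINT x|M. (f x)\<^sup>2 + (g x)\<^sup>2 + 2 * (f x * g x))"
    unfolding lnorm_power2 by (intro Bochner_Integration.integral_cong) (auto simp: power2_eq_square algebra_simps)
  also have "\<dots> = (lnorm M f)\<^sup>2 + (lnorm M g)\<^sup>2 + 2 * (LINT x|M. f x * g x)"
    by (simp add: lnorm_power2)
  also have "\<dots> \<le> (lnorm M f + lnorm M g)\<^sup>2"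
    using Cauchy_Schwarz_lnorm[OF f g] by (simp add: power2_sum)
  finally show "(lnorm M (\<lambda>x. f x + g x))\<^sup>2 \<le> (lnorm M f + lnorm M g)\<^sup>2" .
qed simp

lemma lnorm_cmult: "lnorm M (\<lambda>x. c * f x) = \<bar>c\<bar> * lnorm M f"
  by (simp add: lnorm_def power_mult_distrib real_sqrt_mult)

lemma lnorm_uminus [simp]: "lnorm M (\<lambda>x. - f x) = lnorm M f"
  by (simp add: lnorm_def)

lemma lnorm_abs [simp]: "lnorm M (\<lambda>x. \<bar>f x\<bar>) = lnorm M f"
  by (simp add: lnorm_def)

lemma lnorm_zero [simp]: "lnorm M (\<lambda>x. 0) = 0"
  by (simp add: lnorm_def)

lemma lnorm_diff_commute: "lnorm M (\<lambda>x. f x - g x) = lnorm M (\<lambda>x. g x - f x)"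
  by (simp add: lnorm_def power2_commute)

lemma lnorm_diff_le:
  assumes f: "sq_integrable M f" and g: "sq_integrable M g"
  shows "lnorm M (\<lambda>x. f x - g x) \<le> lnorm M f + lnorm M g"
  using lnorm_add_le[OF f sq_integrable_uminus[OF g]] by simp

lemma lnorm_triangle:
  assumes "sq_integrable M f" "sq_integrable M g" "sq_integrable M h"
  shows "lnorm M (\<lambda>x. f x - h x) \<le> lnorm M (\<lambda>x. f x - g x) + lnorm M (\<lambda>x. g x - h x)"
  using lnorm_add_le[OF sq_integrable_diff[OF assms(1,2)] sq_integrable_diff[OF assms(2,3)]] by simp

lemma lnorm_sum_le:
  assumes "\<And>i. i \<in> I \<Longrightarrow> sq_integrable M (f i)"
  shows "lnorm M (\<lambda>x. \<Sum>i\<in>I. f i x) \<le> (\<Sum>i\<in>I. lnorm M (f i))"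
  using assms
proof (induction I rule: infinite_finite_induct)
  case (insert i I)
  have "lnorm M (\<lambda>x. f i x + (\<Sum>i\<in>I. f i x)) \<le> lnorm M (f i) + lnorm M (\<lambda>x. (\<Sum>i\<in>I. f i x))"
    by (intro lnorm_add_le sq_integrable_sum) (use insert in auto)
  then show ?case using insert by simp
qed auto

lemma lnorm_cong_AE:
  assumes "AE x in M. f x = g x" "f \<in> borel_measurable M" "g \<in> borel_measurable M"
  shows "lnorm M f = lnorm M g"
  unfolding lnorm_def by (rule arg_cong[of _ _ sqrt], rule integral_cong_AE) (use assms in auto)

lemma sq_integrable_of_bounded:
  assumes "finite_measure M" "f \<in> borel_measurable M" "\<And>x. x \<in> space M \<Longrightarrow> \<bar>f x\<bar> \<le> C"
  shows "sq_integrable M f"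
proof -
  interpret finite_measure M by fact
  have "sq_integrable M (\<lambda>x. \<bar>C\<bar>)" by (simp add: sq_integrable_def)
  moreover have "AE x in M. \<bar>f x\<bar> \<le> \<bar>\<bar>C\<bar>\<bar>"
  proof (rule AE_I2)
    fix x assume "x \<in> space M"
    from assms(3)[OF this] show "\<bar>f x\<bar> \<le> \<bar>\<bar>C\<bar>\<bar>" by linarith
  qed
  ultimately show ?thesis using assms(2) by (blast intro: sq_integrable_bound)
qed

lemma sq_integrable_imp_integrable:
  assumes "finite_measure M" "sq_integrable M f"
  shows "integrable M f"
proof -
  have "sq_integrable M (\<lambda>x. 1)" using assms(1) by (intro sq_integrable_of_bounded[where C=1]) auto
  from sq_integrable_mult[OF assms(2) this] show ?thesis by simp
qed

lemma integral_abs_le_lnorm: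
  assumes "finite_measure M" "sq_integrable M f"
  shows "(LINT x|M. \<bar>f x\<bar>) \<le> sqrt (measure M (space M)) * lnorm M f"
proof -
  interpret finite_measure M by fact
  have 1: "sq_integrable M (\<lambda>x. 1)" by (intro sq_integrable_of_bounded[where C=1]) (auto simp: assms)
  have "\<bar>LINT x|M. \<bar>f x\<bar> * 1\<bar> \<le> lnorm M (\<lambda>x. \<bar>f x\<bar>) * lnorm M (\<lambda>x. 1)"
    by (rule Cauchy_Schwarz_lnorm[OF sq_integrable_abs[OF assms(2)] 1])
  then show ?thesis by (simp add: lnorm_def mult.commute)
qed

text \<open>A subsequence with summable increments converges almost everywhere, because the sum of the
  absolute increments is integrable; Fatou's lemma turns its pointwise limit into a limit in norm.\<close>

theorem sq_integrable_complete:
  fixes f :: "nat \<Rightarrow> 'a \<Rightarrow> real"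
  assumes fin: "finite_measure M" and f: "\<And>n. sq_integrable M (f n)"
    and cauchy: "\<And>\<epsilon>. \<epsilon> > 0 \<Longrightarrow> \<exists>N. \<forall>m\<ge>N. \<forall>n\<ge>N. lnorm M (\<lambda>x. f m x - f n x) < \<epsilon>"
  obtains g where "sq_integrable M g" "(\<lambda>n. lnorm M (\<lambda>x. f n x - g x)) \<longlonglongrightarrow> 0"
proof -
  interpret finite_measure M by fact
  note fm [measurable] = sq_integrableD(1)[OF f]
  obtain r where r: "strict_mono r" "\<And>j m n. m \<ge> r j \<Longrightarrow> n \<ge> r j \<Longrightarrow> lnorm M (\<lambda>x. f m x - f n x) < (1/2)^j"
  proof -
    have "\<forall>j. \<exists>N. \<forall>m\<ge>N. \<forall>n\<ge>N. lnorm M (\<lambda>x. f m x - f n x) < (1/2)^j" using cauchy by simp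
    then obtain N where N: "\<And>j m n. m \<ge> N j \<Longrightarrow> n \<ge> N j \<Longrightarrow> lnorm M (\<lambda>x. f m x - f n x) < (1/2)^j"
      by metis
    define r where "r j = (\<Sum>i\<le>j. N i) + j" for j
    have "strict_mono r" by (rule strict_monoI_Suc) (simp add: r_def)
    moreover have "r j \<ge> N j" for j
      unfolding r_def using member_le_sum[of j "{..j}" N] by simp
    ultimately show ?thesis using that N le_trans by meson
  qed
  define d where "d j x = \<bar>f (r (Suc j)) x - f (r j) x\<bar>" for j x
  have [measurable]: "d j \<in> borel_measurable M" for j unfolding d_def by measurable
  have dsq: "sq_integrable M (d j)" for j
    unfolding d_def by (intro sq_integrable_abs sq_integrable_diff f)
  have dint: "integrable M (d j)" for j using sq_integrable_imp_integrable[OF fin dsq] .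
  define c where "c = sqrt (measure M (space M))"
  have dle: "(LINT x|M. d j x) \<le> c * (1/2)^j" for j
  proof -
    have "(LINT x|M. \<bar>d j x\<bar>) \<le> c * lnorm M (d j)" unfolding c_def by (rule integral_abs_le_lnorm[OF fin dsq])
    moreover have "lnorm M (d j) = lnorm M (\<lambda>x. f (r (Suc j)) x - f (r j) x)"
      using lnorm_abs[of M "\<lambda>x. f (r (Suc j)) x - f (r j) x"] by (simp add: d_def[abs_def])
    moreover have "\<dots> \<le> (1/2)^j" using r(2)[of j "r (Suc j)" "r j"] strict_mono_mono[OF r(1)] by (simp add: mono_def less_imp_le)
    moreover have "\<bar>d j x\<bar> = d j x" for x by (simp add: d_def)
    ultimately show ?thesis 
      using mult_left_mono[of "lnorm M (d j)" "(1/2)^j" c] by (simp add: c_def)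
  qed
  have "(\<integral>\<^sup>+x. (\<Sum>j. ennreal (d j x)) \<partial>M) = (\<Sum>j. \<integral>\<^sup>+x. ennreal (d j x) \<partial>M)"
    by (rule nn_integral_suminf) simp
  also have "\<dots> \<le> (\<Sum>j. ennreal (c * (1/2)^j))"
  proof (intro suminf_le allI)
    show "(\<integral>\<^sup>+x. ennreal (d j x) \<partial>M) \<le> ennreal (c * (1/2)^j)" for j
      using ennreal_leI[OF dle[of j]] nn_integral_eq_integral[OF dint[of j]] by (simp add: d_def[abs_def])
  qed auto
  also have "\<dots> = ennreal (\<Sum>j. c * (1/2)^j)"
    by (rule suminf_ennreal2) (auto simp: c_def)
  also have "\<dots> < \<infinity>" by simp
  finally have "AE x in M. (\<Sum>j. ennreal (d j x)) \<noteq> \<infinity>"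
    by (intro nn_integral_PInf_AE) auto
  then have conv: "AE x in M. convergent (\<lambda>j. f (r j) x)"
  proof eventually_elim
    case (elim x)
    have "summable (\<lambda>j. d j x)"
      by (rule summable_suminf_not_top) (use elim in \<open>auto simp: d_def\<close>)
    then have "summable (\<lambda>j. f (r (Suc j)) x - f (r j) x)"
      unfolding d_def by (rule summable_rabs_cancel)
    then have "convergent (\<lambda>n. \<Sum>j<n. f (r (Suc j)) x - f (r j) x)" by (simp add: summable_iff_convergent)
    then have "convergent (\<lambda>n. f (r n) x - f (r 0) x)" by (simp add: sum_lessThan_telescope[of "\<lambda>j. f (r j) x"])
    then have "convergent (\<lambda>n. f (r n) x - f (r 0) x + f (r 0) x)" by (intro convergent_add convergent_const)
    then show ?case by simp
  qed
  define g where "g x = lim (\<lambda>j. f (r j) x)" for x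
  have gm [measurable]: "g \<in> borel_measurable M" unfolding g_def by (rule borel_measurable_lim_metric) simp
  have glim: "AE x in M. (\<lambda>j. f (r j) x) \<longlonglongrightarrow> g x"
    using conv by eventually_elim (simp add: g_def convergent_LIMSEQ_iff)
  have key: "(\<integral>\<^sup>+x. ennreal ((f n x - g x)\<^sup>2) \<partial>M) \<le> ennreal (\<epsilon>\<^sup>2)"
    if e: "\<epsilon> > 0" and N: "\<forall>m\<ge>N. \<forall>n\<ge>N. lnorm M (\<lambda>x. f m x - f n x) < \<epsilon>" and n: "n \<ge> N" for n N \<epsilon>
  proof -
    have "(\<integral>\<^sup>+x. ennreal ((f n x - g x)\<^sup>2) \<partial>M) = (\<integral>\<^sup>+x. liminf (\<lambda>j. ennreal ((f n x - f (r j) x)\<^sup>2)) \<partial>M)"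
    proof (rule nn_integral_cong_AE)
      show "AE x in M. ennreal ((f n x - g x)\<^sup>2) = liminf (\<lambda>j. ennreal ((f n x - f (r j) x)\<^sup>2))"
        using glim
      proof eventually_elim
        case (elim x)
        then have "(\<lambda>j. ennreal ((f n x - f (r j) x)\<^sup>2)) \<longlonglongrightarrow> ennreal ((f n x - g x)\<^sup>2)"
          by (intro tendsto_ennrealI tendsto_intros)
        then show ?case by (rule lim_imp_Liminf[symmetric, rotated]) simp
      qed
    qed
    also have "\<dots> \<le> liminf (\<lambda>j. \<integral>\<^sup>+x. ennreal ((f n x - f (r j) x)\<^sup>2) \<partial>M)"
      by (rule nn_integral_liminf) measurable
    also have "\<dots> \<le> ennreal (\<epsilon>\<^sup>2)"
    proof (rule Liminf_le)
      show "\<forall>\<^sub>F j in sequentially. (\<integral>\<^sup>+x. ennreal ((f n x - f (r j) x)\<^sup>2) \<partial>M) \<le> ennreal (\<epsilon>\<^sup>2)"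
        using eventually_ge_at_top[of N]
      proof eventually_elim
        case (elim j)
        then have "r j \<ge> N" using seq_suble[OF r(1), of j] by linarith
        then have "lnorm M (\<lambda>x. f n x - f (r j) x) \<le> \<epsilon>" using N n by (simp add: less_imp_le)
        then have "(LINT x|M. (f n x - f (r j) x)\<^sup>2) \<le> \<epsilon>\<^sup>2"
          unfolding lnorm_power2[symmetric] by (intro power_mono) auto
        then show ?case
          using sq_integrableD(2)[OF sq_integrable_diff[OF f f]]
          by (subst nn_integral_eq_integral) auto
      qed
    qed simp
    finally show ?thesis .
  qed
  have diff: "sq_integrable M (\<lambda>x. f n x - g x) \<and> lnorm M (\<lambda>x. f n x - g x) \<le> \<epsilon>"
    if e: "\<epsilon> > 0" and N: "\<forall>m\<ge>N. \<forall>n\<ge>N. lnorm M (\<lambda>x. f m x - f n x) < \<epsilon>" and n: "n \<ge> N" for n N \<epsilon>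
  proof -
    note k = key[OF that]
    have i: "integrable M (\<lambda>x. (f n x - g x)\<^sup>2)"
      using le_less_trans[OF k] by (intro integrableI_nonneg) auto
    have "(LINT x|M. (f n x - g x)\<^sup>2) \<le> \<epsilon>\<^sup>2"
      using k nn_integral_eq_integral[OF i] by (auto simp: ennreal_le_iff)
    then show ?thesis using i e by (auto simp: sq_integrable_def lnorm_def intro!: real_le_lsqrt)
  qed
  have "sq_integrable M g"
  proof -
    obtain N where N: "\<forall>m\<ge>N. \<forall>n\<ge>N. lnorm M (\<lambda>x. f m x - f n x) < 1" using cauchy[of 1] by auto
    from diff[OF _ N] have "sq_integrable M (\<lambda>x. f N x - g x)" by simp
    from sq_integrable_diff[OF f[of N] this] show ?thesis by simp
  qed
  moreover have "(\<lambda>n. lnorm M (\<lambda>x. f n x - g x)) \<longlonglongrightarrow> 0"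
  proof (rule LIMSEQ_I)
    fix \<epsilon> :: real assume "\<epsilon> > 0"
    then obtain N where "\<forall>m\<ge>N. \<forall>n\<ge>N. lnorm M (\<lambda>x. f m x - f n x) < \<epsilon>/2" using cauchy[of "\<epsilon>/2"] by auto
    from diff[OF _ this] \<open>\<epsilon> > 0\<close> have "\<forall>n\<ge>N. lnorm M (\<lambda>x. f n x - g x) \<le> \<epsilon>/2" by simp
    with \<open>\<epsilon> > 0\<close> show "\<exists>N. \<forall>n\<ge>N. norm (lnorm M (\<lambda>x. f n x - g x) - 0) < \<epsilon>"
      by (intro exI[of _ N]) (auto intro: le_less_trans)
  qed
  ultimately show ?thesis by (rule that)
qed

section \<open>Integration by parts on the torus and the Hartley functions\<close>

lemma finite_measure_torus: "finite_measure (torus :: (real^'d) measure)"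
  by (rule finite_measure_lebesgue_on) simp

lemma measure_torus: "measure (torus :: (real^'d) measure) (space torus) = 1"
proof -
  have "measure (torus :: (real^'d) measure) (space torus) = measure lebesgue (cbox 0 (1::real^'d))"
    by (simp add: measure_restrict_space)
  also have "\<dots> = (\<Prod>b\<in>Basis. (1::real^'d) \<bullet> b - 0 \<bullet> b)"
    by (subst measure_completion) (auto simp: measure_lborel_cbox_eq inner_Basis Basis_vec_def inner_axis)
  also have "\<dots> = 1" by (intro prod.neutral) (auto simp: Basis_vec_def inner_axis)
  finally show ?thesis .
qed

lemma continuous_imp_measurable_torus:
  fixes f :: "real^'d \<Rightarrow> 'b::euclidean_space"
  assumes "continuous_on UNIV f"
  shows "f \<in> borel_measurable torus"
  using continuous_on_subset[OF assms] by (intro continuous_imp_measurable_on_sets_lebesgue) auto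

lemma GDERIV_imp_continuous:
  assumes "\<And>x. GDERIV f x :> g x" shows "continuous_on UNIV f"
  by (meson assms gderiv_def has_derivative_continuous continuous_at_imp_continuous_on)

lemma has_derivative_GDERIV_iff: "GDERIV f x :> D \<longleftrightarrow> (f has_derivative (\<lambda>h. h \<bullet> D)) (at x)"
  by (simp add: gderiv_def inner_commute)

text \<open>Fubini's theorem integrates first along the chosen axis, where the fundamental theorem of
  calculus leaves the difference of two values that agree by periodicity.\<close>

lemma torus_integral_partial_derivative:
  fixes f :: "real^'d \<Rightarrow> real"
  assumes deriv: "\<And>x. GDERIV f x :> g x" and cont: "continuous_on UNIV (\<lambda>x. g x $ i)"
    and per: "\<And>x. f (x + axis i 1) = f x"
  shows "(LINT x|torus. g x $ i) = 0"
proof -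
  let ?C = "cbox 0 (1::real^'d)"
  let ?b = "axis i 1 :: real^'d"
  define G where "G x = indicator ?C x *\<^sub>R (g x $ i)" for x
  have gm [measurable]: "(\<lambda>x. g x $ i) \<in> borel_measurable borel"
    using cont by (rule borel_measurable_continuous_onI)
  have Gm [measurable]: "G \<in> borel_measurable borel"
    unfolding G_def by measurable
  have "(LINT x|torus. g x $ i) = integral\<^sup>L lebesgue G"
    unfolding G_def by (subst integral_restrict_space) auto
  also have "\<dots> = integral\<^sup>L lborel G"
    by (rule integral_completion) simp
  finally have 1: "(LINT x|torus. g x $ i) = integral\<^sup>L lborel G" .
  have Gint: "integrable lborel G"
    unfolding G_def by (rule borel_integrable_compact) (auto intro: continuous_on_subset[OF cont])
  define S where "S f = (\<Sum>b\<in>Basis. f b *\<^sub>R b)" for f :: "real^'d \<Rightarrow> real"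
  let ?P = "\<Pi>\<^sub>M b\<in>(Basis::(real^'d) set). (lborel :: real measure)"
  have Sm: "S \<in> measurable ?P borel" unfolding S_def by measurable
  have lb: "lborel = distr ?P borel S" unfolding S_def by (rule lborel_eq)
  have bB: "?b \<in> Basis" by (auto simp: Basis_vec_def)
  then have ins: "insert ?b (Basis - {?b}) = Basis" by auto
  interpret product_sigma_finite "\<lambda>b::real^'d. lborel :: real measure" ..
  have int: "integrable ?P (\<lambda>x. G (S x))"
    using Gint by (subst (asm) lb, subst (asm) integrable_distr_eq) (use Sm in auto)
  have "integral\<^sup>L lborel G = integral\<^sup>L ?P (\<lambda>x. G (S x))"
    by (subst lb, rule integral_distr) (use Sm in auto)
  also have "\<dots> = (\<integral>x. (\<integral>y. G (S (x(?b := y))) \<partial>lborel) \<partial>(\<Pi>\<^sub>M b\<in>Basis - {?b}. lborel))"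
    using product_integral_insert[of "Basis - {?b}" ?b "\<lambda>x. G (S x)"] int unfolding ins by simp
  also have "\<dots> = (\<integral>x. (0::real) \<partial>(\<Pi>\<^sub>M b\<in>Basis - {?b}. (lborel::real measure)))"
  proof (rule Bochner_Integration.integral_cong[OF refl])
    fix x :: "real^'d \<Rightarrow> real"
    define z where "z = (\<Sum>b\<in>Basis - {?b}. x b *\<^sub>R b)"
    have Su: "S (x(?b := y)) = z + y *\<^sub>R ?b" for y
    proof -
      have "S (x(?b := y)) = y *\<^sub>R ?b + (\<Sum>b\<in>Basis - {?b}. (x(?b := y)) b *\<^sub>R b)"
        unfolding S_def by (subst sum.remove[OF _ bB]) auto
      also have "(\<Sum>b\<in>Basis - {?b}. (x(?b := y)) b *\<^sub>R b) = z"
        unfolding z_def by (rule sum.cong) auto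
      finally show ?thesis by (simp only: add.commute)
    qed
    have "b $ i = 0" if b: "b \<in> Basis - {?b}" for b :: "real^'d"
    proof -
      obtain j where "b = axis j (1::real)" using b by (auto simp: Basis_vec_def)
      with b show ?thesis by (cases "j = i") (auto simp: axis_def)
    qed
    then have zi: "z $ i = 0" unfolding z_def by (auto intro!: sum.neutral)
    have ind: "indicator ?C (z + y *\<^sub>R ?b) = (indicator {0..1} y * indicator {w. \<forall>j. j \<noteq> i \<longrightarrow> 0 \<le> w $ j \<and> w $ j \<le> 1} z :: real)" for y
      using zi by (auto simp: indicator_def mem_box_cart axis_def) 
    have d: "((\<lambda>y. f (z + y *\<^sub>R ?b)) has_real_derivative (g (z + y *\<^sub>R ?b) $ i)) (at y)" for y
    proof -
      have "((\<lambda>y. f (z + y *\<^sub>R ?b)) has_derivative (\<lambda>h. (h *\<^sub>R ?b) \<bullet> g (z + y *\<^sub>R ?b))) (at y)"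
        by (rule has_derivative_compose[of "\<lambda>y. z + y *\<^sub>R ?b" _ _ _ f "\<lambda>h. h \<bullet> g (z + y *\<^sub>R ?b)"])
           (auto intro!: derivative_eq_intros simp: deriv[unfolded has_derivative_GDERIV_iff])
      moreover have "(\<lambda>h. (h *\<^sub>R ?b) \<bullet> g (z + y *\<^sub>R ?b)) = (*) (g (z + y *\<^sub>R ?b) $ i)"
        by (simp add: fun_eq_iff inner_commute[of ?b] inner_axis)
      ultimately show ?thesis by (simp add: has_field_derivative_def)
    qed
    have c: "isCont (\<lambda>y. g (z + y *\<^sub>R ?b) $ i) y" for y
    proof -
      have "continuous_on UNIV (\<lambda>y. g (z + y *\<^sub>R ?b) $ i)"
        by (rule continuous_on_compose2[OF cont]) (auto intro!: continuous_intros)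
      then show ?thesis by (simp add: continuous_on_eq_continuous_at)
    qed
    have "(\<integral>y. g (z + y *\<^sub>R ?b) $ i * indicator {0..1} y \<partial>lborel) = f (z + 1 *\<^sub>R ?b) - f (z + 0 *\<^sub>R ?b)"
      by (rule integral_FTC_Icc_real) (use d c in auto)
    also have "\<dots> = 0" using per[of z] by simp
    finally have 0: "(\<integral>y. g (z + y *\<^sub>R ?b) $ i * indicator {0..1} y \<partial>lborel) = 0" .
    have "(\<integral>y. G (S (x(?b := y))) \<partial>lborel)
        = (\<integral>y. indicator {w. \<forall>j. j \<noteq> i \<longrightarrow> 0 \<le> w $ j \<and> w $ j \<le> 1} z * (g (z + y *\<^sub>R ?b) $ i * indicator {0..1} y) \<partial>lborel)"
      unfolding G_def Su ind by (intro Bochner_Integration.integral_cong) auto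
    also have "\<dots> = 0" by (simp add: 0)
    finally show "(\<integral>y. G (S (x(?b := y))) \<partial>lborel) = 0" .
  qed
  finally show ?thesis using 1 by simp
qed

definition phase :: "int^'d \<Rightarrow> real^'d \<Rightarrow> real" where
  "phase \<kappa> x = 2 * pi * (\<Sum>i\<in>UNIV. of_int (\<kappa> $ i) * x $ i)"

text \<open>Hartley's function cas = cos + sin. The functions \<open>hartley \<kappa>\<close> form an orthonormal basis of
  real functions indexed by the full lattice, closed under differentiation up to a sign of the
  index; cosines and sines would need a choice of one frequency from each pair \<open>\<plusminus>\<kappa>\<close>.\<close>

definition hartley :: "int^'d \<Rightarrow> real^'d \<Rightarrow> real" where
  "hartley \<kappa> x = cos (phase \<kappa> x) + sin (phase \<kappa> x)"

lemma phase_uminus: "phase (- \<kappa>) x = - phase \<kappa> x"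
  by (simp add: phase_def sum_negf)

lemma phase_add: "phase (\<kappa> + \<mu>) x = phase \<kappa> x + phase \<mu> x"
  by (simp add: phase_def sum.distrib algebra_simps)

lemma phase_diff: "phase (\<kappa> - \<mu>) x = phase \<kappa> x - phase \<mu> x"
  using phase_add[of \<kappa> "-\<mu>" x] by (simp add: phase_uminus)

lemma phase_translate:
  fixes \<kappa> :: "int^'d"
  shows "phase \<kappa> (x + axis i 1) = phase \<kappa> x + 2 * pi * of_int (\<kappa> $ i)"
proof -
  have "(\<Sum>j\<in>UNIV. of_int (\<kappa> $ j) * (axis i 1 :: real^'d) $ j) = (of_int (\<kappa> $ i) :: real)"
    by (simp add: axis_def if_distrib cong: if_cong)
  then show ?thesis by (simp add: phase_def sum.distrib algebra_simps)
qed

lemma cos_sin_phase_translate [simp]: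
  "cos (phase \<kappa> (x + axis i 1)) = cos (phase \<kappa> x)" "sin (phase \<kappa> (x + axis i 1)) = sin (phase \<kappa> x)"
  unfolding phase_translate using sin_cos_eq_iff[of "phase \<kappa> x + 2 * pi * of_int (\<kappa> $ i)" "phase \<kappa> x"] by auto

lemma hartley_translate [simp]: "hartley \<kappa> (x + axis i 1) = hartley \<kappa> x"
  by (simp add: hartley_def)

definition freq :: "int^'d \<Rightarrow> 'd \<Rightarrow> real" where
  "freq \<kappa> i = 2 * pi * of_int (\<kappa> $ i)"

lemma freq_uminus [simp]: "freq (- \<kappa>) i = - freq \<kappa> i"
  by (simp add: freq_def)

lemma GDERIV_phase:
  fixes \<kappa> :: "int^'d"
  shows "GDERIV (phase \<kappa>) x :> (\<chi> i. freq \<kappa> i)"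
proof -
  have "(phase \<kappa> has_derivative (\<lambda>h. 2 * pi * (\<Sum>i\<in>UNIV. of_int (\<kappa> $ i) * h $ i))) (at x)"
    unfolding phase_def by (intro bounded_linear_imp_has_derivative bounded_linear_intros bounded_linear_vec_nth)
  moreover have "(\<lambda>h. 2 * pi * (\<Sum>i\<in>UNIV. of_int (\<kappa> $ i) * h $ i)) = (\<lambda>h::real^'d. h \<bullet> (\<chi> i. freq \<kappa> i))"
    by (auto simp: inner_vec_def fun_eq_iff sum_distrib_left freq_def mult_ac)
  ultimately show ?thesis unfolding has_derivative_GDERIV_iff by simp
qed

lemma GDERIV_hartley: "GDERIV (hartley \<kappa>) x :> (\<chi> i. freq \<kappa> i * hartley (- \<kappa>) x)"
proof -
  have "GDERIV (\<lambda>x. cos (phase \<kappa> x) + sin (phase \<kappa> x)) x :> (- sin (phase \<kappa> x)) *\<^sub>R (\<chi> i. freq \<kappa> i) + cos (phase \<kappa> x) *\<^sub>R (\<chi> i. freq \<kappa> i)"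
    by (intro GDERIV_add GDERIV_DERIV_compose[OF GDERIV_phase]) (auto intro!: derivative_eq_intros)
  also have "(- sin (phase \<kappa> x)) *\<^sub>R (\<chi> i. freq \<kappa> i) + cos (phase \<kappa> x) *\<^sub>R (\<chi> i. freq \<kappa> i) = (\<chi> i. freq \<kappa> i * hartley (- \<kappa>) x)"
    by (simp add: vec_eq_iff hartley_def phase_uminus algebra_simps)
  finally show ?thesis by (simp add: hartley_def[abs_def])
qed

lemma continuous_on_hartley: "continuous_on S (hartley \<kappa>)"
  using GDERIV_imp_continuous[OF GDERIV_hartley] continuous_on_subset by blast

lemma Ck_hartley: "Ck k (\<lambda>x. a * hartley \<kappa> x)"
proof (induction k arbitrary: a \<kappa>)
  case 0 then show ?case by (auto intro!: continuous_intros continuous_on_hartley)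
next
  case (Suc k)
  have "GDERIV (\<lambda>x. a * hartley \<kappa> x) x :> (\<chi> i. (a * freq \<kappa> i) * hartley (- \<kappa>) x)" for x
  proof -
    have "GDERIV (\<lambda>x. a * hartley \<kappa> x) x :> a *\<^sub>R (\<chi> i. freq \<kappa> i * hartley (- \<kappa>) x) + hartley \<kappa> x *\<^sub>R 0"
      by (intro GDERIV_mult GDERIV_const GDERIV_hartley)
    then show ?thesis by (rule GDERIV_subst) (simp add: vec_eq_iff)
  qed
  then show ?case unfolding Ck.simps using Suc.IH by (intro exI[of _ "\<lambda>x. (\<chi> i. (a * freq \<kappa> i) * hartley (- \<kappa>) x)"]) auto
qed

lemma hartley_Cinf_torus: "hartley \<kappa> \<in> Cinf_torus"
  using Ck_hartley[of _ 1 \<kappa>] by (simp add: Cinf_torus_def)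

lemma grad_eq: "GDERIV f x :> D \<Longrightarrow> grad f x = D"
  unfolding grad_def
proof (rule the_equality, assumption)
  fix D' assume "GDERIV f x :> D" "GDERIV f x :> D'"
  then have "(\<lambda>h. h \<bullet> D) = (\<lambda>h. h \<bullet> D')"
    unfolding has_derivative_GDERIV_iff by (rule has_derivative_unique)
  then have "h \<bullet> (D - D') = 0" for h by (simp add: fun_eq_iff inner_diff_right)
  from this[of "D - D'"] show "D' = D" by simp
qed

lemma grad_hartley: "grad (hartley \<kappa>) x $ i = freq \<kappa> i * hartley (- \<kappa>) x"
  using grad_eq[OF GDERIV_hartley] by (metis vec_lambda_beta)

lemma Cinf_torus_GDERIV:
  assumes "\<phi> \<in> Cinf_torus"
  shows "GDERIV \<phi> x :> grad \<phi> x" "continuous_on UNIV (\<lambda>x. grad \<phi> x $ i)" "\<phi> (x + axis i 1) = \<phi> x"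
    "continuous_on UNIV \<phi>"
proof -
  have "Ck (Suc 0) \<phi>" using assms by (simp only: Cinf_torus_def mem_Collect_eq)
  then obtain g where g: "\<And>x. GDERIV \<phi> x :> g x" "\<And>i. continuous_on UNIV (\<lambda>x. g x $ i)" by auto
  have "grad \<phi> = g" using grad_eq[OF g(1)] by blast
  then show "GDERIV \<phi> x :> grad \<phi> x" "continuous_on UNIV (\<lambda>x. grad \<phi> x $ i)" using g by auto
  show "\<phi> (x + axis i 1) = \<phi> x" using assms by (simp add: Cinf_torus_def)
  show "continuous_on UNIV \<phi>" using GDERIV_imp_continuous g by blast
qed

lemma sq_integrable_continuous:
  fixes f :: "real^'d \<Rightarrow> real"
  assumes "continuous_on UNIV f" shows "sq_integrable torus f"
proof -
  have "compact (f ` cbox 0 1)" using continuous_on_subset[OF assms] by (intro compact_continuous_image) auto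
  then obtain C where "\<forall>y\<in>f ` cbox 0 1. norm y \<le> C" using compact_imp_bounded bounded_iff by metis
  then show ?thesis
    by (intro sq_integrable_of_bounded[where C=C] finite_measure_torus continuous_imp_measurable_torus assms) auto
qed

lemma sq_integrable_hartley: "sq_integrable torus (hartley \<kappa>)"
  by (intro sq_integrable_continuous continuous_on_hartley)

lemma hartley_measurable [measurable]: "hartley \<kappa> \<in> borel_measurable torus"
  using sq_integrable_hartley by (rule sq_integrableD)

lemma abs_hartley_le: "\<bar>hartley \<kappa> x\<bar> \<le> 2"
  unfolding hartley_def by (rule order_trans[OF abs_triangle_ineq]) (use abs_cos_le_one[of "phase \<kappa> x"] abs_sin_le_one[of "phase \<kappa> x"] in linarith)

lemma torus_by_parts:
  assumes "f \<in> Cinf_torus" "g \<in> Cinf_torus"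
  shows "(LINT x|torus. f x * grad g x $ i) = - (LINT x|torus. grad f x $ i * g x)"
proof -
  note f = Cinf_torus_GDERIV[OF assms(1)] and g = Cinf_torus_GDERIV[OF assms(2)]
  have "(LINT x|torus. (f x *\<^sub>R grad g x + g x *\<^sub>R grad f x) $ i) = 0"
  proof (rule torus_integral_partial_derivative)
    show "GDERIV (\<lambda>x. f x * g x) x :> f x *\<^sub>R grad g x + g x *\<^sub>R grad f x" for x
      by (intro GDERIV_mult f g)
    show "continuous_on UNIV (\<lambda>x. (f x *\<^sub>R grad g x + g x *\<^sub>R grad f x) $ i)"
      using f(2,4) g(2,4) by (simp add: continuous_on_add continuous_on_mult)
  qed (simp add: f g)
  moreover have "integrable torus (\<lambda>x. f x * grad g x $ i)" "integrable torus (\<lambda>x. grad f x $ i * g x)"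
    by (intro sq_integrable_mult sq_integrable_continuous f(2,4) g(2,4))+
  ultimately show ?thesis by (simp add: mult.commute)
qed

text \<open>Up to a factor, a nonconstant cosine or sine of the phase is a partial derivative of a periodic function.\<close>

lemma integral_trig_phase:
  fixes \<kappa> :: "int^'d"
  shows "(LINT x|torus. cos (phase \<kappa> x)) = (if \<kappa> = 0 then 1 else 0)"
    and "(LINT x|torus. sin (phase \<kappa> x)) = 0"
proof -
  have 0: "phase 0 x = 0" for x :: "real^'d" by (simp add: phase_def)
  have "(LINT x|torus. cos (phase \<kappa> x)) = 0 \<and> (LINT x|torus. sin (phase \<kappa> x)) = 0" if nz0: "\<kappa> \<noteq> 0"
  proof -
    obtain i where i: "\<kappa> $ i \<noteq> 0" using nz0 by (auto simp: vec_eq_iff)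
    then have nz: "freq \<kappa> i \<noteq> 0" by (simp add: freq_def)
    have cont: "continuous_on UNIV (phase \<kappa>)" using GDERIV_imp_continuous[OF GDERIV_phase] .
    have ds: "GDERIV (\<lambda>x. sin (phase \<kappa> x)) x :> cos (phase \<kappa> x) *\<^sub>R (\<chi> i. freq \<kappa> i)"
      and dc: "GDERIV (\<lambda>x. cos (phase \<kappa> x)) x :> - sin (phase \<kappa> x) *\<^sub>R (\<chi> i. freq \<kappa> i)" for x
      by (rule GDERIV_DERIV_compose[OF GDERIV_phase], rule DERIV_sin)
         (rule GDERIV_DERIV_compose[OF GDERIV_phase], rule DERIV_cos)
    have "(LINT x|torus. (cos (phase \<kappa> x) *\<^sub>R (\<chi> i. freq \<kappa> i)) $ i) = 0"
      by (rule torus_integral_partial_derivative[of "\<lambda>x. sin (phase \<kappa> x)"])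
         (auto intro!: ds continuous_intros cont)
    moreover have "(LINT x|torus. (- sin (phase \<kappa> x) *\<^sub>R (\<chi> i. freq \<kappa> i)) $ i) = 0"
      by (rule torus_integral_partial_derivative[of "\<lambda>x. cos (phase \<kappa> x)"])
         (rule dc, auto intro!: continuous_intros cont)
    ultimately show ?thesis using nz by simp
  qed
  then show "(LINT x|torus. cos (phase \<kappa> x)) = (if \<kappa> = 0 then 1 else 0)" "(LINT x|torus. sin (phase \<kappa> x)) = 0"
    using measure_torus[where 'd='d] by (cases "\<kappa> = 0"; auto simp: 0)+
qed

text \<open>Since cas a cas b = cos (a - b) + sin (a + b), only the frequency zero survives.\<close>

lemma hartley_orthonormal:
  "(LINT x|torus. hartley \<kappa> x * hartley \<mu> x) = (if \<kappa> = \<mu> then 1 else 0)"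
proof -
  have "hartley \<kappa> x * hartley \<mu> x = cos (phase (\<kappa> - \<mu>) x) + sin (phase (\<kappa> + \<mu>) x)" for x
    by (simp add: hartley_def phase_diff phase_add cos_diff sin_add algebra_simps)
  moreover have "integrable torus (\<lambda>x. cos (phase \<kappa> x))" "integrable torus (\<lambda>x. sin (phase \<kappa> x))" for \<kappa> :: "int^'a"
    using GDERIV_imp_continuous[OF GDERIV_phase]
    by (auto intro!: sq_integrable_imp_integrable[OF finite_measure_torus] sq_integrable_continuous continuous_intros)
  ultimately show ?thesis by (simp add: integral_trig_phase)
qed

section \<open>Completeness of the Hartley functions\<close>

text \<open>The embedding of the torus as a product of circles; under it trigonometric polynomials are the
  restrictions of ordinary polynomials.\<close>

definition circle_coords :: "real^'d \<Rightarrow> (real^'d) \<times> (real^'d)" where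
  "circle_coords x = ((\<chi> i. cos (2 * pi * x $ i)), (\<chi> i. sin (2 * pi * x $ i)))"

lemma continuous_on_circle_coords: "continuous_on S circle_coords"
  unfolding circle_coords_def by (auto intro!: continuous_intros)

lemma circle_coords_eq_imp:
  assumes "circle_coords x = circle_coords y" "x \<in> cbox 0 1" "y \<in> box 0 (1::real^'d)"
  shows "x = y"
proof (rule vec_eq_iff[THEN iffD2], rule allI)
  fix i
  have "cos (2 * pi * x $ i) = cos (2 * pi * y $ i)" "sin (2 * pi * x $ i) = sin (2 * pi * y $ i)"
    using assms(1) by (auto simp: circle_coords_def vec_eq_iff)
  then obtain n :: int where n: "2 * pi * x $ i = 2 * pi * y $ i + 2 * pi * n"
    using sin_cos_eq_iff[of "2 * pi * x $ i" "2 * pi * y $ i"] by auto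
  then have "2 * pi * x $ i = 2 * pi * (y $ i + n)" by (simp add: algebra_simps)
  then have e: "x $ i = y $ i + n" by simp
  moreover have "0 \<le> x $ i" "x $ i \<le> 1" "0 < y $ i" "y $ i < 1"
    using assms(2,3) by (auto simp: mem_box_cart)
  ultimately have "-1 < real_of_int n" "real_of_int n < 1" by linarith+
  then have "n = 0" by linarith
  then show "x $ i = y $ i" using e by simp
qed

lemma hartley_times_cos:
  "hartley \<kappa> x * cos (phase \<mu> x) = (hartley (\<kappa> + \<mu>) x + hartley (\<kappa> - \<mu>) x) / 2"
  by (simp add: hartley_def phase_add phase_diff cos_add cos_diff sin_add sin_diff algebra_simps)

lemma hartley_times_sin:
  "hartley \<kappa> x * sin (phase \<mu> x) = (hartley (\<mu> - \<kappa>) x - hartley (- \<kappa> - \<mu>) x) / 2"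
proof -
  have "- \<kappa> - \<mu> = - (\<kappa> + \<mu>)" by simp
  then show ?thesis
    by (simp only: hartley_def phase_uminus phase_add phase_diff cos_add cos_diff sin_add sin_diff cos_minus sin_minus)
       (simp add: algebra_simps)
qed

lemma phase_axis: "phase (axis i 1) x = 2 * pi * x $ i"
  by (simp add: phase_def axis_def if_distrib[of "\<lambda>z. z * _"] if_distrib[of of_int] cong: if_cong)

lemma linear_circle_coords:
  fixes p :: "(real^'d) \<times> (real^'d) \<Rightarrow> real"
  assumes "linear p"
  shows "p (circle_coords x) = (\<Sum>i\<in>UNIV. p (axis i 1, 0) * cos (phase (axis i 1) x) + p (0, axis i 1) * sin (phase (axis i 1) x))"
proof -
  have "circle_coords x = (\<Sum>i\<in>UNIV. cos (phase (axis i 1) x) *\<^sub>R (axis i 1, 0) + sin (phase (axis i 1) x) *\<^sub>R (0, axis i 1))"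
    by (intro prod_eqI; simp add: circle_coords_def fst_sum snd_sum phase_axis vec_eq_iff;
        simp add: axis_def if_distrib cong: if_cong)
  then show ?thesis
    by (simp only: linear_sum[OF assms] linear_add[OF assms] linear_scale[OF assms]) (simp add: mult.commute)
qed

context
  fixes f :: "real^'d \<Rightarrow> real"
  assumes f: "sq_integrable torus f" and orth: "\<And>\<kappa>. (LINT x|torus. f x * hartley \<kappa> x) = 0"
begin

text \<open>The class of multipliers that keep f orthogonal to all Hartley functions. Testing against every index,
  and not only the constant, makes the class stable under multiplication by sines and cosines.\<close>

definition annihilated :: "(real^'d \<Rightarrow> real) \<Rightarrow> bool" where
  "annihilated g \<longleftrightarrow> continuous_on UNIV g \<and> (\<forall>\<kappa>. (LINT x|torus. f x * (g x * hartley \<kappa> x)) = 0)"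

lemma integrable_times_continuous: "continuous_on UNIV g \<Longrightarrow> integrable torus (\<lambda>x. f x * g x)"
  by (rule sq_integrable_mult[OF f]) (rule sq_integrable_continuous)

lemma annihilated_integrable: "annihilated g \<Longrightarrow> integrable torus (\<lambda>x. f x * (g x * hartley \<kappa> x))"
  unfolding annihilated_def by (intro integrable_times_continuous continuous_on_mult continuous_on_hartley) auto

lemma annihilated_add:
  assumes "annihilated g" "annihilated h" shows "annihilated (\<lambda>x. g x + h x)"
proof -
  have "(LINT x|torus. f x * ((g x + h x) * hartley \<kappa> x)) = (LINT x|torus. f x * (g x * hartley \<kappa> x) + f x * (h x * hartley \<kappa> x))" for \<kappa>
    by (intro Bochner_Integration.integral_cong) (auto simp: algebra_simps)
  then show ?thesis using assms annihilated_integrable[OF assms(1)] annihilated_integrable[OF assms(2)]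
    by (auto simp: annihilated_def intro!: continuous_on_add)
qed

lemma annihilated_cmult:
  assumes "annihilated g" shows "annihilated (\<lambda>x. c * g x)"
proof -
  have "(LINT x|torus. f x * ((c * g x) * hartley \<kappa> x)) = (LINT x|torus. c * (f x * (g x * hartley \<kappa> x)))" for \<kappa>
    by (intro Bochner_Integration.integral_cong) (auto simp: algebra_simps)
  then show ?thesis using assms by (auto simp: annihilated_def intro!: continuous_on_mult continuous_intros)
qed

lemma annihilated_sum:
  assumes "\<And>i. i \<in> I \<Longrightarrow> annihilated (g i)" shows "annihilated (\<lambda>x. \<Sum>i\<in>I. g i x)"
  using assms
proof (induction I rule: infinite_finite_induct)
  case (insert i I) then show ?case by (simp add: annihilated_add)
qed (auto simp: annihilated_def)

lemma annihilated_trig: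
  assumes "annihilated g"
  shows "annihilated (\<lambda>x. cos (phase \<mu> x) * g x)" "annihilated (\<lambda>x. sin (phase \<mu> x) * g x)"
proof -
  note [simp] = annihilated_integrable[OF assms]
  have c: "continuous_on UNIV (phase \<mu>)" using GDERIV_imp_continuous[OF GDERIV_phase] .
  have z: "(LINT x|torus. f x * (g x * hartley \<kappa> x)) = 0" for \<kappa> using assms by (simp add: annihilated_def)
  have "(LINT x|torus. f x * ((cos (phase \<mu> x) * g x) * hartley \<kappa> x))
     = (LINT x|torus. (f x * (g x * hartley (\<kappa> + \<mu>) x) + f x * (g x * hartley (\<kappa> - \<mu>) x)) / 2)" for \<kappa>
  proof (intro Bochner_Integration.integral_cong refl)
    fix x
    have "f x * ((cos (phase \<mu> x) * g x) * hartley \<kappa> x) = f x * (g x * (hartley \<kappa> x * cos (phase \<mu> x)))" by (simp add: mult_ac)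
    then show "f x * ((cos (phase \<mu> x) * g x) * hartley \<kappa> x) = (f x * (g x * hartley (\<kappa> + \<mu>) x) + f x * (g x * hartley (\<kappa> - \<mu>) x)) / 2"
      unfolding hartley_times_cos by (simp add: algebra_simps add_divide_distrib)
  qed
  then show "annihilated (\<lambda>x. cos (phase \<mu> x) * g x)" using assms c
    unfolding annihilated_def by (auto simp: z intro!: continuous_intros)
  have "(LINT x|torus. f x * ((sin (phase \<mu> x) * g x) * hartley \<kappa> x))
     = (LINT x|torus. (f x * (g x * hartley (\<mu> - \<kappa>) x) - f x * (g x * hartley (- \<kappa> - \<mu>) x)) / 2)" for \<kappa>
  proof (intro Bochner_Integration.integral_cong refl)
    fix x
    have "f x * ((sin (phase \<mu> x) * g x) * hartley \<kappa> x) = f x * (g x * (hartley \<kappa> x * sin (phase \<mu> x)))" by (simp add: mult_ac)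
    then show "f x * ((sin (phase \<mu> x) * g x) * hartley \<kappa> x) = (f x * (g x * hartley (\<mu> - \<kappa>) x) - f x * (g x * hartley (- \<kappa> - \<mu>) x)) / 2"
      unfolding hartley_times_sin by (simp add: algebra_simps diff_divide_distrib)
  qed
  then show "annihilated (\<lambda>x. sin (phase \<mu> x) * g x)" using assms c
    unfolding annihilated_def by (auto simp: z intro!: continuous_intros)
qed

lemma annihilated_polynomial:
  assumes "real_polynomial_function p" "annihilated g"
  shows "annihilated (\<lambda>x. p (circle_coords x) * g x)"
  using assms
proof (induction p arbitrary: g rule: real_polynomial_function.induct)
  case (linear p)
  have "annihilated (\<lambda>x. \<Sum>i\<in>UNIV. p (axis i 1, 0) * (cos (phase (axis i 1) x) * g x) + p (0, axis i 1) * (sin (phase (axis i 1) x) * g x))"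
    by (intro annihilated_sum annihilated_add annihilated_cmult annihilated_trig linear)
  then show ?case unfolding linear_circle_coords[OF bounded_linear.linear[OF linear(1)]]
    by (simp add: sum_distrib_left sum_distrib_right algebra_simps)
next
  case (const c) then show ?case by (rule annihilated_cmult)
next
  case (add p q)
  then show ?case using annihilated_add[OF add.IH(1) add.IH(2)] by (simp add: algebra_simps)
next
  case (mult p q)
  then show ?case using mult.IH(1)[OF mult.IH(2)] by (simp add: mult.assoc)
qed

lemma orthogonal_polynomial:
  assumes "real_polynomial_function p"
  shows "(LINT x|torus. f x * p (circle_coords x)) = 0"
proof -
  have "hartley 0 x = 1" for x :: "real^'d" by (simp add: hartley_def phase_def)
  moreover have "annihilated (\<lambda>x. 1)" using orth by (simp add: annihilated_def)
  from annihilated_polynomial[OF assms this]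
  have "(LINT x|torus. f x * (p (circle_coords x) * 1 * hartley 0 x)) = 0" unfolding annihilated_def by blast
  ultimately show ?thesis by simp
qed

text \<open>On the compact image of the cube, polynomials are uniformly dense by the Stone--Weierstrass
  theorem.\<close>

lemma orthogonal_continuous:
  assumes F: "continuous_on UNIV F"
  shows "(LINT x|torus. f x * F (circle_coords x)) = 0"
proof -
  let ?S = "circle_coords ` cbox 0 (1::real^'d)"
  let ?I = "LINT x|torus. \<bar>f x\<bar>"
  have S: "compact ?S" by (intro compact_continuous_image continuous_on_circle_coords) simp
  have fi: "integrable torus (\<lambda>x. \<bar>f x\<bar>)"
    using sq_integrable_imp_integrable[OF finite_measure_torus f] by simp
  have cF: "continuous_on UNIV (\<lambda>x. F (circle_coords x))"
    using continuous_on_compose2[OF F continuous_on_circle_coords] by simp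
  have "\<bar>LINT x|torus. f x * F (circle_coords x)\<bar> \<le> e * ?I" if e: "e > 0" for e
  proof -
    obtain p where p: "real_polynomial_function p" "\<And>y. y \<in> ?S \<Longrightarrow> \<bar>F y - p y\<bar> < e"
      using Stone_Weierstrass_real_polynomial_function[OF S continuous_on_subset[OF F] e] by auto
    have cp: "continuous_on UNIV (\<lambda>x. p (circle_coords x))"
    proof (rule continuous_on_compose2[OF _ continuous_on_circle_coords])
      show "continuous_on UNIV p"
        using continuous_real_polymonial_function[OF p(1)] by (simp add: continuous_at_imp_continuous_on)
    qed simp
    note i = integrable_times_continuous[OF cF] integrable_times_continuous[OF cp]
    have "(LINT x|torus. f x * F (circle_coords x)) = (LINT x|torus. f x * (F (circle_coords x) - p (circle_coords x)))"
      using i orthogonal_polynomial[OF p(1)] by (simp add: right_diff_distrib)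
    also have "\<bar>\<dots>\<bar> \<le> (LINT x|torus. e * \<bar>f x\<bar>)"
    proof (rule integral_abs_bound_integral)
      show "integrable torus (\<lambda>x. f x * (F (circle_coords x) - p (circle_coords x)))" using i by (simp add: right_diff_distrib)
      show "\<bar>f x * (F (circle_coords x) - p (circle_coords x))\<bar> \<le> e * \<bar>f x\<bar>" if "x \<in> space torus" for x
        using mult_right_mono[of "\<bar>F (circle_coords x) - p (circle_coords x)\<bar>" e "\<bar>f x\<bar>"] p(2)[of "circle_coords x"] that
        by (simp add: abs_mult mult.commute)
    qed (use fi in simp)
    finally show ?thesis by simp
  qed
  note bd = this
  have "\<bar>LINT x|torus. f x * F (circle_coords x)\<bar> \<le> 0"
  proof (rule field_le_epsilon)
    fix e :: real assume "e > 0"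
    define I where "I = ?I"
    have I: "I \<ge> 0" by (simp add: I_def)
    then have "e * (I / (I + 1)) \<le> e * 1" using \<open>e > 0\<close> by (intro mult_left_mono) auto
    then have "e / (I + 1) * I \<le> e" by simp
    moreover have "e / (I + 1) > 0" using I \<open>e > 0\<close> by simp
    ultimately show "\<bar>LINT x|torus. f x * F (circle_coords x)\<bar> \<le> 0 + e"
      using bd[of "e / (I + 1)"] unfolding I_def by linarith
  qed
  then show ?thesis by simp
qed

lemma orthogonal_closed:
  assumes C: "closed C"
  shows "(LINT x|torus. f x * indicator C (circle_coords x)) = 0"
proof (cases "C = {}")
  case False
  define F where "F n y = max 0 (1 - real n * infdist y C)" for n y
  have cF: "continuous_on UNIV (F n)" for n
    unfolding F_def by (intro continuous_intros)
  have lim: "(\<lambda>n. F n y) \<longlonglongrightarrow> indicator C y" for y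
  proof (cases "y \<in> C")
    case True then show ?thesis using infdist_zero[of y C] by (simp add: F_def)
  next
    case y: False
    then have "infdist y C > 0" using in_closed_iff_infdist_zero[OF C False, of y] infdist_nonneg[of y C] by linarith
    then obtain N where "real N * infdist y C > 1" using reals_Archimedean3 by blast
    have "F n y = 0" if "n \<ge> N" for n
    proof -
      have "real N * infdist y C \<le> real n * infdist y C" using that infdist_nonneg[of y C] by (intro mult_right_mono) auto
      then show ?thesis using \<open>real N * infdist y C > 1\<close> by (simp add: F_def)
    qed
    then have "eventually (\<lambda>n. F n y = 0) sequentially" using eventually_at_top_linorder by blast
    then show ?thesis using y by (simp add: tendsto_eventually)
  qed
  have m: "(\<lambda>x. F n (circle_coords x)) \<in> borel_measurable torus" for n
    by (intro continuous_imp_measurable_torus continuous_on_compose2[OF cF continuous_on_circle_coords]) simp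
  have mi: "(\<lambda>x. indicator C (circle_coords x) :: real) \<in> borel_measurable torus"
    by (rule borel_measurable_LIMSEQ_metric[OF m]) (rule lim)
  have "(\<lambda>n. LINT x|torus. f x * F n (circle_coords x)) \<longlonglongrightarrow> (LINT x|torus. f x * indicator C (circle_coords x))"
  proof (rule integral_dominated_convergence[where w="\<lambda>x. \<bar>f x\<bar>"])
    show "integrable torus (\<lambda>x. \<bar>f x\<bar>)"
      using sq_integrable_imp_integrable[OF finite_measure_torus f] by simp
    show "AE x in torus. (\<lambda>n. f x * F n (circle_coords x)) \<longlonglongrightarrow> f x * indicator C (circle_coords x)"
      by (intro AE_I2 tendsto_mult_left lim)
    have "\<bar>F n y\<bar> \<le> 1" for n y using infdist_nonneg[of y C] by (simp add: F_def)
    then show "AE x in torus. norm (f x * F n (circle_coords x)) \<le> \<bar>f x\<bar>" for n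
      by (intro AE_I2) (simp add: abs_mult mult_left_le)
  qed (use m mi sq_integrableD(1)[OF f] in measurable)
  then show ?thesis using orthogonal_continuous[OF cF] by (simp add: LIMSEQ_const_iff)
qed simp

text \<open>A closed set inside the open cube is recovered from its image, since the circle coordinates
  separate its points from all points of the cube. Inner regularity then leaves no room for f to
  be positive.\<close>

lemma nonpos_AE: "AE x in torus. f x \<le> 0"
proof -
  define P where "P = {x \<in> box 0 1. f x > 0}"
  have Pm: "P \<in> sets lebesgue"
  proof -
    have "{x \<in> space torus. f x > 0} \<in> sets torus" using sq_integrableD(1)[OF f] by measurable
    then have "{x \<in> cbox 0 1. f x > 0} \<in> sets lebesgue" by (simp add: sets_restrict_space_iff)
    moreover have "P = {x \<in> cbox 0 1. f x > 0} \<inter> box 0 1" unfolding P_def using box_subset_cbox by blast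
    ultimately show ?thesis by auto
  qed
  have "emeasure lebesgue P < ennreal e" if e: "e > 0" for e
  proof -
    \<comment> \<open>Closed sets of positive measure inside P are excluded, so P itself is null by inner regularity.\<close>
    obtain T where T: "closed T" "T \<subseteq> P" "emeasure lebesgue (P - T) < ennreal e"
      using sets_lebesgue_inner_closed[OF Pm e] by metis
    have TC: "T \<subseteq> cbox 0 1" using T(2) box_subset_cbox[of 0 "1::real^'d"] by (auto simp: P_def)
    then have "compact T" using T(1) bounded_subset[OF bounded_cbox] compact_eq_bounded_closed by blast
    then have cl: "closed (circle_coords ` T)"
      by (intro compact_imp_closed compact_continuous_image continuous_on_circle_coords)
    have "indicator (circle_coords ` T) (circle_coords x) = (indicator T x :: real)" if x: "x \<in> cbox 0 1" for x
    proof -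
      have "x = y" if "circle_coords x = circle_coords y" "y \<in> T" for y
        using circle_coords_eq_imp[OF that(1) x] that(2) T(2) by (auto simp: P_def)
      then have "circle_coords x \<in> circle_coords ` T \<longleftrightarrow> x \<in> T" by blast
      then show ?thesis by (simp add: indicator_def)
    qed
    then have "(LINT x|torus. f x * indicator (circle_coords ` T) (circle_coords x)) = (LINT x|torus. f x * indicator T x)"
      by (intro Bochner_Integration.integral_cong) auto
    with orthogonal_closed[OF cl] have z: "(LINT x|torus. f x * indicator T x) = 0" by simp
    have Tm: "T \<in> sets torus" using TC T(1) by (auto simp: sets_restrict_space_iff)
    have i: "integrable torus (\<lambda>x. f x * indicator T x)"
      using integrable_real_mult_indicator[OF Tm sq_integrable_imp_integrable[OF finite_measure_torus f]] by (simp add: mult.commute)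
    have "AE x in torus. f x * indicator T x = 0"
    proof -
      have "f x * indicator T x \<ge> 0" for x using T(2) by (auto simp: P_def split: split_indicator)
      then show ?thesis using integral_nonneg_eq_0_iff_AE[OF i] z by simp
    qed
    then have "AE x in torus. x \<notin> T"
      by eventually_elim (use T(2) in \<open>auto simp: P_def split: split_indicator_asm\<close>)
    then have "AE x in lebesgue. x \<in> cbox 0 1 \<longrightarrow> x \<notin> T" by (subst (asm) AE_restrict_space_iff) auto
    then have "AE x in lebesgue. x \<notin> T" by eventually_elim (use TC in auto)
    then have "T \<in> null_sets lebesgue" using T(1) by (subst AE_iff_null_sets) auto
    then have "emeasure lebesgue P = emeasure lebesgue (P - T)" using Pm by (simp add: emeasure_Diff_null_set)
    then show ?thesis using T(3) by simp
  qed
  then have "emeasure lebesgue P \<le> 0 + ennreal e" if "e > 0" for e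
    using that by (simp add: less_imp_le)
  then have "emeasure lebesgue P \<le> 0" by (rule ennreal_le_epsilon)
  then have "P \<in> null_sets lebesgue" using Pm by auto
  then have 1: "AE x in lebesgue. x \<notin> P" by (rule AE_not_in)
  have "cbox 0 1 - box 0 (1::real^'d) \<in> null_sets lebesgue"
    using negligible_frontier_interval[of 0 "1::real^'d"] by (simp add: negligible_iff_null_sets)
  then have 2: "AE x in lebesgue. x \<notin> cbox 0 1 - box 0 (1::real^'d)" by (rule AE_not_in)
  from 1 2 have "AE x in lebesgue. x \<in> cbox 0 1 \<longrightarrow> f x \<le> 0"
    by eventually_elim (auto simp: P_def)
  then show ?thesis by (subst AE_restrict_space_iff) auto
qed

end

theorem hartley_complete:
  assumes f: "sq_integrable torus f" and orth: "\<And>\<kappa>. (LINT x|torus. f x * hartley \<kappa> x) = 0"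
  shows "AE x in torus. f x = 0"
proof -
  have "AE x in torus. f x \<le> 0" by (rule nonpos_AE[OF f orth])
  moreover have "AE x in torus. - f x \<le> 0"
    by (rule nonpos_AE[OF sq_integrable_uminus[OF f]]) (use orth in simp)
  ultimately show ?thesis by eventually_elim simp
qed

section \<open>Fourier series in L2 and H1\<close>

definition fourier_coeff :: "(real^'d \<Rightarrow> real) \<Rightarrow> int^'d \<Rightarrow> real" where
  "fourier_coeff f \<kappa> = (LINT x|torus. f x * hartley \<kappa> x)"

definition fourier_sum :: "(int^'d) set \<Rightarrow> (int^'d \<Rightarrow> real) \<Rightarrow> real^'d \<Rightarrow> real" where
  "fourier_sum F c x = (\<Sum>\<kappa>\<in>F. c \<kappa> * hartley \<kappa> x)"

text \<open>Cubes rather than balls; they are symmetric, so that sums can be reindexed by the reflection that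
  differentiation induces.\<close>

definition freqs :: "nat \<Rightarrow> (int^'d) set" where
  "freqs m = {\<kappa>. \<forall>i. \<bar>\<kappa> $ i\<bar> \<le> int m}"

text \<open>The eigenvalue of minus the Laplacian on the Hartley function of this index.\<close>

definition freq_norm_sq :: "int^'d \<Rightarrow> real" where
  "freq_norm_sq \<kappa> = (\<Sum>i\<in>UNIV. (freq \<kappa> i)\<^sup>2)"

lemma finite_freqs [simp]: "finite (freqs m)"
proof -
  have "freqs m \<subseteq> vec_lambda ` (PiE UNIV (\<lambda>_. {- int m..int m}))"
  proof
    fix \<kappa> :: "int^'d" assume "\<kappa> \<in> freqs m"
    then have "vec_nth \<kappa> \<in> PiE UNIV (\<lambda>_. {- int m..int m})" by (auto simp: freqs_def abs_le_iff minus_le_iff)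
    moreover have "\<kappa> = vec_lambda (vec_nth \<kappa>)" by simp
    ultimately show "\<kappa> \<in> vec_lambda ` (PiE UNIV (\<lambda>_. {- int m..int m}))" by blast
  qed
  then show ?thesis by (rule finite_subset) (intro finite_imageI finite_PiE; simp)
qed

lemma freqs_mono: "m \<le> n \<Longrightarrow> freqs m \<subseteq> freqs n"
proof
  fix \<kappa> :: "int^'a" assume "m \<le> n" "\<kappa> \<in> freqs m"
  then have "\<bar>\<kappa> $ i\<bar> \<le> int n" for i by (auto simp: freqs_def dest!: spec[of _ i])
  then show "\<kappa> \<in> freqs n" by (simp add: freqs_def)
qed

lemma mem_freqs_exists: "\<exists>m. \<kappa> \<in> freqs m"
proof -
  define N where "N = (\<Sum>i\<in>UNIV. nat \<bar>\<kappa> $ i\<bar>)"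
  have "nat \<bar>\<kappa> $ i\<bar> \<le> N" for i
    unfolding N_def using member_le_sum[of i UNIV "\<lambda>i. nat \<bar>\<kappa> $ i\<bar>"] by simp
  then have "\<bar>\<kappa> $ i\<bar> \<le> int N" for i by (simp add: nat_le_iff)
  then show ?thesis unfolding freqs_def by blast
qed

lemma uminus_freqs_iff [simp]: "- \<kappa> \<in> freqs m \<longleftrightarrow> \<kappa> \<in> freqs m"
  by (simp add: freqs_def)

lemma sum_freqs_uminus: "(\<Sum>\<kappa>\<in>freqs m. g (- \<kappa>)) = (\<Sum>\<kappa>\<in>freqs m. g \<kappa>)"
  by (rule sum.reindex_bij_witness[of _ uminus uminus]) auto

lemma freq_norm_sq_nonneg [simp]: "0 \<le> freq_norm_sq \<kappa>" by (simp add: freq_norm_sq_def sum_nonneg)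

lemma freq_norm_sq_uminus [simp]: "freq_norm_sq (- \<kappa>) = freq_norm_sq \<kappa>" by (simp add: freq_norm_sq_def)

lemma freq_norm_sq_ge:
  assumes "\<kappa> \<notin> freqs m" shows "(real m)\<^sup>2 \<le> freq_norm_sq \<kappa>"
proof -
  obtain i where "\<bar>\<kappa> $ i\<bar> > int m" using assms by (auto simp: freqs_def not_le)
  then have 1: "real m \<le> \<bar>of_int (\<kappa> $ i)\<bar>" by linarith
  have "1 \<le> 2 * pi" using pi_gt3 by simp
  then have "1 * \<bar>of_int (\<kappa> $ i)\<bar> \<le> \<bar>freq \<kappa> i\<bar>" unfolding freq_def abs_mult by (intro mult_right_mono) auto
  then have "(real m)\<^sup>2 \<le> \<bar>freq \<kappa> i\<bar>\<^sup>2" using 1 by (intro power_mono) auto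
  also have "\<dots> \<le> freq_norm_sq \<kappa>" unfolding freq_norm_sq_def using member_le_sum[of i UNIV "\<lambda>i. (freq \<kappa> i)\<^sup>2"] by simp
  finally show ?thesis .
qed

lemma lnorm_hartley: "lnorm torus (hartley \<kappa>) = 1"
  using hartley_orthonormal[of \<kappa> \<kappa>] by (simp add: lnorm_def power2_eq_square)

lemma abs_fourier_coeff_le: "sq_integrable torus f \<Longrightarrow> \<bar>fourier_coeff f \<kappa>\<bar> \<le> lnorm torus f"
  using Cauchy_Schwarz_lnorm[OF _ sq_integrable_hartley, of f \<kappa>] by (simp add: fourier_coeff_def lnorm_hartley)

lemma fourier_coeff_add: "sq_integrable torus f \<Longrightarrow> sq_integrable torus g \<Longrightarrow> fourier_coeff (\<lambda>x. f x + g x) \<kappa> = fourier_coeff f \<kappa> + fourier_coeff g \<kappa>"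
  unfolding fourier_coeff_def by (simp add: distrib_right sq_integrable_mult sq_integrable_hartley)

lemma fourier_coeff_diff: "sq_integrable torus f \<Longrightarrow> sq_integrable torus g \<Longrightarrow> fourier_coeff (\<lambda>x. f x - g x) \<kappa> = fourier_coeff f \<kappa> - fourier_coeff g \<kappa>"
  unfolding fourier_coeff_def by (simp add: left_diff_distrib sq_integrable_mult sq_integrable_hartley)

lemma fourier_coeff_cmult: "fourier_coeff (\<lambda>x. a * f x) \<kappa> = a * fourier_coeff f \<kappa>"
  unfolding fourier_coeff_def by (simp add: mult.assoc)

lemma fourier_coeff_hartley: "fourier_coeff (hartley \<kappa>) \<mu> = (if \<kappa> = \<mu> then 1 else 0)"
  by (simp add: fourier_coeff_def hartley_orthonormal)

lemma fourier_coeff_zero [simp]: "fourier_coeff (\<lambda>x. 0) \<kappa> = 0" by (simp add: fourier_coeff_def)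

lemma sq_integrable_fourier_sum [simp]: "sq_integrable torus (fourier_sum F c)"
  unfolding fourier_sum_def[abs_def] by (intro sq_integrable_sum sq_integrable_cmult sq_integrable_hartley)

lemma fourier_coeff_sum:
  "(\<And>i. i \<in> I \<Longrightarrow> sq_integrable torus (f i)) \<Longrightarrow> fourier_coeff (\<lambda>x. \<Sum>i\<in>I. f i x) \<kappa> = (\<Sum>i\<in>I. fourier_coeff (f i) \<kappa>)"
  by (induction I rule: infinite_finite_induct) (simp_all add: fourier_coeff_add sq_integrable_sum)

lemma integral_mult_fourier_sum:
  assumes f: "sq_integrable torus f"
  shows "(LINT x|torus. f x * fourier_sum F c x) = (\<Sum>\<kappa>\<in>F. c \<kappa> * fourier_coeff f \<kappa>)"
proof -
  have "(LINT x|torus. f x * fourier_sum F c x) = (LINT x|torus. (\<Sum>\<kappa>\<in>F. c \<kappa> * (f x * hartley \<kappa> x)))"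
    by (simp add: fourier_sum_def sum_distrib_left mult_ac)
  also have "\<dots> = (\<Sum>\<kappa>\<in>F. c \<kappa> * fourier_coeff f \<kappa>)"
    using sq_integrable_mult[OF f sq_integrable_hartley] by (subst Bochner_Integration.integral_sum) (auto simp: fourier_coeff_def)
  finally show ?thesis .
qed

lemma fourier_coeff_fourier_sum:
  assumes "finite F" shows "fourier_coeff (fourier_sum F c) \<kappa> = (if \<kappa> \<in> F then c \<kappa> else 0)"
proof -
  have "fourier_coeff (fourier_sum F c) \<kappa> = (\<Sum>\<mu>\<in>F. c \<mu> * fourier_coeff (hartley \<mu>) \<kappa>)"
    unfolding fourier_sum_def[abs_def] by (simp add: fourier_coeff_sum fourier_coeff_cmult sq_integrable_cmult sq_integrable_hartley)
  also have "\<dots> = (\<Sum>\<mu>\<in>F. if \<mu> = \<kappa> then c \<mu> else 0)"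
    by (intro sum.cong) (auto simp: fourier_coeff_hartley)
  finally show ?thesis using assms by simp
qed

lemma lnorm_fourier_sum:
  assumes "finite F" shows "(lnorm torus (fourier_sum F c))\<^sup>2 = (\<Sum>\<kappa>\<in>F. (c \<kappa>)\<^sup>2)"
proof -
  have "(lnorm torus (fourier_sum F c))\<^sup>2 = (LINT x|torus. fourier_sum F c x * fourier_sum F c x)"
    unfolding lnorm_power2 by (simp add: power2_eq_square)
  also have "\<dots> = (\<Sum>\<kappa>\<in>F. (c \<kappa>)\<^sup>2)"
    using assms by (subst integral_mult_fourier_sum) (auto simp: fourier_coeff_fourier_sum power2_eq_square intro!: sum.cong)
  finally show ?thesis .
qed

lemma lnorm_diff_fourier_sum:
  assumes "finite F" and f: "sq_integrable torus f"
  shows "(lnorm torus (\<lambda>x. f x - fourier_sum F (fourier_coeff f) x))\<^sup>2 = (lnorm torus f)\<^sup>2 - (\<Sum>\<kappa>\<in>F. (fourier_coeff f \<kappa>)\<^sup>2)"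
proof -
  note i = sq_integrable_mult[OF f sq_integrable_fourier_sum[of F "fourier_coeff f"]] sq_integrableD(2)[OF f] sq_integrableD(2)[OF sq_integrable_fourier_sum[of F "fourier_coeff f"]]
  have "(lnorm torus (\<lambda>x. f x - fourier_sum F (fourier_coeff f) x))\<^sup>2
      = (LINT x|torus. (f x)\<^sup>2 + (fourier_sum F (fourier_coeff f) x)\<^sup>2 - 2 * (f x * fourier_sum F (fourier_coeff f) x))"
    unfolding lnorm_power2 by (intro Bochner_Integration.integral_cong) (auto simp: power2_eq_square algebra_simps)
  also have "\<dots> = (lnorm torus f)\<^sup>2 + (lnorm torus (fourier_sum F (fourier_coeff f)))\<^sup>2 - 2 * (LINT x|torus. f x * fourier_sum F (fourier_coeff f) x)"
    using i by (simp add: lnorm_power2)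
  also have "\<dots> = (lnorm torus f)\<^sup>2 - (\<Sum>\<kappa>\<in>F. (fourier_coeff f \<kappa>)\<^sup>2)"
    unfolding lnorm_fourier_sum[OF assms(1)] integral_mult_fourier_sum[OF f] by (simp add: power2_eq_square)
  finally show ?thesis .
qed

lemma Bessel:
  assumes "finite F" "sq_integrable torus f"
  shows "(\<Sum>\<kappa>\<in>F. (fourier_coeff f \<kappa>)\<^sup>2) \<le> (lnorm torus f)\<^sup>2"
  using lnorm_diff_fourier_sum[OF assms] zero_le_power2[of "lnorm torus (\<lambda>x. f x - fourier_sum F (fourier_coeff f) x)"] by linarith

lemma fourier_sum_diff_subset:
  assumes "F \<subseteq> G" "finite G"
  shows "fourier_sum G c x - fourier_sum F c x = fourier_sum (G - F) c x"
  unfolding fourier_sum_def using sum_diff[OF assms(2,1), of "\<lambda>\<kappa>. c \<kappa> * hartley \<kappa> x"] by simp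

lemma fourier_sum_Cauchy:
  assumes bd: "\<And>m. (\<Sum>\<kappa>\<in>freqs m. (c \<kappa>)\<^sup>2) \<le> Z" and e: "\<epsilon> > 0"
  shows "\<exists>N. \<forall>m\<ge>N. \<forall>n\<ge>N. lnorm torus (\<lambda>x. fourier_sum (freqs m) c x - fourier_sum (freqs n) c x) < \<epsilon>"
proof -
  define s where "s m = (\<Sum>\<kappa>\<in>freqs m. (c \<kappa>)\<^sup>2)" for m
  have mono: "s m \<le> s n" if "m \<le> n" for m n
    unfolding s_def using that by (intro sum_mono2 freqs_mono) auto
  then have "convergent s"
    by (intro Bseq_mono_convergent incseq_imp_monoseq BseqI'[of _ Z]) (auto simp: s_def bd incseq_def sum_nonneg)
  then have "Cauchy s" by (rule convergent_Cauchy)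
  then obtain N where N: "\<And>m n. m \<ge> N \<Longrightarrow> n \<ge> N \<Longrightarrow> \<bar>s m - s n\<bar> < \<epsilon>\<^sup>2"
    using CauchyD[of s "\<epsilon>\<^sup>2"] e by auto
  have le: "lnorm torus (\<lambda>x. fourier_sum (freqs n) c x - fourier_sum (freqs m) c x) < \<epsilon>" if "m \<ge> N" "m \<le> n" for m n
  proof -
    have "(lnorm torus (\<lambda>x. fourier_sum (freqs n) c x - fourier_sum (freqs m) c x))\<^sup>2 = (\<Sum>\<kappa>\<in>freqs n - freqs m. (c \<kappa>)\<^sup>2)"
      by (simp add: fourier_sum_diff_subset[OF freqs_mono[OF that(2)]] lnorm_fourier_sum)
    also have "\<dots> = s n - s m" unfolding s_def by (rule sum_diff[OF finite_freqs freqs_mono[OF that(2)]])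
    also have "\<dots> < \<epsilon>\<^sup>2" using N[of n m] that by simp
    finally show ?thesis using e by (simp add: power2_less_imp_less)
  qed
  show ?thesis
  proof (intro exI[of _ N] allI impI)
    fix m n assume "N \<le> m" "N \<le> n"
    then show "lnorm torus (\<lambda>x. fourier_sum (freqs m) c x - fourier_sum (freqs n) c x) < \<epsilon>"
      using le[of m n] le[of n m] lnorm_diff_commute[of torus "fourier_sum (freqs m) c" "fourier_sum (freqs n) c"]
      by (cases "m \<le> n") auto
  qed
qed

text \<open>The partial sums are Cauchy in the complete space of square integrable functions, and taking a
  coefficient is continuous.\<close>

theorem Riesz_Fischer:
  assumes bd: "\<And>m. (\<Sum>\<kappa>\<in>freqs m. (c \<kappa>)\<^sup>2) \<le> Z"
  obtains f where "sq_integrable torus f" "\<And>\<kappa>. fourier_coeff f \<kappa> = c \<kappa>"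
    "(\<lambda>m. lnorm torus (\<lambda>x. fourier_sum (freqs m) c x - f x)) \<longlonglongrightarrow> 0"
proof -
  obtain f where f: "sq_integrable torus f" and lim: "(\<lambda>m. lnorm torus (\<lambda>x. fourier_sum (freqs m) c x - f x)) \<longlonglongrightarrow> 0"
    using sq_integrable_complete[OF finite_measure_torus, of "\<lambda>m. fourier_sum (freqs m) c"] fourier_sum_Cauchy[OF bd] by auto
  have "fourier_coeff f \<kappa> = c \<kappa>" for \<kappa>
  proof -
    have "(\<lambda>m. fourier_coeff (fourier_sum (freqs m) c) \<kappa> - fourier_coeff f \<kappa>) \<longlonglongrightarrow> 0"
    proof (rule Lim_null_comparison[OF _ lim], rule always_eventually, rule allI)
      show "norm (fourier_coeff (fourier_sum (freqs m) c) \<kappa> - fourier_coeff f \<kappa>) \<le> lnorm torus (\<lambda>x. fourier_sum (freqs m) c x - f x)" for m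
        using abs_fourier_coeff_le[OF sq_integrable_diff[OF sq_integrable_fourier_sum[of "freqs m" c] f], of \<kappa>]
          fourier_coeff_diff[OF sq_integrable_fourier_sum[of "freqs m" c] f, of \<kappa>] by simp
    qed
    moreover obtain m0 where "\<kappa> \<in> freqs m0" using mem_freqs_exists by blast
    then have mem: "\<kappa> \<in> freqs m" if "m \<ge> m0" for m using freqs_mono[OF that] by blast
    have "\<forall>\<^sub>F m in sequentially. fourier_coeff (fourier_sum (freqs m) c) \<kappa> - fourier_coeff f \<kappa> = c \<kappa> - fourier_coeff f \<kappa>"
      using eventually_ge_at_top[of m0] by eventually_elim (simp add: fourier_coeff_fourier_sum mem)
    then have "(\<lambda>m. fourier_coeff (fourier_sum (freqs m) c) \<kappa> - fourier_coeff f \<kappa>) \<longlonglongrightarrow> c \<kappa> - fourier_coeff f \<kappa>" by (rule tendsto_eventually)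
    ultimately have "c \<kappa> - fourier_coeff f \<kappa> = 0" using LIMSEQ_unique by blast
    then show ?thesis by simp
  qed
  from that[OF f this lim] show ?thesis .
qed

text \<open>By Bessel's inequality the Fourier series converges to some function; it has the coefficients of f, so
  completeness identifies the two.\<close>

theorem fourier_sum_tendsto:
  assumes f: "sq_integrable torus f"
  shows "(\<lambda>m. lnorm torus (\<lambda>x. f x - fourier_sum (freqs m) (fourier_coeff f) x)) \<longlonglongrightarrow> 0"
proof -
  obtain g where g: "sq_integrable torus g" "\<And>\<kappa>. fourier_coeff g \<kappa> = fourier_coeff f \<kappa>"
    "(\<lambda>m. lnorm torus (\<lambda>x. fourier_sum (freqs m) (fourier_coeff f) x - g x)) \<longlonglongrightarrow> 0"
    using Riesz_Fischer[OF Bessel[OF finite_freqs f]] by blast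
  have "AE x in torus. f x - g x = 0"
    by (rule hartley_complete[OF sq_integrable_diff[OF f g(1)]])
       (use fourier_coeff_diff[OF f g(1)] g(2) in \<open>simp add: fourier_coeff_def\<close>)
  then have "lnorm torus (\<lambda>x. fourier_sum (freqs m) (fourier_coeff f) x - f x) = lnorm torus (\<lambda>x. fourier_sum (freqs m) (fourier_coeff f) x - g x)" for m
    using sq_integrableD(1)[OF f] sq_integrableD(1)[OF g(1)] sq_integrableD(1)[OF sq_integrable_fourier_sum]
    by (intro lnorm_cong_AE borel_measurable_diff) (auto elim!: eventually_mono)
  then show ?thesis using g(3) lnorm_diff_commute[of torus f] by simp
qed

theorem Parseval:
  assumes f: "sq_integrable torus f" and g: "sq_integrable torus g"
  shows "(\<lambda>m. \<Sum>\<kappa>\<in>freqs m. fourier_coeff f \<kappa> * fourier_coeff g \<kappa>) \<longlonglongrightarrow> (LINT x|torus. f x * g x)"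
proof -
  have eq: "(LINT x|torus. f x * g x) - (\<Sum>\<kappa>\<in>freqs m. fourier_coeff f \<kappa> * fourier_coeff g \<kappa>) = (LINT x|torus. f x * (g x - fourier_sum (freqs m) (fourier_coeff g) x))" for m
    using integral_mult_fourier_sum[OF f, of "freqs m" "fourier_coeff g"] sq_integrable_mult[OF f g] sq_integrable_mult[OF f sq_integrable_fourier_sum]
    by (simp add: right_diff_distrib mult.commute)
  have "(\<lambda>m. (LINT x|torus. f x * g x) - (\<Sum>\<kappa>\<in>freqs m. fourier_coeff f \<kappa> * fourier_coeff g \<kappa>)) \<longlonglongrightarrow> 0"
  proof (rule Lim_null_comparison)
    show "\<forall>\<^sub>F m in sequentially. norm ((LINT x|torus. f x * g x) - (\<Sum>\<kappa>\<in>freqs m. fourier_coeff f \<kappa> * fourier_coeff g \<kappa>))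
        \<le> lnorm torus f * lnorm torus (\<lambda>x. g x - fourier_sum (freqs m) (fourier_coeff g) x)"
      unfolding eq by (simp add: Cauchy_Schwarz_lnorm[OF f sq_integrable_diff[OF g sq_integrable_fourier_sum]])
    show "(\<lambda>m. lnorm torus f * lnorm torus (\<lambda>x. g x - fourier_sum (freqs m) (fourier_coeff g) x)) \<longlonglongrightarrow> 0"
      using tendsto_mult_left[OF fourier_sum_tendsto[OF g], of "lnorm torus f"] by simp
  qed
  then show ?thesis
    using tendsto_diff[OF tendsto_const[of "LINT x|torus. f x * g x"], of _ 0] by fastforce
qed

lemma Parseval_norm:
  assumes f: "sq_integrable torus f"
  shows "(\<lambda>m. \<Sum>\<kappa>\<in>freqs m. (fourier_coeff f \<kappa>)\<^sup>2) \<longlonglongrightarrow> (lnorm torus f)\<^sup>2"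
  using Parseval[OF f f] unfolding lnorm_power2 by (simp add: power2_eq_square)

lemma lnorm_le_of_fourier_coeff:
  assumes f: "sq_integrable torus f" and "\<And>m. (\<Sum>\<kappa>\<in>freqs m. (fourier_coeff f \<kappa>)\<^sup>2) \<le> Z"
  shows "(lnorm torus f)\<^sup>2 \<le> Z"
  using LIMSEQ_le_const2[OF Parseval_norm[OF f]] assms(2) by blast

text \<open>Frequencies outside the box of radius m carry weight at least \<open>m\<^sup>2\<close>; this is what makes the
  embedding of H1 into L2 compact.\<close>

lemma lnorm_le_low_frequencies:
  fixes f :: "real^'d \<Rightarrow> real"
  assumes f: "sq_integrable torus f" and m: "m > 0"
    and Z: "\<And>n. (\<Sum>\<kappa>\<in>freqs n. freq_norm_sq \<kappa> * (fourier_coeff f \<kappa>)\<^sup>2) \<le> Z"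
  shows "(lnorm torus f)\<^sup>2 \<le> (\<Sum>\<kappa>\<in>freqs m. (fourier_coeff f \<kappa>)\<^sup>2) + Z / (real m)\<^sup>2"
proof (rule lnorm_le_of_fourier_coeff[OF f])
  fix n
  have m2: "(real m)\<^sup>2 > 0" using m by simp
  have "(\<Sum>\<kappa>\<in>freqs n. (fourier_coeff f \<kappa>)\<^sup>2) \<le> (\<Sum>\<kappa>\<in>freqs m \<union> (freqs n - freqs m). (fourier_coeff f \<kappa>)\<^sup>2)"
    by (intro sum_mono2) auto
  also have "\<dots> = (\<Sum>\<kappa>\<in>freqs m. (fourier_coeff f \<kappa>)\<^sup>2) + (\<Sum>\<kappa>\<in>freqs n - freqs m. (fourier_coeff f \<kappa>)\<^sup>2)"
    by (rule sum.union_disjoint) auto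
  also have "(\<Sum>\<kappa>\<in>freqs n - freqs m. (fourier_coeff f \<kappa>)\<^sup>2) \<le> (\<Sum>\<kappa>\<in>freqs n - freqs m. freq_norm_sq \<kappa> * (fourier_coeff f \<kappa>)\<^sup>2 / (real m)\<^sup>2)"
  proof (rule sum_mono)
    fix \<kappa> :: "int^'d" assume "\<kappa> \<in> freqs n - freqs m"
    then have "(real m)\<^sup>2 * (fourier_coeff f \<kappa>)\<^sup>2 \<le> freq_norm_sq \<kappa> * (fourier_coeff f \<kappa>)\<^sup>2" by (intro mult_right_mono freq_norm_sq_ge) auto
    then show "(fourier_coeff f \<kappa>)\<^sup>2 \<le> freq_norm_sq \<kappa> * (fourier_coeff f \<kappa>)\<^sup>2 / (real m)\<^sup>2" using m2 by (simp add: field_simps)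
  qed
  also have "\<dots> \<le> (\<Sum>\<kappa>\<in>freqs n. freq_norm_sq \<kappa> * (fourier_coeff f \<kappa>)\<^sup>2 / (real m)\<^sup>2)"
    by (intro sum_mono2) (auto intro!: divide_nonneg_nonneg)
  also have "\<dots> \<le> Z / (real m)\<^sup>2"
    unfolding sum_divide_distrib[symmetric] using Z m2 by (intro divide_right_mono) auto
  finally show "(\<Sum>\<kappa>\<in>freqs n. (fourier_coeff f \<kappa>)\<^sup>2) \<le> (\<Sum>\<kappa>\<in>freqs m. (fourier_coeff f \<kappa>)\<^sup>2) + Z / (real m)\<^sup>2" by simp
qed

lemma L2_real_iff: "f \<in> L2 \<longleftrightarrow> sq_integrable torus f" for f :: "real^'d \<Rightarrow> real"
  by (simp add: L2_def sq_integrable_def)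

lemma L2_norm_real: "L2_norm f = lnorm torus f" for f :: "real^'d \<Rightarrow> real"
  by (simp add: L2_norm_def L2_inner_def lnorm_def power2_eq_square)

lemma L2_inner_real: "L2_inner f g = (LINT x|torus. f x * g x)" for f g :: "real^'d \<Rightarrow> real"
  by (simp add: L2_inner_def)

lemma norm_power2_vec: "(norm v)\<^sup>2 = (\<Sum>i\<in>UNIV. (v $ i)\<^sup>2)" for v :: "real^'d"
  by (simp add: norm_vec_def L2_set_def sum_nonneg)

lemma L2_vec_iff: "g \<in> L2 \<longleftrightarrow> (\<forall>i. sq_integrable torus (\<lambda>x. g x $ i))" for g :: "real^'d \<Rightarrow> real^'d"
proof
  assume g: "g \<in> L2"
  then have m: "g \<in> borel_measurable torus" and i: "integrable torus (\<lambda>x. (norm (g x))\<^sup>2)" by (auto simp: L2_def)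
  have s: "sq_integrable torus (\<lambda>x. norm (g x))" using m i by (simp add: sq_integrable_def)
  show "\<forall>i. sq_integrable torus (\<lambda>x. g x $ i)"
  proof
    fix i
    have "(\<lambda>v::real^'d. v $ i) \<in> borel_measurable borel"
      by (intro borel_measurable_continuous_onI continuous_intros)
    from measurable_compose[OF m this] have "(\<lambda>x. g x $ i) \<in> borel_measurable torus" .
    then show "sq_integrable torus (\<lambda>x. g x $ i)"
      by (rule sq_integrable_bound[OF s]) (simp add: component_le_norm_cart)
  qed
next
  assume g: "\<forall>i. sq_integrable torus (\<lambda>x. g x $ i)"
  then have "(\<lambda>x. g x $ i) \<in> borel_measurable torus" for i by (auto dest: sq_integrableD)
  then have "g \<in> borel_measurable torus"
    by (subst borel_measurable_euclidean_space) (auto simp: Basis_vec_def inner_axis)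
  moreover have "integrable torus (\<lambda>x. (norm (g x))\<^sup>2)"
    unfolding norm_power2_vec using g by (intro Bochner_Integration.integrable_sum) (auto dest: sq_integrableD)
  ultimately show "g \<in> L2" by (simp add: L2_def)
qed

lemma L2_inner_vec:
  fixes f g :: "real^'d \<Rightarrow> real^'d"
  assumes "f \<in> L2" "g \<in> L2"
  shows "L2_inner f g = (\<Sum>i\<in>UNIV. LINT x|torus. f x $ i * g x $ i)"
  using assms unfolding L2_vec_iff L2_inner_def inner_vec_def
  by (subst Bochner_Integration.integral_sum) (auto intro!: sq_integrable_mult)

lemma L2_norm_vec:
  fixes f :: "real^'d \<Rightarrow> real^'d"
  assumes "f \<in> L2"
  shows "(L2_norm f)\<^sup>2 = (\<Sum>i\<in>UNIV. (lnorm torus (\<lambda>x. f x $ i))\<^sup>2)"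
proof -
  have "L2_inner f f = (\<Sum>i\<in>UNIV. (lnorm torus (\<lambda>x. f x $ i))\<^sup>2)"
    unfolding L2_inner_vec[OF assms assms] lnorm_power2 by (simp add: power2_eq_square)
  then show ?thesis unfolding L2_norm_def by (simp add: sum_nonneg)
qed

lemma Cinf_torus_sq_integrable:
  assumes "\<phi> \<in> Cinf_torus"
  shows "sq_integrable torus \<phi>" "sq_integrable torus (\<lambda>x. grad \<phi> x $ i)"
  using Cinf_torus_GDERIV[OF assms] by (auto intro: sq_integrable_continuous)

lemma fourier_coeff_grad:
  assumes "\<phi> \<in> Cinf_torus"
  shows "fourier_coeff (\<lambda>x. grad \<phi> x $ i) \<kappa> = - freq \<kappa> i * fourier_coeff \<phi> (- \<kappa>)"
proof -
  have "fourier_coeff (\<lambda>x. grad \<phi> x $ i) \<kappa> = - (LINT x|torus. \<phi> x * grad (hartley \<kappa>) x $ i)"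
    unfolding fourier_coeff_def using torus_by_parts[OF assms hartley_Cinf_torus, of \<kappa> i] by simp
  also have "\<dots> = - (LINT x|torus. freq \<kappa> i * (\<phi> x * hartley (- \<kappa>) x))"
    unfolding grad_hartley by (simp add: mult_ac)
  finally show ?thesis by (simp add: fourier_coeff_def)
qed

lemma weak_gradient_fourier_coeff:
  assumes "weak_gradient f g"
  shows "fourier_coeff (\<lambda>x. g x $ i) \<kappa> = - freq \<kappa> i * fourier_coeff f (- \<kappa>)"
proof -
  have "L2_inner f (\<lambda>x. grad (hartley \<kappa>) x $ i) = - L2_inner (\<lambda>x. g x $ i) (hartley \<kappa>)"
    using assms hartley_Cinf_torus unfolding weak_gradient_def by blast
  then have "fourier_coeff (\<lambda>x. g x $ i) \<kappa> = - (LINT x|torus. freq \<kappa> i * (f x * hartley (- \<kappa>) x))"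
    unfolding L2_inner_real grad_hartley fourier_coeff_def by (simp add: mult_ac)
  then show ?thesis by (simp add: fourier_coeff_def)
qed

lemma H1_sq_integrable: "f \<in> H1 \<Longrightarrow> sq_integrable torus f"
  by (simp add: H1_def L2_real_iff)

lemma weak_gradient_wgrad: "f \<in> H1 \<Longrightarrow> weak_gradient f (wgrad f)"
  unfolding wgrad_def H1_def by (auto intro: someI[of "weak_gradient f"])

lemma wgrad_L2: "f \<in> H1 \<Longrightarrow> wgrad f \<in> L2"
  using weak_gradient_wgrad by (auto simp: weak_gradient_def)

lemma wgrad_sq_integrable: "f \<in> H1 \<Longrightarrow> sq_integrable torus (\<lambda>x. wgrad f x $ i)"
  using wgrad_L2 L2_vec_iff by blast

lemma fourier_coeff_wgrad: "f \<in> H1 \<Longrightarrow> fourier_coeff (\<lambda>x. wgrad f x $ i) \<kappa> = - freq \<kappa> i * fourier_coeff f (- \<kappa>)"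
  by (rule weak_gradient_fourier_coeff[OF weak_gradient_wgrad])

text \<open>A partial derivative multiplies a coefficient by the frequency and reflects the index. The bound
  makes the resulting sequences square summable, hence coefficients of functions, and Parseval's
  identity turns the relation between coefficients into the integration by parts formula.\<close>

lemma H1_fourierI:
  fixes f :: "real^'d \<Rightarrow> real"
  assumes f: "sq_integrable torus f" and Z: "\<And>m. (\<Sum>\<kappa>\<in>freqs m. freq_norm_sq \<kappa> * (fourier_coeff f \<kappa>)\<^sup>2) \<le> Z"
  shows "f \<in> H1"
proof -
  have "\<exists>g. sq_integrable torus g \<and> (\<forall>\<kappa>. fourier_coeff g \<kappa> = - freq \<kappa> i * fourier_coeff f (- \<kappa>))" for i
  proof -
    have "(\<Sum>\<kappa>\<in>freqs m. (- freq \<kappa> i * fourier_coeff f (- \<kappa>))\<^sup>2) \<le> Z" for m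
    proof -
      have "(\<Sum>\<kappa>\<in>freqs m. (- freq \<kappa> i * fourier_coeff f (- \<kappa>))\<^sup>2) = (\<Sum>\<kappa>\<in>freqs m. (freq \<kappa> i * fourier_coeff f \<kappa>)\<^sup>2)"
        using sum_freqs_uminus[of "\<lambda>\<kappa>. (freq \<kappa> i * fourier_coeff f \<kappa>)\<^sup>2" m] by simp
      also have "\<dots> \<le> (\<Sum>\<kappa>\<in>freqs m. freq_norm_sq \<kappa> * (fourier_coeff f \<kappa>)\<^sup>2)"
        unfolding power_mult_distrib freq_norm_sq_def
        by (intro sum_mono mult_right_mono member_le_sum[of i UNIV "\<lambda>i. (freq _ i)\<^sup>2"]) auto
      finally show ?thesis using Z[of m] by linarith
    qed
    from Riesz_Fischer[OF this] show ?thesis by metis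
  qed
  then obtain g where g: "\<And>i. sq_integrable torus (g i)" "\<And>i \<kappa>. fourier_coeff (g i) \<kappa> = - freq \<kappa> i * fourier_coeff f (- \<kappa>)" by metis
  have "weak_gradient f (\<lambda>x. \<chi> i. g i x)"
    unfolding weak_gradient_def
  proof (intro conjI ballI allI)
    show "(\<lambda>x. \<chi> i. g i x) \<in> L2" using g(1) by (simp add: L2_vec_iff)
    fix \<phi> :: "real^'d \<Rightarrow> real" and i assume \<phi>: "\<phi> \<in> Cinf_torus"
    note s = Cinf_torus_sq_integrable[OF \<phi>]
    have "(\<Sum>\<kappa>\<in>freqs m. fourier_coeff f \<kappa> * fourier_coeff (\<lambda>x. grad \<phi> x $ i) \<kappa>) = - (\<Sum>\<kappa>\<in>freqs m. fourier_coeff (g i) \<kappa> * fourier_coeff \<phi> \<kappa>)" for m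
    proof -
      have "(\<Sum>\<kappa>\<in>freqs m. fourier_coeff f \<kappa> * fourier_coeff (\<lambda>x. grad \<phi> x $ i) \<kappa>) = (\<Sum>\<kappa>\<in>freqs m. fourier_coeff f (- \<kappa>) * (freq \<kappa> i * fourier_coeff \<phi> \<kappa>))"
        using sum_freqs_uminus[of "\<lambda>\<kappa>. fourier_coeff f \<kappa> * fourier_coeff (\<lambda>x. grad \<phi> x $ i) \<kappa>" m] by (simp add: fourier_coeff_grad[OF \<phi>])
      then show ?thesis by (simp add: g(2) sum_negf[symmetric] mult_ac)
    qed
    then have "(\<lambda>m. - (\<Sum>\<kappa>\<in>freqs m. fourier_coeff (g i) \<kappa> * fourier_coeff \<phi> \<kappa>)) \<longlonglongrightarrow> (LINT x|torus. f x * grad \<phi> x $ i)"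
      using Parseval[OF f s(2)[of i]] by simp
    moreover have "(\<lambda>m. - (\<Sum>\<kappa>\<in>freqs m. fourier_coeff (g i) \<kappa> * fourier_coeff \<phi> \<kappa>)) \<longlonglongrightarrow> - (LINT x|torus. g i x * \<phi> x)"
      by (rule tendsto_minus[OF Parseval[OF g(1) s(1)]])
    ultimately show "L2_inner f (\<lambda>x. grad \<phi> x $ i) = - L2_inner (\<lambda>x. (\<chi> i. g i x) $ i) \<phi>"
      using LIMSEQ_unique by (fastforce simp: L2_inner_real)
  qed
  then show ?thesis using f by (auto simp: H1_def L2_real_iff)
qed

lemma H1_norm_tendsto:
  assumes f: "f \<in> H1"
  shows "(\<lambda>m. \<Sum>\<kappa>\<in>freqs m. (1 + freq_norm_sq \<kappa>) * (fourier_coeff f \<kappa>)\<^sup>2) \<longlonglongrightarrow> (H1_norm f)\<^sup>2"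
    and "(\<lambda>m. \<Sum>\<kappa>\<in>freqs m. freq_norm_sq \<kappa> * (fourier_coeff f \<kappa>)\<^sup>2) \<longlonglongrightarrow> (L2_norm (wgrad f))\<^sup>2"
proof -
  have "(\<Sum>\<kappa>\<in>freqs m. freq_norm_sq \<kappa> * (fourier_coeff f \<kappa>)\<^sup>2) = (\<Sum>i\<in>UNIV. \<Sum>\<kappa>\<in>freqs m. (fourier_coeff (\<lambda>x. wgrad f x $ i) \<kappa>)\<^sup>2)" for m
  proof -
    have "(\<Sum>i\<in>UNIV. \<Sum>\<kappa>\<in>freqs m. (fourier_coeff (\<lambda>x. wgrad f x $ i) \<kappa>)\<^sup>2) = (\<Sum>\<kappa>\<in>freqs m. \<Sum>i\<in>UNIV. (freq \<kappa> i)\<^sup>2 * (fourier_coeff f (- \<kappa>))\<^sup>2)"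
      by (subst sum.swap) (simp add: fourier_coeff_wgrad[OF f] power_mult_distrib)
    also have "\<dots> = (\<Sum>\<kappa>\<in>freqs m. freq_norm_sq (- \<kappa>) * (fourier_coeff f (- \<kappa>))\<^sup>2)"
      by (simp add: freq_norm_sq_def sum_distrib_right)
    finally show ?thesis using sum_freqs_uminus[of "\<lambda>\<kappa>. freq_norm_sq \<kappa> * (fourier_coeff f \<kappa>)\<^sup>2" m] by simp
  qed
  then show 1: "(\<lambda>m. \<Sum>\<kappa>\<in>freqs m. freq_norm_sq \<kappa> * (fourier_coeff f \<kappa>)\<^sup>2) \<longlonglongrightarrow> (L2_norm (wgrad f))\<^sup>2"
    unfolding L2_norm_vec[OF wgrad_L2[OF f]] by (simp add: tendsto_sum Parseval_norm wgrad_sq_integrable[OF f])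
  have "(H1_norm f)\<^sup>2 = (lnorm torus f)\<^sup>2 + (L2_norm (wgrad f))\<^sup>2"
    by (simp add: H1_norm_def L2_norm_real)
  with tendsto_add[OF Parseval_norm[OF H1_sq_integrable[OF f]] 1]
  show "(\<lambda>m. \<Sum>\<kappa>\<in>freqs m. (1 + freq_norm_sq \<kappa>) * (fourier_coeff f \<kappa>)\<^sup>2) \<longlonglongrightarrow> (H1_norm f)\<^sup>2"
    by (simp add: distrib_right sum.distrib)
qed

section \<open>The coefficients and the energy inequality\<close>

lemma square_summable_Cauchy_Schwarz:
  fixes a b :: "'k \<Rightarrow> real"
  assumes a: "(\<lambda>k. (a k)\<^sup>2) summable_on UNIV" and b: "(\<lambda>k. (b k)\<^sup>2) summable_on UNIV"
    and A: "(\<Sum>\<^sub>\<infinity>k. (a k)\<^sup>2) \<le> A\<^sup>2" and B: "(\<Sum>\<^sub>\<infinity>k. (b k)\<^sup>2) \<le> B\<^sup>2" and nn: "A \<ge> 0" "B \<ge> 0"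
  shows "(\<lambda>k. a k * b k) summable_on UNIV" and "\<bar>\<Sum>\<^sub>\<infinity>k. a k * b k\<bar> \<le> A * B"
proof -
  have fin: "(\<Sum>k\<in>F. \<bar>a k * b k\<bar>) \<le> A * B" if F: "finite F" for F
  proof -
    have sA: "(\<Sum>k\<in>F. (a k)\<^sup>2) \<le> A\<^sup>2"
      using finite_sum_le_infsum[OF a F] A by simp
    have sB: "(\<Sum>k\<in>F. (b k)\<^sup>2) \<le> B\<^sup>2"
      using finite_sum_le_infsum[OF b F] B by simp
    have "(\<Sum>k\<in>F. \<bar>a k\<bar> * \<bar>b k\<bar>) \<le> L2_set a F * L2_set b F" by (rule L2_set_mult_ineq)
    also have "\<dots> \<le> A * B"
      unfolding L2_set_def using sA sB nn by (intro mult_mono) (auto intro!: real_le_lsqrt sum_nonneg)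
    finally show ?thesis by (simp add: abs_mult)
  qed
  have s: "(\<lambda>k. \<bar>a k * b k\<bar>) summable_on UNIV"
    by (rule nonneg_bdd_above_summable_on) (auto intro!: bdd_aboveI2 fin)
  have abs: "(\<lambda>k. norm (a k * b k)) summable_on UNIV" using s by simp
  then show "(\<lambda>k. a k * b k) summable_on UNIV" by (rule abs_summable_summable)
  have "\<bar>\<Sum>\<^sub>\<infinity>k. a k * b k\<bar> \<le> (\<Sum>\<^sub>\<infinity>k. \<bar>a k * b k\<bar>)" using norm_infsum_bound[OF abs] by simp
  also have "\<dots> \<le> A * B" by (rule infsum_le_finite_sums[OF s]) (rule fin)
  finally show "\<bar>\<Sum>\<^sub>\<infinity>k. a k * b k\<bar> \<le> A * B" .
qed

lemma orthonormal_Bessel: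
  fixes e :: "'k \<Rightarrow> 'u::real_inner"
  assumes on: "\<And>j k. e j \<bullet> e k = (if j = k then 1 else 0)"
  shows "(\<lambda>k. (p \<bullet> e k)\<^sup>2) summable_on UNIV" and "(\<Sum>\<^sub>\<infinity>k. (p \<bullet> e k)\<^sup>2) \<le> (norm p)\<^sup>2"
proof -
  have fin: "(\<Sum>k\<in>F. (p \<bullet> e k)\<^sup>2) \<le> (norm p)\<^sup>2" if F: "finite F" for F
  proof -
    define q where "q = (\<Sum>k\<in>F. (p \<bullet> e k) *\<^sub>R e k)"
    have pq: "p \<bullet> q = (\<Sum>k\<in>F. (p \<bullet> e k)\<^sup>2)" by (simp add: q_def inner_sum_right power2_eq_square)
    have "e j \<bullet> q = p \<bullet> e j" if "j \<in> F" for j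
      using that F by (simp add: q_def inner_sum_right on if_distrib cong: if_cong)
    then have qq: "q \<bullet> q = (\<Sum>k\<in>F. (p \<bullet> e k)\<^sup>2)"
      by (subst (1) q_def) (simp add: inner_sum_left power2_eq_square)
    have "0 \<le> (p - q) \<bullet> (p - q)" by simp
    also have "\<dots> = (norm p)\<^sup>2 - (\<Sum>k\<in>F. (p \<bullet> e k)\<^sup>2)"
      by (simp add: inner_diff_left inner_diff_right pq qq inner_commute[of q p] power2_norm_eq_inner)
    finally show ?thesis by simp
  qed
  show s: "(\<lambda>k. (p \<bullet> e k)\<^sup>2) summable_on UNIV"
    by (rule nonneg_bdd_above_summable_on) (auto intro!: bdd_aboveI2 fin)
  show "(\<Sum>\<^sub>\<infinity>k. (p \<bullet> e k)\<^sup>2) \<le> (norm p)\<^sup>2" by (rule infsum_le_finite_sums[OF s]) (rule fin)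
qed

text \<open>The real function through which the noise operator in direction p acts on the values of u.\<close>

definition noise_density :: "('k \<Rightarrow> 'u::real_inner) \<Rightarrow> ('k \<Rightarrow> real \<Rightarrow> real) \<Rightarrow> 'u \<Rightarrow> real \<Rightarrow> real" where
  "noise_density e \<sigma> p y = (\<Sum>\<^sub>\<infinity>k. (p \<bullet> e k) * \<sigma> k y)"

lemma noise_op_eq: "noise_op e \<sigma> u p = (\<lambda>x. noise_density e \<sigma> p (u x))"
  by (simp add: noise_op_def noise_density_def)

text \<open>Cauchy--Schwarz in the sequence space turns the two summability conditions on \<open>\<sigma>\<close> into growth
  and Lipschitz bounds for a single real function.\<close>

lemma noise_density_bounds:
  fixes e :: "'k \<Rightarrow> 'u::real_inner"
  assumes on: "\<And>j k. e j \<bullet> e k = (if j = k then 1 else 0)" and C: "C > 0"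
    and grow: "\<And>y. (\<lambda>k. (\<sigma> k y)\<^sup>2) summable_on UNIV" "\<And>y. (\<Sum>\<^sub>\<infinity>k. (\<sigma> k y)\<^sup>2) \<le> C * (1 + y\<^sup>2)"
    and lip: "\<And>y z. (\<lambda>k. (\<sigma> k y - \<sigma> k z)\<^sup>2) summable_on UNIV" "\<And>y z. (\<Sum>\<^sub>\<infinity>k. (\<sigma> k y - \<sigma> k z)\<^sup>2) \<le> C * (y - z)\<^sup>2"
  shows "noise_density e \<sigma> (p - q) y = noise_density e \<sigma> p y - noise_density e \<sigma> q y"
    and "\<bar>noise_density e \<sigma> p y\<bar> \<le> sqrt C * norm p * (1 + \<bar>y\<bar>)"
    and "\<bar>noise_density e \<sigma> p y - noise_density e \<sigma> p z\<bar> \<le> sqrt C * norm p * \<bar>y - z\<bar>"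
proof -
  note P = orthonormal_Bessel[of e, OF on]
  have g: "(\<Sum>\<^sub>\<infinity>k. (\<sigma> k y)\<^sup>2) \<le> (sqrt C * (1 + \<bar>y\<bar>))\<^sup>2" for y
  proof -
    have "1 + y\<^sup>2 \<le> (1 + \<bar>y\<bar>)\<^sup>2" by (simp add: power2_sum)
    then have "C * (1 + y\<^sup>2) \<le> C * (1 + \<bar>y\<bar>)\<^sup>2" using C by (intro mult_left_mono) auto
    moreover have "(sqrt C * (1 + \<bar>y\<bar>))\<^sup>2 = C * (1 + \<bar>y\<bar>)\<^sup>2" using C by (simp add: power_mult_distrib)
    ultimately show ?thesis using grow(2)[of y] by linarith
  qed
  have l: "(\<Sum>\<^sub>\<infinity>k. (\<sigma> k y - \<sigma> k z)\<^sup>2) \<le> (sqrt C * \<bar>y - z\<bar>)\<^sup>2" for y z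
    using lip(2)[of y z] C by (simp add: power_mult_distrib)
  note CS = square_summable_Cauchy_Schwarz[OF P(1) grow(1) P(2) g]
  note CL = square_summable_Cauchy_Schwarz[OF P(1) lip(1) P(2) l]
  have s: "(\<lambda>k. (p \<bullet> e k) * \<sigma> k y) summable_on UNIV" for p y using CS(1) C by simp
  have diff: "(\<Sum>\<^sub>\<infinity>k. f k - g k) = (\<Sum>\<^sub>\<infinity>k. f k) - (\<Sum>\<^sub>\<infinity>k. g k)"
    if "f summable_on UNIV" "g summable_on UNIV" for f g :: "'k \<Rightarrow> real"
    using infsum_add[OF that(1) summable_on_uminus[THEN iffD2, OF that(2)]] by (simp add: infsum_uminus)
  show "noise_density e \<sigma> (p - q) y = noise_density e \<sigma> p y - noise_density e \<sigma> q y"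
    using diff[OF s[of p y] s[of q y]] unfolding noise_density_def by (simp add: inner_diff_left left_diff_distrib)
  show "\<bar>noise_density e \<sigma> p y\<bar> \<le> sqrt C * norm p * (1 + \<bar>y\<bar>)"
    unfolding noise_density_def using CS(2)[of p y] C by (simp add: mult_ac)
  have "noise_density e \<sigma> p y - noise_density e \<sigma> p z = (\<Sum>\<^sub>\<infinity>k. (p \<bullet> e k) * (\<sigma> k y - \<sigma> k z))"
    using diff[OF s[of p y] s[of p z]] unfolding noise_density_def by (simp add: right_diff_distrib)
  then show "\<bar>noise_density e \<sigma> p y - noise_density e \<sigma> p z\<bar> \<le> sqrt C * norm p * \<bar>y - z\<bar>"
    using CL(2)[of p y z] C by (simp add: mult_ac)
qed

lemma lipschitz_imp_measurable_compose:
  fixes f :: "real \<Rightarrow> real"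
  assumes lip: "\<And>y z. \<bar>f y - f z\<bar> \<le> L * \<bar>y - z\<bar>" and w: "w \<in> borel_measurable M"
  shows "(\<lambda>x. f (w x)) \<in> borel_measurable M"
proof -
  have "\<bar>L\<bar>-lipschitz_on UNIV f"
  proof (rule lipschitz_onI)
    fix y z show "dist (f y) (f z) \<le> \<bar>L\<bar> * dist y z"
      using lip[of y z] mult_right_mono[OF abs_ge_self[of L] abs_ge_zero[of "y - z"]] by (simp add: dist_real_def)
  qed simp
  then have "continuous_on UNIV f" by (rule lipschitz_on_continuous_on)
  then have "f \<in> borel_measurable borel" by (rule borel_measurable_continuous_onI)
  from measurable_compose[OF w this] show ?thesis .
qed

lemma lnorm_const_torus: "lnorm (torus :: (real^'d) measure) (\<lambda>x. c) = \<bar>c\<bar>"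
  using measure_torus[where 'd='d] by (simp add: lnorm_def)

lemma sq_integrable_const_torus [simp]: "sq_integrable (torus :: (real^'d) measure) (\<lambda>x. c)"
  by (intro sq_integrable_of_bounded[where C="\<bar>c\<bar>"] finite_measure_torus) auto

lemma nemytskii_growth:
  fixes f :: "real \<Rightarrow> real" and w :: "real^'d \<Rightarrow> real"
  assumes lip: "\<And>y z. \<bar>f y - f z\<bar> \<le> L * \<bar>y - z\<bar>" and grow: "\<And>y. \<bar>f y\<bar> \<le> K * (1 + \<bar>y\<bar>)"
    and w: "sq_integrable torus w"
  shows "sq_integrable torus (\<lambda>x. f (w x))" "lnorm torus (\<lambda>x. f (w x)) \<le> K * (1 + lnorm torus w)"
proof -
  have K: "K \<ge> 0" using grow[of 0] by simp
  note m = lipschitz_imp_measurable_compose[of f L, OF lip sq_integrableD(1)[OF w]]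
  have s: "sq_integrable torus (\<lambda>x. K * (1 + \<bar>w x\<bar>))"
    by (intro sq_integrable_cmult sq_integrable_add sq_integrable_const_torus sq_integrable_abs w)
  have le: "AE x in torus. \<bar>f (w x)\<bar> \<le> \<bar>K * (1 + \<bar>w x\<bar>)\<bar>"
    using grow K by (intro AE_I2) (simp add: abs_mult)
  show "sq_integrable torus (\<lambda>x. f (w x))" by (rule sq_integrable_bound[OF s m le])
  have "lnorm torus (\<lambda>x. f (w x)) \<le> lnorm torus (\<lambda>x. K * (1 + \<bar>w x\<bar>))" by (rule lnorm_mono[OF s m le])
  also have "\<dots> \<le> K * (lnorm torus (\<lambda>x::real^'d. 1) + lnorm torus (\<lambda>x. \<bar>w x\<bar>))"
    unfolding lnorm_cmult using K by (intro mult_mono lnorm_add_le sq_integrable_abs w) auto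
  finally show "lnorm torus (\<lambda>x. f (w x)) \<le> K * (1 + lnorm torus w)" by (simp add: lnorm_const_torus)
qed

lemma nemytskii_lipschitz:
  fixes f :: "real \<Rightarrow> real"
  assumes lip: "\<And>y z. \<bar>f y - f z\<bar> \<le> L * \<bar>y - z\<bar>"
    and w: "sq_integrable M w" and v: "sq_integrable M v"
  shows "lnorm M (\<lambda>x. f (w x) - f (v x)) \<le> L * lnorm M (\<lambda>x. w x - v x)"
proof -
  have L: "L \<ge> 0" using lip[of 1 0] by simp
  have "lnorm M (\<lambda>x. f (w x) - f (v x)) \<le> lnorm M (\<lambda>x. L * (w x - v x))"
    using lip L by (intro lnorm_mono sq_integrable_cmult sq_integrable_diff w v borel_measurable_diff
      lipschitz_imp_measurable_compose[of f L, OF lip] sq_integrableD(1)[OF w] sq_integrableD(1)[OF v])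
      (simp add: abs_mult)
  then show ?thesis using L by (simp add: lnorm_cmult)
qed

lemma bounded_multiplier:
  assumes "m \<in> borel_measurable M" "\<And>x. \<bar>m x\<bar> \<le> L" and g: "sq_integrable M g"
  shows "sq_integrable M (\<lambda>x. m x * g x)" "lnorm M (\<lambda>x. m x * g x) \<le> L * lnorm M g"
proof -
  have L: "L \<ge> 0" using assms(2)[of undefined] by simp
  have s: "sq_integrable M (\<lambda>x. L * g x)" by (rule sq_integrable_cmult[OF g])
  have m: "(\<lambda>x. m x * g x) \<in> borel_measurable M" using assms(1) sq_integrableD(1)[OF g] by measurable
  have le: "AE x in M. \<bar>m x * g x\<bar> \<le> \<bar>L * g x\<bar>"
    using assms(2) L by (intro AE_I2) (simp add: abs_mult mult_right_mono)
  show "sq_integrable M (\<lambda>x. m x * g x)" by (rule sq_integrable_bound[OF s m le])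
  show "lnorm M (\<lambda>x. m x * g x) \<le> L * lnorm M g" using lnorm_mono[OF s m le] L by (simp add: lnorm_cmult)
qed

text \<open>The Fourier coefficients of the i-th partial derivative of a function with coefficients c.\<close>

definition dcoef :: "'d \<Rightarrow> (int^'d \<Rightarrow> real) \<Rightarrow> int^'d \<Rightarrow> real" where
  "dcoef i c \<kappa> = - freq \<kappa> i * c (- \<kappa>)"

text \<open>The hypotheses in scalar form, with one constant for all upper bounds. The noise enters through a
  real function \<open>\<Theta> p\<close> for each direction p, which \<open>noise_density\<close> instantiates.\<close>

locale quasilinear =
  fixes T \<delta> L :: real
    and b :: "'d::finite \<Rightarrow> real \<Rightarrow> real"
    and a :: "'d \<Rightarrow> 'd \<Rightarrow> real \<Rightarrow> real"
    and \<Theta> :: "'u::{real_inner, banach, second_countable_topology} \<Rightarrow> real \<Rightarrow> real"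
    and h :: "real \<Rightarrow> 'u"
    and u0 :: "real^'d \<Rightarrow> real"
  assumes T: "T > 0" and \<delta>: "\<delta> > 0" and L: "L \<ge> 1"
    and b_lip: "\<bar>b i y - b i z\<bar> \<le> L * \<bar>y - z\<bar>"
    and b_growth: "\<bar>b i y\<bar> \<le> L * (1 + \<bar>y\<bar>)"
    and a_lip: "\<bar>a i j y - a i j z\<bar> \<le> L * \<bar>y - z\<bar>"
    and a_bound: "\<bar>a i j y\<bar> \<le> L"
    and coercive: "\<delta> * (\<Sum>i\<in>UNIV. (\<xi> i)\<^sup>2) \<le> (\<Sum>i\<in>UNIV. \<Sum>j\<in>UNIV. a i j y * \<xi> j * \<xi> i)"
    and \<Theta>_diff: "\<Theta> (p - q) y = \<Theta> p y - \<Theta> q y"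
    and \<Theta>_growth: "\<bar>\<Theta> p y\<bar> \<le> (L * norm p) * (1 + \<bar>y\<bar>)"
    and \<Theta>_lip: "\<bar>\<Theta> p y - \<Theta> p z\<bar> \<le> (L * norm p) * \<bar>y - z\<bar>"
    and h_meas: "h \<in> borel_measurable (lebesgue_on {0..T})"
    and h_sq: "integrable (lebesgue_on {0..T}) (\<lambda>t. (norm (h t))\<^sup>2)"
    and u0: "sq_integrable torus u0"
begin

definition flux :: "(real^'d \<Rightarrow> real) \<Rightarrow> ('d \<Rightarrow> real^'d \<Rightarrow> real) \<Rightarrow> 'd \<Rightarrow> real^'d \<Rightarrow> real" where
  "flux w g i x = b i (w x) - (\<Sum>j\<in>UNIV. a i j (w x) * g j x)"

text \<open>The right-hand side of the weak formulation for the Hartley function of index \<open>\<kappa>\<close>, whose gradient is a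
  multiple of the one of index \<open>- \<kappa>\<close>. The gradient g of w is a separate argument.\<close>

definition rate :: "int^'d \<Rightarrow> (real^'d \<Rightarrow> real) \<Rightarrow> ('d \<Rightarrow> real^'d \<Rightarrow> real) \<Rightarrow> 'u \<Rightarrow> real" where
  "rate \<kappa> w g p = (\<Sum>i\<in>UNIV. freq \<kappa> i * fourier_coeff (flux w g i) (- \<kappa>)) + fourier_coeff (\<lambda>x. \<Theta> p (w x)) \<kappa>"

lemmas b_sq = nemytskii_growth[of "b _", OF b_lip b_growth]
lemmas \<Theta>_sq = nemytskii_growth[of "\<Theta> _", OF \<Theta>_lip \<Theta>_growth]

lemma a_measurable: "sq_integrable torus w \<Longrightarrow> (\<lambda>x. a i j (w x)) \<in> borel_measurable torus"
  by (rule lipschitz_imp_measurable_compose[of "a i j", OF a_lip sq_integrableD(1)])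

lemma a_sq:
  assumes "sq_integrable torus w" "sq_integrable torus g"
  shows "sq_integrable torus (\<lambda>x. a i j (w x) * g x)" "lnorm torus (\<lambda>x. a i j (w x) * g x) \<le> L * lnorm torus g"
  by (rule bounded_multiplier[OF a_measurable[OF assms(1)] a_bound assms(2)])+

lemma flux_sq:
  assumes w: "sq_integrable torus w" and g: "\<And>j. sq_integrable torus (g j)"
  shows "sq_integrable torus (flux w g i)"
    "lnorm torus (flux w g i) \<le> L * (1 + lnorm torus w + (\<Sum>j\<in>UNIV. lnorm torus (g j)))"
proof -
  have s: "sq_integrable torus (\<lambda>x. \<Sum>j\<in>UNIV. a i j (w x) * g j x)"
    by (intro sq_integrable_sum a_sq w g)
  show "sq_integrable torus (flux w g i)"
    unfolding flux_def[abs_def] by (intro sq_integrable_diff b_sq w s)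
  have "lnorm torus (flux w g i) \<le> lnorm torus (\<lambda>x. b i (w x)) + lnorm torus (\<lambda>x. \<Sum>j\<in>UNIV. a i j (w x) * g j x)"
    unfolding flux_def[abs_def] by (intro lnorm_diff_le b_sq w s)
  also have "lnorm torus (\<lambda>x. b i (w x)) \<le> L * (1 + lnorm torus w)" by (rule b_sq(2)[OF w])
  also have "lnorm torus (\<lambda>x. \<Sum>j\<in>UNIV. a i j (w x) * g j x) \<le> (\<Sum>j\<in>UNIV. lnorm torus (\<lambda>x. a i j (w x) * g j x))"
    by (intro lnorm_sum_le a_sq w g)
  also have "\<dots> \<le> (\<Sum>j\<in>UNIV. L * lnorm torus (g j))" by (intro sum_mono a_sq w g)
  finally show "lnorm torus (flux w g i) \<le> L * (1 + lnorm torus w + (\<Sum>j\<in>UNIV. lnorm torus (g j)))"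
    by (simp add: sum_distrib_left algebra_simps)
qed

definition rate_const :: "int^'d \<Rightarrow> real" where
  "rate_const \<kappa> = L * (1 + (\<Sum>i\<in>UNIV. \<bar>freq \<kappa> i\<bar>))"

lemma rate_bound:
  assumes w: "sq_integrable torus w" and g: "\<And>j. sq_integrable torus (g j)"
  shows "\<bar>rate \<kappa> w g p\<bar> \<le> rate_const \<kappa> * (1 + lnorm torus w + (\<Sum>j\<in>UNIV. lnorm torus (g j)) + norm p * (1 + lnorm torus w))"
proof -
  let ?X = "1 + lnorm torus w + (\<Sum>j\<in>UNIV. lnorm torus (g j))" and ?Y = "norm p * (1 + lnorm torus w)"
  have X: "?X \<ge> 0" "?Y \<ge> 0" by (auto intro!: add_nonneg_nonneg sum_nonneg)
  have f: "\<bar>fourier_coeff (flux w g i) (- \<kappa>)\<bar> \<le> L * ?X" for i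
    by (rule order_trans[OF abs_fourier_coeff_le[OF flux_sq(1)[OF w g]] flux_sq(2)[OF w g]])
  have t: "\<bar>fourier_coeff (\<lambda>x. \<Theta> p (w x)) \<kappa>\<bar> \<le> L * ?Y"
    using order_trans[OF abs_fourier_coeff_le[OF \<Theta>_sq(1)[OF w]] \<Theta>_sq(2)[OF w], of p \<kappa>] by (simp add: mult_ac)
  have "\<bar>rate \<kappa> w g p\<bar> \<le> (\<Sum>i\<in>UNIV. \<bar>freq \<kappa> i * fourier_coeff (flux w g i) (- \<kappa>)\<bar>) + L * ?Y"
    unfolding rate_def using t by (intro order_trans[OF abs_triangle_ineq] add_mono sum_abs) 
  also have "(\<Sum>i\<in>UNIV. \<bar>freq \<kappa> i * fourier_coeff (flux w g i) (- \<kappa>)\<bar>) \<le> (\<Sum>i\<in>UNIV. \<bar>freq \<kappa> i\<bar> * (L * ?X))"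
    unfolding abs_mult by (intro sum_mono mult_left_mono f) auto
  also have "\<dots> = L * (\<Sum>i\<in>UNIV. \<bar>freq \<kappa> i\<bar>) * ?X" by (simp add: sum_distrib_right[symmetric])
  also have "L * (\<Sum>i\<in>UNIV. \<bar>freq \<kappa> i\<bar>) * ?X + L * ?Y \<le> rate_const \<kappa> * ?X + rate_const \<kappa> * ?Y"
    using L X by (intro add_mono mult_right_mono) (auto simp: rate_const_def sum_nonneg)
  finally show ?thesis by (simp add: distrib_left)
qed

lemma rate_const_nonneg: "0 \<le> rate_const \<kappa>"
  using L by (simp add: rate_const_def sum_nonneg)

lemma rate_bound_sq:
  assumes w: "sq_integrable torus w" and g: "\<And>j. sq_integrable torus (g j)"
  shows "(rate \<kappa> w g p)\<^sup>2 \<le> 4 * (rate_const \<kappa>)\<^sup>2 * CARD('d) *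
    ((1 + (lnorm torus w)\<^sup>2) * (1 + (norm p)\<^sup>2) * 2 + (\<Sum>j\<in>UNIV. (lnorm torus (g j))\<^sup>2))"
proof -
  define W where "W = lnorm torus w"
  define G where "G = (\<Sum>j\<in>UNIV. lnorm torus (g j))"
  define G2 where "G2 = (\<Sum>j\<in>UNIV. (lnorm torus (g j))\<^sup>2)"
  define D where "D = real CARD('d)"
  have D: "D \<ge> 1" unfolding D_def using zero_less_card_finite[where 'a='d] by linarith
  have "G\<^sup>2 \<le> (\<Sum>j\<in>(UNIV::'d set). 1\<^sup>2) * G2"
    unfolding G_def G2_def using Cauchy_Schwarz_ineq_sum[of "\<lambda>_. 1" "\<lambda>j. lnorm torus (g j)" "UNIV::'d set"] by simp
  then have G: "G\<^sup>2 \<le> D * G2" by (simp add: D_def)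
  have W: "W \<ge> 0" "G \<ge> 0" "G2 \<ge> 0" by (auto simp: W_def G_def G2_def sum_nonneg)
  have "\<bar>rate \<kappa> w g p\<bar> \<le> rate_const \<kappa> * ((1 + W) * (1 + norm p) + G)"
    using rate_bound[OF w g, where \<kappa>=\<kappa> and p=p] by (simp add: W_def G_def algebra_simps)
  then have "(rate \<kappa> w g p)\<^sup>2 \<le> (rate_const \<kappa> * ((1 + W) * (1 + norm p) + G))\<^sup>2"
    by (rule power2_le_iff_abs_le[THEN iffD2, rotated]) (use rate_const_nonneg W in auto)
  also have "\<dots> \<le> (rate_const \<kappa>)\<^sup>2 * (2 * ((1 + W) * (1 + norm p))\<^sup>2 + 2 * G\<^sup>2)"
    unfolding power_mult_distrib[of "rate_const \<kappa>"]
    by (intro mult_left_mono) (use sum_squares_bound[of "(1 + W) * (1 + norm p)" G] in \<open>auto simp: power2_sum\<close>)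
  also have "\<dots> \<le> (rate_const \<kappa>)\<^sup>2 * (4 * D * ((1 + W\<^sup>2) * (1 + (norm p)\<^sup>2) * 2 + G2))"
  proof (rule mult_left_mono)
    have "((1 + W) * (1 + norm p))\<^sup>2 \<le> (2 * (1 + W\<^sup>2)) * (2 * (1 + (norm p)\<^sup>2))"
      unfolding power_mult_distrib using sum_squares_bound[of 1 W] sum_squares_bound[of 1 "norm p"]
      by (intro mult_mono) (auto simp: power2_sum)
    moreover have "1 * ((1 + W\<^sup>2) * (1 + (norm p)\<^sup>2)) \<le> D * ((1 + W\<^sup>2) * (1 + (norm p)\<^sup>2))"
      using D by (intro mult_right_mono) auto
    moreover have "D * G2 \<ge> 0" using W(3) D by simp
    ultimately show "2 * ((1 + W) * (1 + norm p))\<^sup>2 + 2 * G\<^sup>2 \<le> 4 * D * ((1 + W\<^sup>2) * (1 + (norm p)\<^sup>2) * 2 + G2)"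
      using G by (simp add: algebra_simps)
  qed simp
  finally show ?thesis unfolding W_def G2_def D_def by (simp only: mult_ac)
qed

lemma lnorm_dcoef:
  "(\<Sum>i\<in>UNIV. (lnorm torus (fourier_sum (freqs n) (dcoef i v)))\<^sup>2) = (\<Sum>\<kappa>\<in>freqs n. freq_norm_sq \<kappa> * (v \<kappa>)\<^sup>2)"
proof -
  have "(\<Sum>i\<in>UNIV. (lnorm torus (fourier_sum (freqs n) (dcoef i v)))\<^sup>2) = (\<Sum>\<kappa>\<in>freqs n. \<Sum>i\<in>UNIV. (freq \<kappa> i)\<^sup>2 * (v (- \<kappa>))\<^sup>2)"
    by (subst sum.swap) (simp add: lnorm_fourier_sum dcoef_def power_mult_distrib)
  also have "\<dots> = (\<Sum>\<kappa>\<in>freqs n. freq_norm_sq (- \<kappa>) * (v (- \<kappa>))\<^sup>2)" by (simp add: freq_norm_sq_def sum_distrib_right)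
  finally show ?thesis using sum_freqs_uminus[of "\<lambda>\<kappa>. freq_norm_sq \<kappa> * (v \<kappa>)\<^sup>2" n] by simp
qed

lemma sum_freq_fourier_coeff:
  assumes f: "sq_integrable torus f"
  shows "(\<Sum>\<kappa>\<in>freqs n. v \<kappa> * (freq \<kappa> i * fourier_coeff f (- \<kappa>))) = (LINT x|torus. f x * fourier_sum (freqs n) (dcoef i v) x)"
  unfolding integral_mult_fourier_sum[OF f] dcoef_def
  using sum_freqs_uminus[of "\<lambda>\<kappa>. - freq \<kappa> i * v (- \<kappa>) * fourier_coeff f \<kappa>" n] by (simp add: mult_ac)

definition C_energy :: real where
  "C_energy = CARD('d) * L\<^sup>2 / \<delta> + 2 * L"

text \<open>Summing the rates against the coefficients of the state amounts to testing with the state. Coercivity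
  gives twice the gradient term on the right; half of it absorbs the drift by Young's inequality.\<close>

lemma energy_inequality:
  fixes v :: "int^'d \<Rightarrow> real" and n :: nat
  defines "w \<equiv> fourier_sum (freqs n) v" and "g \<equiv> \<lambda>i. fourier_sum (freqs n) (dcoef i v)"
  shows "(\<Sum>\<kappa>\<in>freqs n. v \<kappa> * rate \<kappa> w g p)
    \<le> - (\<delta> / 2) * (\<Sum>\<kappa>\<in>freqs n. freq_norm_sq \<kappa> * (v \<kappa>)\<^sup>2) + C_energy * ((1 + (\<Sum>\<kappa>\<in>freqs n. (v \<kappa>)\<^sup>2)) * (1 + (norm p)\<^sup>2))"
proof -
  have w: "sq_integrable torus w" and g: "\<And>i. sq_integrable torus (g i)" by (simp_all add: w_def g_def)
  define W where "W = lnorm torus w"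
  define N where "N i = lnorm torus (g i)" for i
  have W: "W \<ge> 0" by (simp add: W_def)
  have W2: "W\<^sup>2 = (\<Sum>\<kappa>\<in>freqs n. (v \<kappa>)\<^sup>2)" by (simp add: W_def w_def lnorm_fourier_sum)
  have N2: "(\<Sum>i\<in>UNIV. (N i)\<^sup>2) = (\<Sum>\<kappa>\<in>freqs n. freq_norm_sq \<kappa> * (v \<kappa>)\<^sup>2)" by (simp add: N_def g_def lnorm_dcoef)
  have w1: "(1 + W)\<^sup>2 \<le> 2 * (1 + W\<^sup>2)" using sum_squares_bound[of 1 W] by (simp add: power2_sum)
  have "(\<Sum>\<kappa>\<in>freqs n. v \<kappa> * rate \<kappa> w g p)
      = (\<Sum>i\<in>UNIV. \<Sum>\<kappa>\<in>freqs n. v \<kappa> * (freq \<kappa> i * fourier_coeff (flux w g i) (- \<kappa>))) + (\<Sum>\<kappa>\<in>freqs n. v \<kappa> * fourier_coeff (\<lambda>x. \<Theta> p (w x)) \<kappa>)"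
    unfolding rate_def by (subst sum.swap) (simp add: distrib_left sum.distrib sum_distrib_left)
  also have "\<dots> = (\<Sum>i\<in>UNIV. LINT x|torus. flux w g i x * g i x) + (LINT x|torus. \<Theta> p (w x) * w x)"
    using sum_freq_fourier_coeff[OF flux_sq(1)[OF w g]] integral_mult_fourier_sum[OF \<Theta>_sq(1)[OF w]] by (simp add: g_def w_def)
  finally have 1: "(\<Sum>\<kappa>\<in>freqs n. v \<kappa> * rate \<kappa> w g p) = (\<Sum>i\<in>UNIV. LINT x|torus. flux w g i x * g i x) + (LINT x|torus. \<Theta> p (w x) * w x)" .
  have ib: "integrable torus (\<lambda>x. b i (w x) * g i x)" for i by (intro sq_integrable_mult b_sq w g)
  have ia: "integrable torus (\<lambda>x. a i j (w x) * g j x * g i x)" for i j by (intro sq_integrable_mult a_sq w g)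
  have fx: "(LINT x|torus. flux w g i x * g i x) = (LINT x|torus. b i (w x) * g i x) - (LINT x|torus. (\<Sum>j\<in>UNIV. a i j (w x) * g j x * g i x))" for i
    unfolding flux_def left_diff_distrib sum_distrib_right
    by (rule Bochner_Integration.integral_diff) (intro ib Bochner_Integration.integrable_sum ia)+
  have "\<delta> * (\<Sum>i\<in>UNIV. (N i)\<^sup>2) = (LINT x|torus. \<delta> * (\<Sum>i\<in>UNIV. (g i x)\<^sup>2))"
    using sq_integrableD(2)[OF g] by (simp add: N_def lnorm_power2 Bochner_Integration.integral_sum)
  also have "\<dots> \<le> (LINT x|torus. (\<Sum>i\<in>UNIV. \<Sum>j\<in>UNIV. a i j (w x) * g j x * g i x))"
    using sq_integrableD(2)[OF g]
    by (intro integral_mono coercive Bochner_Integration.integrable_sum ia integrable_mult_right) auto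
  also have "\<dots> = (\<Sum>i\<in>UNIV. LINT x|torus. (\<Sum>j\<in>UNIV. a i j (w x) * g j x * g i x))"
    by (intro Bochner_Integration.integral_sum Bochner_Integration.integrable_sum ia)
  finally have co: "\<delta> * (\<Sum>i\<in>UNIV. (N i)\<^sup>2) \<le> (\<Sum>i\<in>UNIV. LINT x|torus. (\<Sum>j\<in>UNIV. a i j (w x) * g j x * g i x))" .
  have bb: "(LINT x|torus. b i (w x) * g i x) \<le> \<delta> / 2 * (N i)\<^sup>2 + L\<^sup>2 / \<delta> * (1 + W\<^sup>2)" for i
  proof -
    have "(LINT x|torus. b i (w x) * g i x) \<le> lnorm torus (\<lambda>x. b i (w x)) * N i"
      unfolding N_def using Cauchy_Schwarz_lnorm[OF b_sq(1)[OF w] g, of i i] by linarith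
    also have "\<dots> \<le> L * (1 + W) * N i"
      unfolding W_def N_def by (intro mult_right_mono b_sq w) auto
    also have "\<dots> \<le> \<delta> / 2 * (N i)\<^sup>2 + L\<^sup>2 * (1 + W)\<^sup>2 / (2 * \<delta>)"
    proof -
      have "0 \<le> (\<delta> * N i - L * (1 + W))\<^sup>2 / (2 * \<delta>)" using \<delta> by simp
      also have "\<dots> = \<delta> / 2 * (N i)\<^sup>2 + L\<^sup>2 * (1 + W)\<^sup>2 / (2 * \<delta>) - L * (1 + W) * N i"
        using \<delta> by (simp add: power2_eq_square field_simps)
      finally show ?thesis by simp
    qed
    also have "L\<^sup>2 * (1 + W)\<^sup>2 / (2 * \<delta>) \<le> L\<^sup>2 * (2 * (1 + W\<^sup>2)) / (2 * \<delta>)"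
      using \<delta> w1 by (intro divide_right_mono mult_left_mono) auto
    also have "\<dots> = L\<^sup>2 / \<delta> * (1 + W\<^sup>2)" using \<delta> by (simp add: field_simps)
    finally show ?thesis by simp
  qed
  have tt: "(LINT x|torus. \<Theta> p (w x) * w x) \<le> 2 * L * ((1 + W\<^sup>2) * (1 + (norm p)\<^sup>2))"
  proof -
    have "(LINT x|torus. \<Theta> p (w x) * w x) \<le> lnorm torus (\<lambda>x. \<Theta> p (w x)) * W"
      unfolding W_def using Cauchy_Schwarz_lnorm[OF \<Theta>_sq(1)[OF w] w, of p] by linarith
    also have "\<dots> \<le> (L * norm p * (1 + W)) * W"
      unfolding W_def by (intro mult_right_mono \<Theta>_sq w) auto
    also have "\<dots> \<le> (L * norm p * (1 + W)) * (1 + W)"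
      using L W by (intro mult_left_mono) auto
    also have "\<dots> = L * norm p * (1 + W)\<^sup>2" by (simp add: power2_eq_square)
    also have "\<dots> \<le> L * (1 + (norm p)\<^sup>2) * (2 * (1 + W\<^sup>2))"
    proof (intro mult_mono w1)
      show "norm p \<le> 1 + (norm p)\<^sup>2" using sum_squares_bound[of 1 "norm p", simplified] norm_ge_zero[of p] by linarith
    qed (use L in auto)
    finally show ?thesis by (simp only: mult_ac)
  qed
  have "(\<Sum>i\<in>UNIV. LINT x|torus. flux w g i x * g i x) \<le> (\<Sum>i\<in>UNIV. \<delta> / 2 * (N i)\<^sup>2 + L\<^sup>2 / \<delta> * (1 + W\<^sup>2)) - \<delta> * (\<Sum>i\<in>UNIV. (N i)\<^sup>2)"
    unfolding fx sum_subtractf using co bb by (intro diff_mono sum_mono) auto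
  also have "\<dots> = - (\<delta> / 2) * (\<Sum>i\<in>UNIV. (N i)\<^sup>2) + CARD('d) * L\<^sup>2 / \<delta> * (1 + W\<^sup>2)"
    by (simp add: sum.distrib sum_distrib_left[symmetric] sum_divide_distrib[symmetric] algebra_simps)
  also have "CARD('d) * L\<^sup>2 / \<delta> * (1 + W\<^sup>2) \<le> CARD('d) * L\<^sup>2 / \<delta> * ((1 + W\<^sup>2) * (1 + (norm p)\<^sup>2))"
    using \<delta> by (intro mult_left_mono) (auto simp: algebra_simps)
  finally show ?thesis using 1 tt unfolding W2[symmetric] N2[symmetric] C_energy_def by (simp add: algebra_simps)
qed

end

section \<open>The Euler--Galerkin scheme\<close>

lemma integrable_lebesgue_on_subinterval:
  fixes f :: "real \<Rightarrow> real"
  assumes "integrable (lebesgue_on {0..T}) f" "0 \<le> a" "b \<le> T"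
  shows "integrable (lebesgue_on {a..b}) f"
proof -
  have "set_integrable lebesgue {0..T} f"
    using assms(1) by (simp add: set_integrable_def integrable_restrict_space)
  then have "set_integrable lebesgue {a..b} f"
    by (rule set_integrable_subset) (use assms in auto)
  then show ?thesis by (simp add: set_integrable_def integrable_restrict_space)
qed

lemma lebesgue_on_interval_integral:
  fixes f :: "real \<Rightarrow> real"
  assumes "integrable (lebesgue_on {0..T}) f" "0 \<le> a" "b \<le> T"
  shows "(LINT s|lebesgue_on {a..b}. f s) = integral {a..b} f" "f integrable_on {a..b}"
  using integrable_lebesgue_on_subinterval[OF assms]
  by (auto intro: lebesgue_integral_eq_integral integrable_on_lebesgue_on)

lemma integral_square_le:
  fixes f :: "real \<Rightarrow> real"
  assumes f: "sq_integrable (lebesgue_on {0..T}) f" and ab: "0 \<le> a" "a \<le> b" "b \<le> T"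
  shows "(integral {a..b} f)\<^sup>2 \<le> (b - a) * integral {a..b} (\<lambda>s. (f s)\<^sup>2)"
proof -
  let ?M = "lebesgue_on {a..b}"
  have fin: "finite_measure ?M" by (rule finite_measure_lebesgue_on) simp
  have i2: "integrable (lebesgue_on {0..T}) (\<lambda>s. (f s)\<^sup>2)" using f by (rule sq_integrableD)
  have i1: "integrable (lebesgue_on {0..T}) f"
    by (rule sq_integrable_imp_integrable[OF _ f]) (rule finite_measure_lebesgue_on, simp)
  have sq: "sq_integrable ?M f"
    using integrable_lebesgue_on_subinterval[OF i1 ab(1,3)] integrable_lebesgue_on_subinterval[OF i2 ab(1,3)]
    by (simp add: sq_integrable_def)
  have "\<bar>LINT s|?M. f s\<bar> \<le> (LINT s|?M. \<bar>f s\<bar>)" by (rule integral_abs_bound)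
  also have "\<dots> \<le> sqrt (measure ?M (space ?M)) * lnorm ?M f" by (rule integral_abs_le_lnorm[OF fin sq])
  also have "measure ?M (space ?M) = b - a" using ab by (simp add: measure_restrict_space)
  finally have "\<bar>LINT s|?M. f s\<bar>\<^sup>2 \<le> (sqrt (b - a) * lnorm ?M f)\<^sup>2" by (intro power_mono) auto
  then show ?thesis
    using ab by (simp add: power_mult_distrib lnorm_power2 lebesgue_on_interval_integral[OF i1 ab(1,3)]
        lebesgue_on_interval_integral[OF i2 ab(1,3)])
qed

definition cell :: "real \<Rightarrow> real \<Rightarrow> nat" where
  "cell \<tau> s = nat \<lfloor>s / \<tau>\<rfloor>"

lemma cell_eqI:
  assumes "\<tau> > 0" "real j * \<tau> \<le> s" "s < (real j + 1) * \<tau>" shows "cell \<tau> s = j"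
proof -
  have "\<lfloor>s / \<tau>\<rfloor> = int j" using assms by (intro floor_unique) (auto simp: field_simps)
  then show ?thesis by (simp add: cell_def)
qed

lemma cell_bounds:
  assumes "\<tau> > 0" "s \<ge> 0" shows "real (cell \<tau> s) * \<tau> \<le> s" "s < (real (cell \<tau> s) + 1) * \<tau>"
proof -
  have "0 \<le> s / \<tau>" using assms by simp
  then have 1: "real (cell \<tau> s) = of_int \<lfloor>s / \<tau>\<rfloor>" by (simp add: cell_def)
  have 2: "of_int \<lfloor>s / \<tau>\<rfloor> \<le> s / \<tau>" "s / \<tau> < of_int \<lfloor>s / \<tau>\<rfloor> + 1" by linarith+
  show "real (cell \<tau> s) * \<tau> \<le> s" "s < (real (cell \<tau> s) + 1) * \<tau>"
    using mult_right_mono[OF 2(1), of \<tau>] mult_strict_right_mono[OF 2(2), of \<tau>] assms unfolding 1 by auto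
qed

text \<open>Over each cell of the mesh the integrand has a fixed index, so the integral is a sum over cells.\<close>

lemma has_integral_cells:
  fixes F :: "nat \<Rightarrow> real \<Rightarrow> real"
  assumes \<tau>: "\<tau> > 0" and F: "\<And>i. i < j \<Longrightarrow> F i integrable_on {real i * \<tau>..(real i + 1) * \<tau>}"
  shows "((\<lambda>s. F (cell \<tau> s) s) has_integral (\<Sum>i<j. integral {real i * \<tau>..(real i + 1) * \<tau>} (F i))) {0..real j * \<tau>}"
  using F
proof (induction j)
  case 0 then show ?case by (simp add: has_integral_refl)
next
  case (Suc j)
  have "(F j has_integral integral {real j * \<tau>..(real j + 1) * \<tau>} (F j)) {real j * \<tau>..(real j + 1) * \<tau>}"
    using Suc.prems[of j] by (simp add: integrable_integral)
  then have "((\<lambda>s. F (cell \<tau> s) s) has_integral integral {real j * \<tau>..(real j + 1) * \<tau>} (F j)) {real j * \<tau>..(real j + 1) * \<tau>}"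
  proof (rule has_integral_spike_finite[of "{(real j + 1) * \<tau>}", rotated 2])
    fix s assume "s \<in> {real j * \<tau>..(real j + 1) * \<tau>} - {(real j + 1) * \<tau>}"
    then have "cell \<tau> s = j" using \<tau> by (intro cell_eqI) auto
    then show "F (cell \<tau> s) s = F j s" by simp
  qed simp
  moreover have "((\<lambda>s. F (cell \<tau> s) s) has_integral (\<Sum>i<j. integral {real i * \<tau>..(real i + 1) * \<tau>} (F i))) {0..real j * \<tau>}"
    using Suc by simp
  ultimately have "((\<lambda>s. F (cell \<tau> s) s) has_integral (\<Sum>i<j. integral {real i * \<tau>..(real i + 1) * \<tau>} (F i)) + integral {real j * \<tau>..(real j + 1) * \<tau>} (F j)) {0..(real j + 1) * \<tau>}"
    using \<tau> by (intro has_integral_combine[of 0 "real j * \<tau>" "(real j + 1) * \<tau>"]) auto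
  then show ?case by (simp add: add.commute)
qed

lemma cell_measurable [measurable]: "cell \<tau> \<in> measurable (lebesgue_on S) (count_space UNIV)"
proof -
  have "(\<lambda>s. nat \<lfloor>s / \<tau>\<rfloor>) \<in> measurable borel (count_space UNIV)" by measurable
  moreover have "(\<lambda>s. s) \<in> measurable (lebesgue_on S) borel"
    by (rule measurable_restrict_space1) (simp add: measurable_completion)
  ultimately show ?thesis unfolding cell_def[abs_def] by (rule measurable_compose[rotated])
qed

context quasilinear
begin

abbreviation time :: "real measure" where "time \<equiv> lebesgue_on {0..T}"

lemma finite_measure_time: "finite_measure time"
  by (rule finite_measure_lebesgue_on) simp

lemma integrable_const_time [simp]: "integrable time (\<lambda>s. c :: real)"
  using finite_measure.integrable_const[OF finite_measure_time] .

definition galerkin_rate :: "nat \<Rightarrow> int^'d \<Rightarrow> (int^'d \<Rightarrow> real) \<Rightarrow> real \<Rightarrow> real" where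
  "galerkin_rate n \<kappa> v s = rate \<kappa> (fourier_sum (freqs n) v) (\<lambda>i. fourier_sum (freqs n) (dcoef i v)) (h s)"

lemma fourier_coeff_\<Theta>_lipschitz:
  assumes w: "sq_integrable torus w"
  shows "\<bar>fourier_coeff (\<lambda>x. \<Theta> p (w x)) \<kappa> - fourier_coeff (\<lambda>x. \<Theta> q (w x)) \<kappa>\<bar> \<le> (L * (1 + lnorm torus w)) * dist p q"
proof -
  have "fourier_coeff (\<lambda>x. \<Theta> p (w x)) \<kappa> - fourier_coeff (\<lambda>x. \<Theta> q (w x)) \<kappa> = fourier_coeff (\<lambda>x. \<Theta> (p - q) (w x)) \<kappa>"
    unfolding \<Theta>_diff by (rule fourier_coeff_diff[OF \<Theta>_sq(1)[OF w] \<Theta>_sq(1)[OF w], symmetric])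
  also have "\<bar>\<dots>\<bar> \<le> L * norm (p - q) * (1 + lnorm torus w)"
    by (rule order_trans[OF abs_fourier_coeff_le[OF \<Theta>_sq(1)[OF w]] \<Theta>_sq(2)[OF w]])
  finally show ?thesis by (simp add: dist_norm mult_ac)
qed

lemma continuous_fourier_coeff_\<Theta>:
  assumes w: "sq_integrable torus w"
  shows "continuous_on UNIV (\<lambda>p. fourier_coeff (\<lambda>x. \<Theta> p (w x)) \<kappa>)"
proof (rule lipschitz_on_continuous_on)
  show "(L * (1 + lnorm torus w))-lipschitz_on UNIV (\<lambda>p. fourier_coeff (\<lambda>x. \<Theta> p (w x)) \<kappa>)"
    using fourier_coeff_\<Theta>_lipschitz[OF w] L by (intro lipschitz_onI) (auto simp: dist_real_def)
qed

lemma rate_measurable: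
  assumes w: "sq_integrable torus w"
  shows "(\<lambda>s. rate \<kappa> w g (h s)) \<in> borel_measurable time"
proof -
  have "(\<lambda>p. fourier_coeff (\<lambda>x. \<Theta> p (w x)) \<kappa>) \<in> borel_measurable borel"
    by (rule borel_measurable_continuous_onI[OF continuous_fourier_coeff_\<Theta>[OF w]])
  from measurable_compose[OF h_meas this] show ?thesis unfolding rate_def by measurable
qed

lemma galerkin_rate_measurable: "galerkin_rate n \<kappa> v \<in> borel_measurable time"
  unfolding galerkin_rate_def[abs_def] by (rule rate_measurable) simp

definition forcing :: "real \<Rightarrow> real" where "forcing s = 1 + (norm (h s))\<^sup>2"

lemma forcing_integrable: "integrable time forcing"
  unfolding forcing_def[abs_def] using h_sq by simp

lemma forcing_nonneg: "0 \<le> forcing s" "1 \<le> forcing s" by (auto simp: forcing_def)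

definition vnorm2 :: "nat \<Rightarrow> (int^'d \<Rightarrow> real) \<Rightarrow> real" where
  "vnorm2 n v = (\<Sum>\<kappa>\<in>freqs n. (v \<kappa>)\<^sup>2)"

definition vgrad2 :: "nat \<Rightarrow> (int^'d \<Rightarrow> real) \<Rightarrow> real" where
  "vgrad2 n v = (\<Sum>\<kappa>\<in>freqs n. freq_norm_sq \<kappa> * (v \<kappa>)\<^sup>2)"

lemma vnorm2_nonneg [simp]: "0 \<le> vnorm2 n v" "0 \<le> vgrad2 n v"
  by (auto simp: vnorm2_def vgrad2_def sum_nonneg)

definition rate_const_sq :: "int^'d \<Rightarrow> real" where
  "rate_const_sq \<kappa> = 4 * (rate_const \<kappa>)\<^sup>2 * CARD('d)"

lemma rate_const_sq_nonneg: "0 \<le> rate_const_sq \<kappa>" by (simp add: rate_const_sq_def)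

lemma galerkin_rate_sq_le: "(galerkin_rate n \<kappa> v s)\<^sup>2 \<le> rate_const_sq \<kappa> * (2 * (1 + vnorm2 n v) * forcing s + vgrad2 n v)"
  using rate_bound_sq[where w="fourier_sum (freqs n) v" and g="\<lambda>i. fourier_sum (freqs n) (dcoef i v)" and \<kappa>=\<kappa> and p="h s",
      OF sq_integrable_fourier_sum sq_integrable_fourier_sum]
  unfolding galerkin_rate_def rate_const_sq_def forcing_def lnorm_dcoef vgrad2_def vnorm2_def by (simp only: lnorm_fourier_sum[OF finite_freqs] mult_ac)

lemma galerkin_rate_sq_integrable: "sq_integrable time (galerkin_rate n \<kappa> v)"
  unfolding sq_integrable_def
proof
  show "integrable time (\<lambda>s. (galerkin_rate n \<kappa> v s)\<^sup>2)"
  proof (rule Bochner_Integration.integrable_bound)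
    show "integrable time (\<lambda>s. rate_const_sq \<kappa> * (2 * (1 + vnorm2 n v) * forcing s + vgrad2 n v))"
      using forcing_integrable by (intro integrable_mult_right Bochner_Integration.integrable_add integrable_const_time)
    show "AE s in time. norm ((galerkin_rate n \<kappa> v s)\<^sup>2) \<le> norm (rate_const_sq \<kappa> * (2 * (1 + vnorm2 n v) * forcing s + vgrad2 n v))"
      using galerkin_rate_sq_le by (intro AE_I2) (simp, meson abs_ge_self order_trans)
  qed (use galerkin_rate_measurable in measurable)
qed (rule galerkin_rate_measurable)

lemma galerkin_rate_integrable: "integrable time (galerkin_rate n \<kappa> v)"
  by (rule sq_integrable_imp_integrable[OF finite_measure_time galerkin_rate_sq_integrable])

text \<open>A bound for the squares of the rates of all modes up to n, relative to the size of the state. The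
  gradient of the state is estimated by its norm, which is why the bound grows with n.\<close>

definition cfl :: "nat \<Rightarrow> real" where
  "cfl n = (\<Sum>\<kappa>\<in>freqs n. rate_const_sq \<kappa> * (2 + (\<Sum>\<mu>\<in>(freqs n :: (int^'d) set). freq_norm_sq \<mu>)))"

definition C_growth :: real where "C_growth = 2 * C_energy + 1"

lemma C_energy_nonneg: "0 \<le> C_energy"
  using L \<delta> by (simp add: C_energy_def)

lemma vgrad2_le: "vgrad2 n v \<le> (\<Sum>\<mu>\<in>(freqs n :: (int^'d) set). freq_norm_sq \<mu>) * vnorm2 n v"
  unfolding vgrad2_def vnorm2_def sum_distrib_left
  by (intro sum_mono mult_right_mono member_le_sum) auto

text \<open>The square of the increment is of second order in the step; the step restriction lets it be
  absorbed. The cross term is controlled by the coercivity of the diffusion.\<close>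

lemma euler_step:
  fixes v :: "int^'d \<Rightarrow> real"
  assumes ab: "0 \<le> t1" "t1 \<le> t2" "t2 \<le> T" and cfl: "(t2 - t1) * cfl n \<le> 1"
  defines "v' \<equiv> \<lambda>\<kappa>. v \<kappa> + integral {t1..t2} (galerkin_rate n \<kappa> v)"
  shows "1 + vnorm2 n v' + \<delta> * (t2 - t1) * vgrad2 n v \<le> (1 + vnorm2 n v) * (1 + C_growth * integral {t1..t2} forcing)"
proof -
  let ?I = "integral {t1..t2}"
  let ?V = "vnorm2 n v" and ?G = "vgrad2 n v" and ?H = "?I forcing"
  let ?\<Lambda> = "\<Sum>\<mu>\<in>(freqs n :: (int^'d) set). freq_norm_sq \<mu>"
  note gi = lebesgue_on_interval_integral(2)[OF galerkin_rate_integrable ab(1,3)]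
  note hi = lebesgue_on_interval_integral(2)[OF forcing_integrable ab(1,3)]
  note g2i = lebesgue_on_interval_integral(2)[OF sq_integrableD(2)[OF galerkin_rate_sq_integrable] ab(1,3)]
  have c: "?I (\<lambda>s. c) = (t2 - t1) * c" for c :: real using ab by simp
  have "vnorm2 n v' = ?V + 2 * (\<Sum>\<kappa>\<in>freqs n. v \<kappa> * ?I (galerkin_rate n \<kappa> v)) + (\<Sum>\<kappa>\<in>freqs n. (?I (galerkin_rate n \<kappa> v))\<^sup>2)"
    by (simp add: vnorm2_def v'_def power2_sum sum.distrib sum_distrib_left mult.assoc)
  moreover have "2 * (\<Sum>\<kappa>\<in>freqs n. v \<kappa> * ?I (galerkin_rate n \<kappa> v)) \<le> - \<delta> * (t2 - t1) * ?G + 2 * C_energy * (1 + ?V) * ?H"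
  proof -
    have "(\<Sum>\<kappa>\<in>freqs n. v \<kappa> * ?I (galerkin_rate n \<kappa> v)) = ?I (\<lambda>s. \<Sum>\<kappa>\<in>freqs n. v \<kappa> * galerkin_rate n \<kappa> v s)"
      using gi by (subst Henstock_Kurzweil_Integration.integral_sum) (auto intro: integrable_on_mult_right)
    also have "\<dots> \<le> ?I (\<lambda>s. - (\<delta> / 2) * ?G + C_energy * (1 + ?V) * forcing s)"
    proof (rule integral_le)
      show "(\<lambda>s. \<Sum>\<kappa>\<in>freqs n. v \<kappa> * galerkin_rate n \<kappa> v s) integrable_on {t1..t2}"
        using gi by (intro integrable_sum integrable_on_mult_right) auto
      show "(\<lambda>s. - (\<delta> / 2) * ?G + C_energy * (1 + ?V) * forcing s) integrable_on {t1..t2}"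
        using hi by (intro integrable_add integrable_on_mult_right integrable_const_ivl)
      show "(\<Sum>\<kappa>\<in>freqs n. v \<kappa> * galerkin_rate n \<kappa> v s) \<le> - (\<delta> / 2) * ?G + C_energy * (1 + ?V) * forcing s" for s
        using energy_inequality[where v=v and n=n and p="h s"]
        unfolding galerkin_rate_def vnorm2_def vgrad2_def forcing_def by (simp add: mult.assoc)
    qed
    also have "\<dots> = (t2 - t1) * (- (\<delta> / 2) * ?G) + C_energy * (1 + ?V) * ?H"
      using hi ab(2) by (subst Henstock_Kurzweil_Integration.integral_add) (auto simp: c intro: integrable_on_mult_right)
    finally have "2 * (\<Sum>\<kappa>\<in>freqs n. v \<kappa> * ?I (galerkin_rate n \<kappa> v))
      \<le> 2 * ((t2 - t1) * (- (\<delta> / 2) * ?G) + C_energy * (1 + ?V) * ?H)" by (rule mult_left_mono) simp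
    also have "\<dots> = - \<delta> * (t2 - t1) * ?G + 2 * C_energy * (1 + ?V) * ?H" by (simp add: field_simps)
    finally show ?thesis .
  qed
  moreover have "(\<Sum>\<kappa>\<in>freqs n. (?I (galerkin_rate n \<kappa> v))\<^sup>2) \<le> (1 + ?V) * ?H"
  proof -
    have H0: "?H \<ge> 0" using forcing_nonneg by (intro integral_nonneg hi) auto
    have "(?I (galerkin_rate n \<kappa> v))\<^sup>2 \<le> (t2 - t1) * (rate_const_sq \<kappa> * (2 + ?\<Lambda>) * ((1 + ?V) * ?H))" for \<kappa>
    proof -
      have "(?I (galerkin_rate n \<kappa> v))\<^sup>2 \<le> (t2 - t1) * ?I (\<lambda>s. (galerkin_rate n \<kappa> v s)\<^sup>2)"
        by (rule integral_square_le[OF galerkin_rate_sq_integrable ab])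
      also have "\<dots> \<le> (t2 - t1) * ?I (\<lambda>s. rate_const_sq \<kappa> * (2 + ?\<Lambda>) * (1 + ?V) * forcing s)"
      proof (rule mult_left_mono, rule integral_le[OF g2i])
        show "(\<lambda>s. rate_const_sq \<kappa> * (2 + ?\<Lambda>) * (1 + ?V) * forcing s) integrable_on {t1..t2}"
          using hi by (rule integrable_on_mult_right)
        fix s
        have "?G \<le> ?\<Lambda> * (1 + ?V) * forcing s"
        proof -
          have "?G \<le> ?\<Lambda> * ?V * 1" using vgrad2_le by simp
          also have "\<dots> \<le> ?\<Lambda> * (1 + ?V) * forcing s"
            using forcing_nonneg by (intro mult_mono mult_nonneg_nonneg sum_nonneg) auto
          finally show ?thesis .
        qed
        then have "rate_const_sq \<kappa> * (2 * (1 + ?V) * forcing s + ?G) \<le> rate_const_sq \<kappa> * (2 * (1 + ?V) * forcing s + ?\<Lambda> * (1 + ?V) * forcing s)"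
          using rate_const_sq_nonneg by (intro mult_left_mono) auto
        with galerkin_rate_sq_le[of n \<kappa> v s] show "(galerkin_rate n \<kappa> v s)\<^sup>2 \<le> rate_const_sq \<kappa> * (2 + ?\<Lambda>) * (1 + ?V) * forcing s"
          by (simp add: algebra_simps)
      qed (use ab in simp)
      finally show ?thesis by (simp add: mult_ac)
    qed
    then have "(\<Sum>\<kappa>\<in>freqs n. (?I (galerkin_rate n \<kappa> v))\<^sup>2) \<le> (\<Sum>\<kappa>\<in>freqs n. (t2 - t1) * (rate_const_sq \<kappa> * (2 + ?\<Lambda>) * ((1 + ?V) * ?H)))"
      by (rule sum_mono)
    also have "\<dots> = ((t2 - t1) * cfl n) * ((1 + ?V) * ?H)"
      by (simp add: cfl_def sum_distrib_left sum_distrib_right mult_ac)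
    also have "\<dots> \<le> 1 * ((1 + ?V) * ?H)"
      using H0 cfl by (intro mult_right_mono) auto
    finally show ?thesis by simp
  qed
  ultimately show ?thesis by (simp add: C_growth_def algebra_simps)
qed

text \<open>Enough steps for the stability restriction, and at least n + 1 so that the mesh size tends to zero.\<close>

definition steps :: "nat \<Rightarrow> nat" where "steps n = nat \<lceil>T * cfl n\<rceil> + n + 1"

definition tau :: "nat \<Rightarrow> real" where "tau n = T / steps n"

lemma tau_props: "tau n > 0" "steps n * tau n = T" "tau n * cfl n \<le> 1" "tau n \<le> T / (real n + 1)"
proof -
  have s: "steps n > 0" "real (steps n) \<ge> T * cfl n" "real (steps n) \<ge> n + 1" by (auto simp: steps_def) linarith
  show "tau n > 0" "steps n * tau n = T" using s(1) T by (auto simp: tau_def)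
  show "tau n * cfl n \<le> 1" using s(1,2) by (simp add: tau_def field_simps)
  show "tau n \<le> T / (real n + 1)" unfolding tau_def using s(1,3) T by (intro divide_left_mono) auto
qed

primrec euler :: "nat \<Rightarrow> nat \<Rightarrow> int^'d \<Rightarrow> real" where
  "euler n 0 = fourier_coeff u0"
| "euler n (Suc j) = (\<lambda>\<kappa>. euler n j \<kappa> + integral {real j * tau n..(real j + 1) * tau n} (galerkin_rate n \<kappa> (euler n j)))"

definition C_apriori :: real where
  "C_apriori = (1 + (lnorm torus u0)\<^sup>2) * exp (C_growth * integral {0..T} forcing)"

lemma mesh_le:
  assumes "j \<le> steps n" shows "real j * tau n \<le> T"
proof -
  have "real j * tau n \<le> real (steps n) * tau n" using assms tau_props(1)[of n] by (intro mult_right_mono) auto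
  then show ?thesis using tau_props(2) by simp
qed

text \<open>The one-step estimates multiply up to an exponential, which is a discrete Gronwall argument.\<close>

lemma euler_energy:
  assumes "j \<le> steps n"
  shows "1 + vnorm2 n (euler n j) + \<delta> * tau n * (\<Sum>i<j. vgrad2 n (euler n i))
    \<le> (1 + (lnorm torus u0)\<^sup>2) * exp (C_growth * integral {0..real j * tau n} forcing)"
  using assms
proof (induction j)
  case 0
  show ?case using Bessel[OF finite_freqs u0, of n] by (simp add: vnorm2_def)
next
  case (Suc j)
  let ?t1 = "real j * tau n" and ?t2 = "(real j + 1) * tau n"
  let ?E = "(1 + (lnorm torus u0)\<^sup>2)" and ?G = "\<delta> * tau n * (\<Sum>i<j. vgrad2 n (euler n i))"
  let ?e = "C_growth * integral {?t1..?t2} forcing"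
  have t: "0 \<le> ?t1" "?t1 \<le> ?t2" "?t2 \<le> T" "?t2 - ?t1 = tau n"
    using tau_props(1)[of n] mesh_le[OF Suc.prems] by (auto simp: algebra_simps)
  have hi: "forcing integrable_on {a..b}" if "0 \<le> a" "b \<le> T" for a b
    by (rule lebesgue_on_interval_integral(2)[OF forcing_integrable that])
  have e0: "?e \<ge> 0" using C_energy_nonneg forcing_nonneg t hi[of ?t1 ?t2]
    by (auto simp: C_growth_def intro!: mult_nonneg_nonneg integral_nonneg)
  have G0: "?G \<ge> 0" using \<delta> tau_props(1)[of n] by (auto intro!: mult_nonneg_nonneg sum_nonneg)
  have "1 + vnorm2 n (euler n (Suc j)) + \<delta> * (?t2 - ?t1) * vgrad2 n (euler n j) \<le> (1 + vnorm2 n (euler n j)) * (1 + ?e)"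
    unfolding euler.simps by (rule euler_step) (use t tau_props(3) in auto)
  then have "1 + vnorm2 n (euler n (Suc j)) + \<delta> * tau n * (\<Sum>i<Suc j. vgrad2 n (euler n i)) \<le> (1 + vnorm2 n (euler n j)) * (1 + ?e) + ?G"
    unfolding t(4) by (simp add: algebra_simps)
  also have "\<dots> \<le> (1 + vnorm2 n (euler n j) + ?G) * (1 + ?e)"
    using mult_nonneg_nonneg[OF G0 e0] by (simp add: algebra_simps)
  also have "\<dots> \<le> (?E * exp (C_growth * integral {0..?t1} forcing)) * exp ?e"
  proof (intro mult_mono)
    show "1 + vnorm2 n (euler n j) + ?G \<le> ?E * exp (C_growth * integral {0..?t1} forcing)"
      using Suc by simp
  qed (use e0 G0 in \<open>auto intro!: add_nonneg_nonneg\<close>)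
  also have "\<dots> = ?E * exp (C_growth * integral {0..?t2} forcing)"
    using Henstock_Kurzweil_Integration.integral_combine[of 0 ?t1 ?t2 forcing] t hi[of 0 ?t2]
    by (simp add: exp_add[symmetric] distrib_left[symmetric])
  finally show ?case by (simp add: add.commute)
qed

lemma C_apriori_bounds:
  assumes "j \<le> steps n"
  shows "vnorm2 n (euler n j) \<le> C_apriori" "tau n * (\<Sum>i<j. vgrad2 n (euler n i)) \<le> C_apriori / \<delta>"
proof -
  have hi: "forcing integrable_on {a..b}" if "0 \<le> a" "b \<le> T" for a b
    by (rule lebesgue_on_interval_integral(2)[OF forcing_integrable that])
  have "integral {0..real j * tau n} forcing \<le> integral {0..T} forcing"
    using mesh_le[OF assms] forcing_nonneg tau_props(1)[of n] by (intro integral_subset_le hi) auto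
  then have "C_growth * integral {0..real j * tau n} forcing \<le> C_growth * integral {0..T} forcing"
    using C_energy_nonneg by (intro mult_left_mono) (auto simp: C_growth_def)
  then have "(1 + (lnorm torus u0)\<^sup>2) * exp (C_growth * integral {0..real j * tau n} forcing) \<le> C_apriori"
    unfolding C_apriori_def by (intro mult_left_mono) auto
  then have 1: "1 + vnorm2 n (euler n j) + \<delta> * tau n * (\<Sum>i<j. vgrad2 n (euler n i)) \<le> C_apriori"
    using euler_energy[OF assms] by linarith
  have G0: "\<delta> * tau n * (\<Sum>i<j. vgrad2 n (euler n i)) \<ge> 0" using \<delta> tau_props(1)[of n] by (auto intro!: mult_nonneg_nonneg sum_nonneg)
  show "vnorm2 n (euler n j) \<le> C_apriori" using 1 G0 by linarith
  have "\<delta> * (tau n * (\<Sum>i<j. vgrad2 n (euler n i))) \<le> C_apriori"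
    using 1 vnorm2_nonneg(1)[of n "euler n j"] unfolding mult.assoc by linarith
  then show "tau n * (\<Sum>i<j. vgrad2 n (euler n i)) \<le> C_apriori / \<delta>" using \<delta> by (simp add: field_simps)
qed

definition frozen :: "nat \<Rightarrow> real \<Rightarrow> int^'d \<Rightarrow> real" where
  "frozen n s = euler n (cell (tau n) s)"

lemma cell_le_steps: assumes "s \<in> {0..T}" shows "cell (tau n) s \<le> steps n"
proof -
  have "real (cell (tau n) s) * tau n \<le> real (steps n) * tau n"
    using cell_bounds(1)[OF tau_props(1)[of n], of s] assms tau_props(2)[of n] by simp
  then show ?thesis using tau_props(1)[of n] by simp
qed

lemma frozen_bound: "s \<in> {0..T} \<Longrightarrow> vnorm2 n (frozen n s) \<le> C_apriori"
  unfolding frozen_def by (rule C_apriori_bounds(1)[OF cell_le_steps])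

lemma frozen_measurable:
  assumes "\<And>v. (\<lambda>s. F v s) \<in> borel_measurable time"
  shows "(\<lambda>s. F (frozen n s) s) \<in> borel_measurable time"
  unfolding frozen_def
  by (rule measurable_compose_countable[where f="\<lambda>j s. F (euler n j) s" and g="cell (tau n)"]) (use assms in auto)

lemma vgrad2_frozen:
  "integrable time (\<lambda>s. vgrad2 n (frozen n s))" "integral {0..T} (\<lambda>s. vgrad2 n (frozen n s)) \<le> C_apriori / \<delta>"
proof -
  have "((\<lambda>s. vgrad2 n (euler n (cell (tau n) s))) has_integral
    (\<Sum>i<steps n. integral {real i * tau n..(real i + 1) * tau n} (\<lambda>s. vgrad2 n (euler n i)))) {0..real (steps n) * tau n}"
    by (rule has_integral_cells[OF tau_props(1), of "steps n" "\<lambda>i s. vgrad2 n (euler n i)" n]) (rule integrable_const_ivl)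
  moreover have "integral {real i * tau n..(real i + 1) * tau n} (\<lambda>s. vgrad2 n (euler n i)) = tau n * vgrad2 n (euler n i)" for i
    using tau_props(1)[of n] by (simp add: algebra_simps)
  ultimately have hi: "((\<lambda>s. vgrad2 n (frozen n s)) has_integral tau n * (\<Sum>i<steps n. vgrad2 n (euler n i))) {0..T}"
    unfolding frozen_def tau_props(2) by (simp only: sum_distrib_left)
  then show "integral {0..T} (\<lambda>s. vgrad2 n (frozen n s)) \<le> C_apriori / \<delta>"
    using C_apriori_bounds(2)[OF order_refl, of n] by (simp add: integral_unique)
  have "(\<lambda>s. vgrad2 n (frozen n s)) absolutely_integrable_on {0..T}"
    by (rule nonnegative_absolutely_integrable_1) (use hi in \<open>auto simp: integrable_on_def\<close>)
  then show "integrable time (\<lambda>s. vgrad2 n (frozen n s))"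
    by (simp add: set_integrable_def integrable_restrict_space)
qed

definition C_rate :: "int^'d \<Rightarrow> real" where
  "C_rate \<kappa> = rate_const_sq \<kappa> * (2 * (1 + C_apriori) * integral {0..T} forcing + C_apriori / \<delta>)"

lemma frozen_rate:
  "sq_integrable time (\<lambda>s. galerkin_rate n \<kappa> (frozen n s) s)"
  "integral {0..T} (\<lambda>s. (galerkin_rate n \<kappa> (frozen n s) s)\<^sup>2) \<le> C_rate \<kappa>"
proof -
  define D where "D s = rate_const_sq \<kappa> * (2 * (1 + C_apriori) * forcing s + vgrad2 n (frozen n s))" for s
  have Di: "integrable time D"
    unfolding D_def using forcing_integrable vgrad2_frozen(1)[of n] by simp
  have le: "(galerkin_rate n \<kappa> (frozen n s) s)\<^sup>2 \<le> D s" if "s \<in> {0..T}" for s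
  proof -
    have "2 * (1 + vnorm2 n (frozen n s)) * forcing s \<le> 2 * (1 + C_apriori) * forcing s"
      using frozen_bound[OF that] forcing_nonneg by (intro mult_right_mono mult_left_mono) auto
    then have "rate_const_sq \<kappa> * (2 * (1 + vnorm2 n (frozen n s)) * forcing s + vgrad2 n (frozen n s)) \<le> D s"
      unfolding D_def using rate_const_sq_nonneg by (intro mult_left_mono) auto
    then show ?thesis using galerkin_rate_sq_le[of n \<kappa> "frozen n s" s] by linarith
  qed
  have m: "(\<lambda>s. galerkin_rate n \<kappa> (frozen n s) s) \<in> borel_measurable time"
    by (rule frozen_measurable) (rule galerkin_rate_measurable)
  have i2: "integrable time (\<lambda>s. (galerkin_rate n \<kappa> (frozen n s) s)\<^sup>2)"
  proof (rule Bochner_Integration.integrable_bound[OF Di])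
    show "AE s in time. norm ((galerkin_rate n \<kappa> (frozen n s) s)\<^sup>2) \<le> norm (D s)"
    proof (rule AE_I2)
      fix s assume "s \<in> space time"
      then have "(galerkin_rate n \<kappa> (frozen n s) s)\<^sup>2 \<le> D s" using le by simp
      then show "norm ((galerkin_rate n \<kappa> (frozen n s) s)\<^sup>2) \<le> norm (D s)" by simp
    qed
  qed (use m in measurable)
  then show "sq_integrable time (\<lambda>s. galerkin_rate n \<kappa> (frozen n s) s)" using m by (simp add: sq_integrable_def)
  note hi = lebesgue_on_interval_integral(2)[OF forcing_integrable order_refl order_refl]
  note vi = lebesgue_on_interval_integral(2)[OF vgrad2_frozen(1) order_refl order_refl]
  have "integral {0..T} (\<lambda>s. (galerkin_rate n \<kappa> (frozen n s) s)\<^sup>2) \<le> integral {0..T} D"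
    using lebesgue_on_interval_integral(2)[OF i2 order_refl order_refl] lebesgue_on_interval_integral(2)[OF Di order_refl order_refl] le
    by (rule integral_le)
  also have "\<dots> = rate_const_sq \<kappa> * (2 * (1 + C_apriori) * integral {0..T} forcing + integral {0..T} (\<lambda>s. vgrad2 n (frozen n s)))"
    unfolding D_def using hi vi
    by (simp add: Henstock_Kurzweil_Integration.integral_add integrable_on_mult_right)
  also have "\<dots> \<le> C_rate \<kappa>"
    unfolding C_rate_def using rate_const_sq_nonneg vgrad2_frozen(2) by (intro mult_left_mono) auto
  finally show "integral {0..T} (\<lambda>s. (galerkin_rate n \<kappa> (frozen n s) s)\<^sup>2) \<le> C_rate \<kappa>" .
qed

text \<open>The continuous interpolant, whose increments are integrals of the rate at the frozen state. It is
  defined for every mode, so that each mode yields a full sequence in n.\<close>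

definition galerkin :: "nat \<Rightarrow> int^'d \<Rightarrow> real \<Rightarrow> real" where
  "galerkin n \<kappa> t = fourier_coeff u0 \<kappa> + integral {0..t} (\<lambda>s. galerkin_rate n \<kappa> (frozen n s) s)"

lemma frozen_rate_integrable: "integrable time (\<lambda>s. galerkin_rate n \<kappa> (frozen n s) s)"
  by (rule sq_integrable_imp_integrable[OF finite_measure_time frozen_rate(1)])

lemma galerkin_mesh:
  assumes "j \<le> steps n" shows "galerkin n \<kappa> (real j * tau n) = euler n j \<kappa>"
proof -
  have "((\<lambda>s. galerkin_rate n \<kappa> (frozen n s) s) has_integral
    (\<Sum>i<j. integral {real i * tau n..(real i + 1) * tau n} (galerkin_rate n \<kappa> (euler n i)))) {0..real j * tau n}"
    unfolding frozen_def
  proof (rule has_integral_cells[OF tau_props(1), of j "\<lambda>i. galerkin_rate n \<kappa> (euler n i)"])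
    fix i assume "i < j"
    then have "real (Suc i) * tau n \<le> T" using assms by (intro mesh_le) auto
    then show "galerkin_rate n \<kappa> (euler n i) integrable_on {real i * tau n..(real i + 1) * tau n}"
      using tau_props(1)[of n] by (intro lebesgue_on_interval_integral(2)[OF galerkin_rate_integrable]) (auto simp: add.commute)
  qed
  then have "galerkin n \<kappa> (real j * tau n) = fourier_coeff u0 \<kappa> + (\<Sum>i<j. integral {real i * tau n..(real i + 1) * tau n} (galerkin_rate n \<kappa> (euler n i)))"
    by (simp add: galerkin_def integral_unique)
  also have "\<dots> = euler n j \<kappa>" by (induction j) auto
  finally show ?thesis .
qed

text \<open>The constant does not depend on n: in the rate of a single mode the derivative falls on the Hartley
  function, so its square is bounded by the energy and the forcing.\<close>

lemma galerkin_hoelder: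
  assumes "0 \<le> s" "s \<le> t" "t \<le> T"
  shows "(galerkin n \<kappa> t - galerkin n \<kappa> s)\<^sup>2 \<le> C_rate \<kappa> * (t - s)"
proof -
  let ?f = "\<lambda>s. galerkin_rate n \<kappa> (frozen n s) s"
  have "galerkin n \<kappa> t - galerkin n \<kappa> s = integral {s..t} ?f"
    unfolding galerkin_def
    using Henstock_Kurzweil_Integration.integral_combine[of 0 s t ?f] assms
      lebesgue_on_interval_integral(2)[OF frozen_rate_integrable order_refl assms(3), of n \<kappa>] by simp
  then have "(galerkin n \<kappa> t - galerkin n \<kappa> s)\<^sup>2 \<le> (t - s) * integral {s..t} (\<lambda>s. (?f s)\<^sup>2)"
    using integral_square_le[OF frozen_rate(1) assms, of n \<kappa>] by simp
  also have "\<dots> \<le> (t - s) * integral {0..T} (\<lambda>s. (?f s)\<^sup>2)"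
    using assms lebesgue_on_interval_integral(2)[OF sq_integrableD(2)[OF frozen_rate(1)], of _ _ n \<kappa>]
    by (intro mult_left_mono integral_subset_le) auto
  also have "\<dots> \<le> (t - s) * C_rate \<kappa>" using assms by (intro mult_left_mono frozen_rate(2)) auto
  finally show ?thesis by (simp add: mult.commute)
qed

lemma frozen_close:
  assumes s: "s \<in> {0..T}" shows "(galerkin n \<kappa> s - frozen n s \<kappa>)\<^sup>2 \<le> C_rate \<kappa> * tau n"
proof -
  let ?j = "cell (tau n) s"
  note cb = cell_bounds[OF tau_props(1)[of n], of s]
  have "frozen n s \<kappa> = galerkin n \<kappa> (real ?j * tau n)"
    unfolding frozen_def by (rule galerkin_mesh[OF cell_le_steps[OF s], symmetric])
  then have "(galerkin n \<kappa> s - frozen n s \<kappa>)\<^sup>2 \<le> C_rate \<kappa> * (s - real ?j * tau n)"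
    using galerkin_hoelder[of "real ?j * tau n" s n \<kappa>] cb s tau_props(1)[of n] by simp
  also have "\<dots> \<le> C_rate \<kappa> * tau n"
  proof (rule mult_left_mono)
    show "s - real ?j * tau n \<le> tau n" using cb s by (simp add: algebra_simps)
    show "0 \<le> C_rate \<kappa>"
      using order_trans[OF integral_nonneg frozen_rate(2)[of n \<kappa>]]
        lebesgue_on_interval_integral(2)[OF sq_integrableD(2)[OF frozen_rate(1)] order_refl order_refl, of n \<kappa>] by simp
  qed
  finally show ?thesis .
qed

end

section \<open>Families that depend on time\<close>

abbreviation ip :: "(real^'d \<Rightarrow> real) \<Rightarrow> (real^'d \<Rightarrow> real) \<Rightarrow> real" where
  "ip f g \<equiv> (LINT x|torus. f x * g x)"

text \<open>Weak measurability of a family of functions on the torus, tested on the basis only.\<close>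

definition fourier_measurable :: "'a measure \<Rightarrow> ('a \<Rightarrow> real^'d \<Rightarrow> real) \<Rightarrow> bool" where
  "fourier_measurable M X \<longleftrightarrow>
     (\<forall>t\<in>space M. sq_integrable torus (X t)) \<and> (\<forall>\<kappa>. (\<lambda>t. fourier_coeff (X t) \<kappa>) \<in> borel_measurable M)"

lemma fourier_measurableD:
  assumes "fourier_measurable M X"
  shows "t \<in> space M \<Longrightarrow> sq_integrable torus (X t)" "(\<lambda>t. fourier_coeff (X t) \<kappa>) \<in> borel_measurable M"
  using assms by (auto simp: fourier_measurable_def)

lemma fourier_measurable_ip:
  assumes X: "fourier_measurable M X" and Y: "fourier_measurable M Y"
  shows "(\<lambda>t. ip (X t) (Y t)) \<in> borel_measurable M"
proof (rule borel_measurable_LIMSEQ_real)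
  show "(\<lambda>m. \<Sum>\<kappa>\<in>freqs m. fourier_coeff (X t) \<kappa> * fourier_coeff (Y t) \<kappa>) \<longlonglongrightarrow> ip (X t) (Y t)" if "t \<in> space M" for t
    by (rule Parseval[OF fourier_measurableD(1)[OF X that] fourier_measurableD(1)[OF Y that]])
  show "(\<lambda>t. \<Sum>\<kappa>\<in>freqs m. fourier_coeff (X t) \<kappa> * fourier_coeff (Y t) \<kappa>) \<in> borel_measurable M" for m
    by (intro borel_measurable_sum borel_measurable_times fourier_measurableD(2)[OF X] fourier_measurableD(2)[OF Y])
qed

lemma fourier_measurable_lnorm:
  assumes X: "fourier_measurable M X"
  shows "(\<lambda>t. lnorm torus (X t)) \<in> borel_measurable M"
proof -
  have "(\<lambda>t. lnorm torus (X t)) = (\<lambda>t. sqrt (ip (X t) (X t)))" by (simp add: lnorm_def power2_eq_square)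
  then show ?thesis using measurable_compose[OF fourier_measurable_ip[OF X X] borel_measurable_sqrt] by (simp only:)
qed

lemma fourier_measurable_diff:
  assumes X: "fourier_measurable M X" and Y: "fourier_measurable M Y"
  shows "fourier_measurable M (\<lambda>t x. X t x - Y t x)"
  unfolding fourier_measurable_def
proof (intro conjI ballI allI)
  show "sq_integrable torus (\<lambda>x. X t x - Y t x)" if "t \<in> space M" for t
    using that by (intro sq_integrable_diff fourier_measurableD(1)[OF X] fourier_measurableD(1)[OF Y])
  show "(\<lambda>t. fourier_coeff (\<lambda>x. X t x - Y t x) \<kappa>) \<in> borel_measurable M" for \<kappa>
    using borel_measurable_diff[OF fourier_measurableD(2)[OF X] fourier_measurableD(2)[OF Y], of \<kappa> \<kappa>]
    by (subst measurable_cong[where g="\<lambda>t. fourier_coeff (X t) \<kappa> - fourier_coeff (Y t) \<kappa>"])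
       (auto simp: fourier_coeff_diff fourier_measurableD(1)[OF X] fourier_measurableD(1)[OF Y])
qed

lemma fourier_measurable_fourier_sum:
  assumes "finite F" "\<And>\<kappa>. \<kappa> \<in> F \<Longrightarrow> (\<lambda>t. c t \<kappa>) \<in> borel_measurable M"
  shows "fourier_measurable M (\<lambda>t. fourier_sum F (c t))"
  unfolding fourier_measurable_def
proof (intro conjI ballI allI)
  show "(\<lambda>t. fourier_coeff (fourier_sum F (c t)) \<kappa>) \<in> borel_measurable M" for \<kappa>
    using assms by (cases "\<kappa> \<in> F") (simp_all add: fourier_coeff_fourier_sum)
qed simp

lemma fourier_measurable_const: "sq_integrable torus f \<Longrightarrow> fourier_measurable M (\<lambda>t. f)"
  by (simp add: fourier_measurable_def)

text \<open>A functional that is continuous for the L2 norm only sees the limit of the truncated Fourier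
  series, and on truncated series it is a continuous function of countably many real
  coordinates.\<close>

lemma fourier_measurable_functional:
  fixes F :: "'p::{metric_space, second_countable_topology} \<Rightarrow> (real^'d \<Rightarrow> real) \<Rightarrow> real"
  assumes X: "fourier_measurable M X" and q: "q \<in> borel_measurable M"
    and F: "\<And>p w pn wn. pn \<longlonglongrightarrow> p \<Longrightarrow> sq_integrable torus w \<Longrightarrow> (\<And>n. sq_integrable torus (wn n)) \<Longrightarrow>
      (\<lambda>n. lnorm torus (\<lambda>x. wn n x - w x)) \<longlonglongrightarrow> 0 \<Longrightarrow> (\<lambda>n. F (pn n) (wn n)) \<longlonglongrightarrow> F p w"
  shows "(\<lambda>t. F (q t) (X t)) \<in> borel_measurable M"
proof (rule borel_measurable_LIMSEQ_real)
  show "(\<lambda>m. F (q t) (fourier_sum (freqs m) (fourier_coeff (X t)))) \<longlonglongrightarrow> F (q t) (X t)" if t: "t \<in> space M" for t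
  proof (rule F[OF tendsto_const fourier_measurableD(1)[OF X t] sq_integrable_fourier_sum])
    show "(\<lambda>m. lnorm torus (\<lambda>x. fourier_sum (freqs m) (fourier_coeff (X t)) x - X t x)) \<longlonglongrightarrow> 0"
      using fourier_sum_tendsto[OF fourier_measurableD(1)[OF X t]]
      by (subst lnorm_diff_commute)
  qed
  fix m
  define \<Psi> where "\<Psi> = (\<lambda>z::'p \<times> (int^'d \<Rightarrow> real). F (fst z) (fourier_sum (freqs m) (snd z)))"
  have "continuous_on UNIV \<Psi>"
    unfolding continuous_on_sequentially
  proof (intro allI ballI impI)
    fix zn :: "nat \<Rightarrow> 'p \<times> (int^'d \<Rightarrow> real)" and z assume "(\<forall>n. zn n \<in> UNIV) \<and> zn \<longlonglongrightarrow> z"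
    then have z: "zn \<longlonglongrightarrow> z" by blast
    have coord: "(\<lambda>n. snd (zn n) \<kappa>) \<longlonglongrightarrow> snd z \<kappa>" for \<kappa>
      using continuous_on_tendsto_compose[OF continuous_on_product_coordinates[of \<kappa>] tendsto_snd[OF z]] by simp
    have n2: "(lnorm torus (\<lambda>x. fourier_sum (freqs m) (snd (zn n)) x - fourier_sum (freqs m) (snd z) x))\<^sup>2 = (\<Sum>\<kappa>\<in>freqs m. (snd (zn n) \<kappa> - snd z \<kappa>)\<^sup>2)" for n
    proof -
      have "(\<lambda>x. fourier_sum (freqs m) (snd (zn n)) x - fourier_sum (freqs m) (snd z) x) = fourier_sum (freqs m) (\<lambda>\<kappa>. snd (zn n) \<kappa> - snd z \<kappa>)"
        by (simp add: fourier_sum_def fun_eq_iff sum_subtractf left_diff_distrib)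
      then show ?thesis by (simp add: lnorm_fourier_sum)
    qed
    have "(\<lambda>n. \<Sum>\<kappa>\<in>freqs m. (snd (zn n) \<kappa> - snd z \<kappa>)\<^sup>2) \<longlonglongrightarrow> (\<Sum>\<kappa>\<in>freqs m. (snd z \<kappa> - snd z \<kappa>)\<^sup>2)"
      by (intro tendsto_intros coord)
    then have "(\<lambda>n. sqrt ((lnorm torus (\<lambda>x. fourier_sum (freqs m) (snd (zn n)) x - fourier_sum (freqs m) (snd z) x))\<^sup>2)) \<longlonglongrightarrow> sqrt 0"
      unfolding n2 by (intro tendsto_real_sqrt) simp
    then have "(\<lambda>n. lnorm torus (\<lambda>x. fourier_sum (freqs m) (snd (zn n)) x - fourier_sum (freqs m) (snd z) x)) \<longlonglongrightarrow> 0" by simp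
    then show "(\<Psi> \<circ> zn) \<longlonglongrightarrow> \<Psi> z"
      unfolding \<Psi>_def comp_def by (intro F tendsto_fst z) auto
  qed
  then have "\<Psi> \<in> borel_measurable borel" by (rule borel_measurable_continuous_onI)
  moreover have "(\<lambda>t. (q t, fourier_coeff (X t))) \<in> borel_measurable M"
    by (intro borel_measurable_Pair q measurable_coordinatewise_then_product fourier_measurableD(2)[OF X])
  ultimately have "(\<lambda>t. \<Psi> (q t, fourier_coeff (X t))) \<in> borel_measurable M" using measurable_compose by blast
  then show "(\<lambda>t. F (q t) (fourier_sum (freqs m) (fourier_coeff (X t)))) \<in> borel_measurable M" by (simp add: \<Psi>_def)
qed

lemma lnorm_truncation_le:
  assumes "sq_integrable torus f" shows "lnorm torus (\<lambda>x. f x - fourier_sum (freqs m) (fourier_coeff f) x) \<le> lnorm torus f"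
proof (rule power2_le_imp_le)
  show "(lnorm torus (\<lambda>x. f x - fourier_sum (freqs m) (fourier_coeff f) x))\<^sup>2 \<le> (lnorm torus f)\<^sup>2"
    unfolding lnorm_diff_fourier_sum[OF finite_freqs assms] by (simp add: sum_nonneg)
qed simp

text \<open>The product of a weakly and a strongly convergent family converges. Weak convergence is only
  known mode by mode, so the strong factor is split into finitely many modes and a tail that is
  small in the norm of the product space.\<close>

theorem weak_strong_convergence:
  fixes X :: "'a \<Rightarrow> real^'d \<Rightarrow> real"
  assumes fin: "finite_measure M"
    and mXn: "\<And>n. fourier_measurable M (Xn n)" and mX: "fourier_measurable M X"
    and mYn: "\<And>n. fourier_measurable M (Yn n)" and mY: "fourier_measurable M Y"
    and Xn: "\<And>n. sq_integrable M (\<lambda>t. lnorm torus (Xn n t))" "\<And>n. lnorm M (\<lambda>t. lnorm torus (Xn n t)) \<le> C"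
    and X: "sq_integrable M (\<lambda>t. lnorm torus (X t))" "lnorm M (\<lambda>t. lnorm torus (X t)) \<le> C"
    and coef: "\<And>\<kappa>. AE t in M. (\<lambda>n. fourier_coeff (Xn n t) \<kappa>) \<longlonglongrightarrow> fourier_coeff (X t) \<kappa>"
    and coef_bd: "\<And>\<kappa> n t. t \<in> space M \<Longrightarrow> \<bar>fourier_coeff (Xn n t) \<kappa>\<bar> \<le> \<beta> \<kappa>" "\<And>\<kappa> t. t \<in> space M \<Longrightarrow> \<bar>fourier_coeff (X t) \<kappa>\<bar> \<le> \<beta> \<kappa>"
    and Y: "\<And>t. t \<in> space M \<Longrightarrow> lnorm torus (Y t) \<le> D"
    and YnY: "\<And>n. sq_integrable M (\<lambda>t. lnorm torus (\<lambda>x. Yn n t x - Y t x))"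
      "(\<lambda>n. lnorm M (\<lambda>t. lnorm torus (\<lambda>x. Yn n t x - Y t x))) \<longlonglongrightarrow> 0"
  shows "(\<lambda>n. LINT t|M. \<bar>ip (Xn n t) (Yn n t) - ip (X t) (Y t)\<bar>) \<longlonglongrightarrow> 0"
proof -
  interpret finite_measure M by fact
  note sX = fourier_measurableD(1)[OF mX] and sXn = fourier_measurableD(1)[OF mXn]
    and sY = fourier_measurableD(1)[OF mY] and sYn = fourier_measurableD(1)[OF mYn]
  define tail where "tail m t = lnorm torus (\<lambda>x. Y t x - fourier_sum (freqs m) (fourier_coeff (Y t)) x)" for m t
  have mtail: "fourier_measurable M (\<lambda>t x. Y t x - fourier_sum (freqs m) (fourier_coeff (Y t)) x)" for m
    by (intro fourier_measurable_diff mY fourier_measurable_fourier_sum finite_freqs fourier_measurableD(2)[OF mY])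
  have tail_le: "tail m t \<le> D" if "t \<in> space M" for m t
    unfolding tail_def by (rule order_trans[OF lnorm_truncation_le[OF sY[OF that]] Y[OF that]])
  have tail_meas: "tail m \<in> borel_measurable M" for m
    unfolding tail_def[abs_def] by (rule fourier_measurable_lnorm[OF mtail])
  have tail_sq: "sq_integrable M (tail m)" for m
    by (rule sq_integrable_of_bounded[OF fin tail_meas, of _ D]) (use tail_le in \<open>auto simp: tail_def\<close>)
  have tail_lim: "(\<lambda>m. lnorm M (tail m)) \<longlonglongrightarrow> 0"
  proof -
    have "(\<lambda>m. LINT t|M. (tail m t)\<^sup>2) \<longlonglongrightarrow> (LINT t|M. 0)"
    proof (rule integral_dominated_convergence[where w="\<lambda>t. D\<^sup>2"])
      show "AE t in M. (\<lambda>m. (tail m t)\<^sup>2) \<longlonglongrightarrow> 0"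
      proof (rule AE_I2)
        fix t assume "t \<in> space M"
        from tendsto_power[OF fourier_sum_tendsto[OF sY[OF this]], of 2] show "(\<lambda>m. (tail m t)\<^sup>2) \<longlonglongrightarrow> 0"
          by (simp add: tail_def)
      qed
      show "AE t in M. norm ((tail m t)\<^sup>2) \<le> D\<^sup>2" for m
        using tail_le by (intro AE_I2) (auto simp: tail_def intro!: power_mono)
    qed (use tail_meas in measurable)
    then have "(\<lambda>m. sqrt (LINT t|M. (tail m t)\<^sup>2)) \<longlonglongrightarrow> sqrt 0" by (intro tendsto_real_sqrt) simp
    then show ?thesis by (simp add: lnorm_def)
  qed
  define low where "low n \<kappa> = (LINT t|M. \<bar>fourier_coeff (Xn n t) \<kappa> - fourier_coeff (X t) \<kappa>\<bar>)" for n \<kappa>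
  note mc = fourier_measurableD(2)[OF mX] and mcn = fourier_measurableD(2)[OF mXn]
  have low_int: "integrable M (\<lambda>t. \<bar>fourier_coeff (Xn n t) \<kappa> - fourier_coeff (X t) \<kappa>\<bar>)" for n \<kappa>
  proof (rule integrable_const_bound[where B="2 * \<beta> \<kappa>"])
    show "AE t in M. norm \<bar>fourier_coeff (Xn n t) \<kappa> - fourier_coeff (X t) \<kappa>\<bar> \<le> 2 * \<beta> \<kappa>"
    proof (rule AE_I2)
      fix t assume "t \<in> space M"
      from coef_bd(1)[OF this, of n \<kappa>] coef_bd(2)[OF this, of \<kappa>] show "norm \<bar>fourier_coeff (Xn n t) \<kappa> - fourier_coeff (X t) \<kappa>\<bar> \<le> 2 * \<beta> \<kappa>" by simp
    qed
  qed (use mc mcn in measurable)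
  have low_lim: "(\<lambda>n. low n \<kappa>) \<longlonglongrightarrow> 0" for \<kappa>
  proof -
    have "(\<lambda>n. low n \<kappa>) \<longlonglongrightarrow> (LINT t|M. 0)"
      unfolding low_def
    proof (rule integral_dominated_convergence[where w="\<lambda>t. 2 * \<beta> \<kappa>"])
      show "AE t in M. (\<lambda>n. \<bar>fourier_coeff (Xn n t) \<kappa> - fourier_coeff (X t) \<kappa>\<bar>) \<longlonglongrightarrow> 0"
        using coef[of \<kappa>] by eventually_elim (auto intro: tendsto_rabs_zero LIM_zero)
      show "AE t in M. norm \<bar>fourier_coeff (Xn n t) \<kappa> - fourier_coeff (X t) \<kappa>\<bar> \<le> 2 * \<beta> \<kappa>" for n
      proof (rule AE_I2)
        fix t assume "t \<in> space M"
        from coef_bd(1)[OF this, of n \<kappa>] coef_bd(2)[OF this, of \<kappa>] show "norm \<bar>fourier_coeff (Xn n t) \<kappa> - fourier_coeff (X t) \<kappa>\<bar> \<le> 2 * \<beta> \<kappa>" by simp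
      qed
    qed (use mc mcn in measurable)
    then show ?thesis by simp
  qed
  let ?XX = "\<lambda>n t. lnorm torus (Xn n t) + lnorm torus (X t)"
  let ?dY = "\<lambda>n t. lnorm torus (\<lambda>x. Yn n t x - Y t x)"
  have bound: "(LINT t|M. \<bar>ip (Xn n t) (Yn n t) - ip (X t) (Y t)\<bar>)
      \<le> C * lnorm M (?dY n) + D * (\<Sum>\<kappa>\<in>freqs m. low n \<kappa>) + 2 * C * lnorm M (tail m)" for n m
  proof -
    have pw: "\<bar>ip (Xn n t) (Yn n t) - ip (X t) (Y t)\<bar> \<le> lnorm torus (Xn n t) * ?dY n t
        + (D * (\<Sum>\<kappa>\<in>freqs m. \<bar>fourier_coeff (Xn n t) \<kappa> - fourier_coeff (X t) \<kappa>\<bar>) + ?XX n t * tail m t)" if t: "t \<in> space M" for t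
    proof -
      note s = sX[OF t] sXn[OF t, of n] sY[OF t] sYn[OF t, of n]
      note sd = sq_integrable_diff[OF s(2) s(1)] sq_integrable_diff[OF s(4) s(3)]
        sq_integrable_diff[OF s(3) sq_integrable_fourier_sum[of "freqs m" "fourier_coeff (Y t)"]]
      have e1: "ip (Xn n t) (Yn n t) - ip (X t) (Y t) = ip (Xn n t) (\<lambda>x. Yn n t x - Y t x) + ip (\<lambda>x. Xn n t x - X t x) (Y t)"
        using sq_integrable_mult[OF s(2,4)] sq_integrable_mult[OF s(2,3)] sq_integrable_mult[OF s(1,3)]
        by (simp add: left_diff_distrib right_diff_distrib)
      have e2: "ip (\<lambda>x. Xn n t x - X t x) (Y t) = ip (\<lambda>x. Xn n t x - X t x) (fourier_sum (freqs m) (fourier_coeff (Y t))) + ip (\<lambda>x. Xn n t x - X t x) (\<lambda>x. Y t x - fourier_sum (freqs m) (fourier_coeff (Y t)) x)"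
        using sq_integrable_mult[OF sd(1) s(3)] sq_integrable_mult[OF sd(1) sq_integrable_fourier_sum[of "freqs m" "fourier_coeff (Y t)"]]
        by (simp add: right_diff_distrib)
      have b1: "\<bar>ip (Xn n t) (\<lambda>x. Yn n t x - Y t x)\<bar> \<le> lnorm torus (Xn n t) * ?dY n t"
        by (rule Cauchy_Schwarz_lnorm[OF s(2) sd(2)])
      have b2: "\<bar>ip (\<lambda>x. Xn n t x - X t x) (fourier_sum (freqs m) (fourier_coeff (Y t)))\<bar> \<le> D * (\<Sum>\<kappa>\<in>freqs m. \<bar>fourier_coeff (Xn n t) \<kappa> - fourier_coeff (X t) \<kappa>\<bar>)"
      proof -
        have "\<bar>ip (\<lambda>x. Xn n t x - X t x) (fourier_sum (freqs m) (fourier_coeff (Y t)))\<bar> \<le> (\<Sum>\<kappa>\<in>freqs m. \<bar>fourier_coeff (Y t) \<kappa> * (fourier_coeff (Xn n t) \<kappa> - fourier_coeff (X t) \<kappa>)\<bar>)"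
          unfolding integral_mult_fourier_sum[OF sd(1)] fourier_coeff_diff[OF s(2) s(1)] by (rule sum_abs)
        also have "\<dots> \<le> (\<Sum>\<kappa>\<in>freqs m. D * \<bar>fourier_coeff (Xn n t) \<kappa> - fourier_coeff (X t) \<kappa>\<bar>)"
          unfolding abs_mult by (intro sum_mono mult_right_mono order_trans[OF abs_fourier_coeff_le[OF s(3)] Y[OF t]]) auto
        finally show ?thesis by (simp add: sum_distrib_left)
      qed
      have b3: "\<bar>ip (\<lambda>x. Xn n t x - X t x) (\<lambda>x. Y t x - fourier_sum (freqs m) (fourier_coeff (Y t)) x)\<bar> \<le> ?XX n t * tail m t"
        unfolding tail_def
        by (rule order_trans[OF Cauchy_Schwarz_lnorm[OF sd(1) sd(3)]]) (intro mult_right_mono lnorm_diff_le s, simp)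
      show ?thesis using e1 e2 b1 b2 b3 by linarith
    qed
    have i1: "integrable M (\<lambda>t. lnorm torus (Xn n t) * ?dY n t)" by (rule sq_integrable_mult[OF Xn(1) YnY(1)])
    have i2: "integrable M (\<lambda>t. D * (\<Sum>\<kappa>\<in>freqs m. \<bar>fourier_coeff (Xn n t) \<kappa> - fourier_coeff (X t) \<kappa>\<bar>))"
      using low_int by (intro integrable_mult_right Bochner_Integration.integrable_sum)
    have i3: "integrable M (\<lambda>t. ?XX n t * tail m t)" by (intro sq_integrable_mult sq_integrable_add Xn X tail_sq)
    have "(LINT t|M. \<bar>ip (Xn n t) (Yn n t) - ip (X t) (Y t)\<bar>) \<le> (LINT t|M. lnorm torus (Xn n t) * ?dY n t
        + (D * (\<Sum>\<kappa>\<in>freqs m. \<bar>fourier_coeff (Xn n t) \<kappa> - fourier_coeff (X t) \<kappa>\<bar>) + ?XX n t * tail m t))"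
    proof (rule integral_mono_AE')
      show "integrable M (\<lambda>t. lnorm torus (Xn n t) * ?dY n t + (D * (\<Sum>\<kappa>\<in>freqs m. \<bar>fourier_coeff (Xn n t) \<kappa> - fourier_coeff (X t) \<kappa>\<bar>) + ?XX n t * tail m t))"
        by (intro Bochner_Integration.integrable_add i1 i2 i3)
      show "AE t in M. \<bar>ip (Xn n t) (Yn n t) - ip (X t) (Y t)\<bar> \<le> lnorm torus (Xn n t) * ?dY n t
        + (D * (\<Sum>\<kappa>\<in>freqs m. \<bar>fourier_coeff (Xn n t) \<kappa> - fourier_coeff (X t) \<kappa>\<bar>) + ?XX n t * tail m t)"
        by (intro AE_I2 pw)
      show "AE t in M. 0 \<le> lnorm torus (Xn n t) * ?dY n t
        + (D * (\<Sum>\<kappa>\<in>freqs m. \<bar>fourier_coeff (Xn n t) \<kappa> - fourier_coeff (X t) \<kappa>\<bar>) + ?XX n t * tail m t)"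
        by (intro AE_I2 order_trans[OF abs_ge_zero pw])
    qed
    also have "\<dots> = (LINT t|M. lnorm torus (Xn n t) * ?dY n t) + (D * (\<Sum>\<kappa>\<in>freqs m. low n \<kappa>) + (LINT t|M. ?XX n t * tail m t))"
    proof -
      have "(LINT t|M. D * (\<Sum>\<kappa>\<in>freqs m. \<bar>fourier_coeff (Xn n t) \<kappa> - fourier_coeff (X t) \<kappa>\<bar>)) = D * (\<Sum>\<kappa>\<in>freqs m. low n \<kappa>)"
        unfolding low_def integral_mult_right_zero by (subst Bochner_Integration.integral_sum) (use low_int in auto)
      then show ?thesis
        by (subst Bochner_Integration.integral_add[OF i1 Bochner_Integration.integrable_add[OF i2 i3]],
            subst Bochner_Integration.integral_add[OF i2 i3]) simp
    qed
    also have "(LINT t|M. lnorm torus (Xn n t) * ?dY n t) \<le> C * lnorm M (?dY n)"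
      using Cauchy_Schwarz_lnorm[OF Xn(1)[of n] YnY(1)[of n]] mult_right_mono[OF Xn(2)[of n], of "lnorm M (?dY n)"] by simp
    also have "(LINT t|M. ?XX n t * tail m t) \<le> 2 * C * lnorm M (tail m)"
    proof -
      have "lnorm M (?XX n) \<le> 2 * C" using lnorm_add_le[OF Xn(1)[of n] X(1)] Xn(2)[of n] X(2) by linarith
      then have "lnorm M (?XX n) * lnorm M (tail m) \<le> 2 * C * lnorm M (tail m)" by (rule mult_right_mono) simp
      moreover have "\<bar>LINT t|M. ?XX n t * tail m t\<bar> \<le> lnorm M (?XX n) * lnorm M (tail m)"
        by (intro Cauchy_Schwarz_lnorm sq_integrable_add Xn X tail_sq)
      ultimately show ?thesis by linarith
    qed
    finally show ?thesis by simp
  qed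
  show ?thesis
  proof (rule LIMSEQ_I)
    fix e :: real assume e: "e > 0"
    have "(\<lambda>m. 2 * C * lnorm M (tail m)) \<longlonglongrightarrow> 2 * C * 0" by (intro tendsto_mult tendsto_const tail_lim)
    then have "\<forall>\<^sub>F m in sequentially. 2 * C * lnorm M (tail m) < e / 2"
      by (rule order_tendstoD(2)) (use e in simp)
    then obtain m where m: "2 * C * lnorm M (tail m) < e / 2" by (auto simp: eventually_sequentially)
    have "(\<lambda>n. C * lnorm M (?dY n) + D * (\<Sum>\<kappa>\<in>freqs m. low n \<kappa>)) \<longlonglongrightarrow> C * 0 + D * (\<Sum>\<kappa>\<in>(freqs m :: (int^'d) set). 0)"
      by (intro tendsto_intros YnY(2) low_lim)
    then have "\<forall>\<^sub>F n in sequentially. C * lnorm M (?dY n) + D * (\<Sum>\<kappa>\<in>freqs m. low n \<kappa>) < e / 2"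
      by (rule order_tendstoD(2)) (use e in simp)
    then obtain N where N: "\<And>n. n \<ge> N \<Longrightarrow> C * lnorm M (?dY n) + D * (\<Sum>\<kappa>\<in>freqs m. low n \<kappa>) < e / 2"
      by (auto simp: eventually_sequentially)
    show "\<exists>N. \<forall>n\<ge>N. norm ((LINT t|M. \<bar>ip (Xn n t) (Yn n t) - ip (X t) (Y t)\<bar>) - 0) < e"
    proof (intro exI[of _ N] allI impI)
      fix n assume "n \<ge> N"
      from N[OF this] m bound[of n m] have "(LINT t|M. \<bar>ip (Xn n t) (Yn n t) - ip (X t) (Y t)\<bar>) < e" by linarith
      then show "norm ((LINT t|M. \<bar>ip (Xn n t) (Yn n t) - ip (X t) (Y t)\<bar>) - 0) < e" by simp
    qed
  qed
qed

section \<open>Compactness\<close>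

context quasilinear
begin

lemma C_rate_nonneg: "0 \<le> C_rate \<kappa>"
proof -
  have "0 \<le> integral {0..T} (\<lambda>s. (galerkin_rate 0 \<kappa> (frozen 0 s) s)\<^sup>2)"
    using lebesgue_on_interval_integral(2)[OF sq_integrableD(2)[OF frozen_rate(1)] order_refl order_refl]
    by (intro integral_nonneg) auto
  then show ?thesis using frozen_rate(2)[of 0 \<kappa>] by linarith
qed

lemma C_apriori_pos: "0 \<le> C_apriori" by (simp add: C_apriori_def)

lemma galerkin_0 [simp]: "galerkin n \<kappa> 0 = fourier_coeff u0 \<kappa>" by (simp add: galerkin_def)

lemma galerkin_hoelder_abs:
  assumes "s \<in> {0..T}" "t \<in> {0..T}"
  shows "\<bar>galerkin n \<kappa> t - galerkin n \<kappa> s\<bar> \<le> sqrt (C_rate \<kappa> * \<bar>t - s\<bar>)"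
proof -
  have "(galerkin n \<kappa> t - galerkin n \<kappa> s)\<^sup>2 \<le> C_rate \<kappa> * \<bar>t - s\<bar>"
    using galerkin_hoelder[of s t n \<kappa>] galerkin_hoelder[of t s n \<kappa>] assms
    by (cases "s \<le> t") (auto simp: power2_commute)
  then show ?thesis by (simp add: real_le_rsqrt)
qed

text \<open>A diagonal argument gives convergence at all rational times for all modes; the common
  modulus of continuity extends it to every time.\<close>

lemma galerkin_subsequence:
  obtains r c where "strict_mono (r :: nat \<Rightarrow> nat)" "\<And>\<kappa> t. t \<in> {0..T} \<Longrightarrow> (\<lambda>n. galerkin (r n) \<kappa> t) \<longlonglongrightarrow> c \<kappa> t"
proof -
  define Q where "Q = \<rat> \<inter> {0..T}"
  \<comment> \<open>Scaling by a bound of each mode gives the uniform bound that the diagonal argument needs.\<close>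
  define B where "B \<kappa> = \<bar>fourier_coeff u0 \<kappa>\<bar> + sqrt (C_rate \<kappa> * T) + 1" for \<kappa>
  have Bpos: "B \<kappa> > 0" for \<kappa> using C_rate_nonneg[of \<kappa>] T by (simp add: B_def add_nonneg_pos)
  have bd: "\<bar>galerkin n \<kappa> t\<bar> \<le> B \<kappa>" if "t \<in> {0..T}" for n \<kappa> t
  proof -
    have "\<bar>galerkin n \<kappa> t - fourier_coeff u0 \<kappa>\<bar> \<le> sqrt (C_rate \<kappa> * t)"
      using galerkin_hoelder_abs[of 0 t n \<kappa>] that by simp
    also have "\<dots> \<le> sqrt (C_rate \<kappa> * T)" using that C_rate_nonneg by (intro real_sqrt_le_mono mult_left_mono) auto
    finally show ?thesis unfolding B_def by linarith
  qed
  define S where "S = (UNIV :: (int^'d) set) \<times> Q"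
  have "countable S" unfolding S_def Q_def by (intro countable_SIGMA countableI_type countable_Int1 countable_rat)
  then obtain r where r: "strict_mono (r :: nat \<Rightarrow> nat)"
    and l: "\<And>z. z \<in> S \<Longrightarrow> \<exists>l. (\<lambda>n. galerkin (r n) (fst z) (snd z) / B (fst z)) \<longlonglongrightarrow> l"
  proof (rule function_convergent_subsequence[of S "\<lambda>n z. galerkin n (fst z) (snd z) / B (fst z)" 1])
    show "norm (galerkin n (fst z) (snd z) / B (fst z)) \<le> 1" if "z \<in> S" for n z
      using bd[of "snd z" n "fst z"] Bpos[of "fst z"] that by (auto simp: S_def Q_def abs_divide)
  qed auto
  have conv_Q: "convergent (\<lambda>n. galerkin (r n) \<kappa> q)" if q: "q \<in> Q" for \<kappa> q
  proof -
    obtain l where "(\<lambda>n. galerkin (r n) \<kappa> q / B \<kappa>) \<longlonglongrightarrow> l" using l[of "(\<kappa>, q)"] q by (auto simp: S_def)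
    from tendsto_mult_right[OF this, of "B \<kappa>"] have "(\<lambda>n. galerkin (r n) \<kappa> q) \<longlonglongrightarrow> l * B \<kappa>"
      using Bpos[of \<kappa>] by simp
    then show ?thesis by (rule convergentI)
  qed
  have "convergent (\<lambda>n. galerkin (r n) \<kappa> t)" if t: "t \<in> {0..T}" for \<kappa> t
  proof (rule Cauchy_convergent, rule CauchyI)
    fix e :: real assume e: "e > 0"
    define \<eta> where "\<eta> = (e/3)\<^sup>2 / (C_rate \<kappa> + 1)"
    have \<eta>: "\<eta> > 0" using e C_rate_nonneg[of \<kappa>] by (simp add: \<eta>_def)
    have "max 0 (t - \<eta>) < min T (t + \<eta>)" using t T \<eta> by auto
    then obtain q where "q \<in> \<rat>" "max 0 (t - \<eta>) < q" "q < min T (t + \<eta>)" using Rats_dense_in_real by blast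
    then have q: "q \<in> Q" "q \<in> {0..T}" "\<bar>t - q\<bar> \<le> \<eta>" by (auto simp: Q_def)
    have close: "\<bar>galerkin n \<kappa> t - galerkin n \<kappa> q\<bar> \<le> e/3" for n
    proof -
      have "C_rate \<kappa> * \<bar>t - q\<bar> \<le> (C_rate \<kappa> + 1) * \<eta>"
        using q(3) C_rate_nonneg[of \<kappa>] by (intro mult_mono) auto
      also have "\<dots> = (e/3)\<^sup>2" using C_rate_nonneg[of \<kappa>] by (simp add: \<eta>_def)
      finally have "sqrt (C_rate \<kappa> * \<bar>t - q\<bar>) \<le> e/3" using e by (intro real_le_lsqrt) auto
      then show ?thesis using galerkin_hoelder_abs[OF q(2) t, of n \<kappa>] by linarith
    qed
    have "Cauchy (\<lambda>n. galerkin (r n) \<kappa> q)" using conv_Q[OF q(1)] by (rule convergent_Cauchy)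
    then obtain M where M: "\<And>m n. m \<ge> M \<Longrightarrow> n \<ge> M \<Longrightarrow> norm (galerkin (r m) \<kappa> q - galerkin (r n) \<kappa> q) < e/3"
      using CauchyD[of _ "e/3"] e by (metis divide_pos_pos zero_less_numeral)
    show "\<exists>M. \<forall>m\<ge>M. \<forall>n\<ge>M. norm (galerkin (r m) \<kappa> t - galerkin (r n) \<kappa> t) < e"
    proof (intro exI[of _ M] allI impI)
      fix m n assume "m \<ge> M" "n \<ge> M"
      from M[OF this] close[of "r m"] close[of "r n"] show "norm (galerkin (r m) \<kappa> t - galerkin (r n) \<kappa> t) < e"
        unfolding real_norm_def by linarith
    qed
  qed
  then have "\<exists>l. (\<lambda>n. galerkin (r n) \<kappa> t) \<longlonglongrightarrow> l" if "t \<in> {0..T}" for \<kappa> t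
    using that by (auto simp: convergent_def)
  then have "(\<lambda>n. galerkin (r n) \<kappa> t) \<longlonglongrightarrow> lim (\<lambda>n. galerkin (r n) \<kappa> t)" if "t \<in> {0..T}" for \<kappa> t
    using that convergent_LIMSEQ_iff unfolding convergent_def by blast
  from that[OF r this] show ?thesis .
qed

end

locale quasilinear_limit = quasilinear T \<delta> L b a \<Theta> h u0
  for T \<delta> L :: real
    and b :: "'d::finite \<Rightarrow> real \<Rightarrow> real"
    and a :: "'d \<Rightarrow> 'd \<Rightarrow> real \<Rightarrow> real"
    and \<Theta> :: "'u::{real_inner, banach, second_countable_topology} \<Rightarrow> real \<Rightarrow> real"
    and h :: "real \<Rightarrow> 'u"
    and u0 :: "real^'d \<Rightarrow> real" +
  fixes r :: "nat \<Rightarrow> nat" and c :: "int^'d \<Rightarrow> real \<Rightarrow> real"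
  assumes r_mono: "strict_mono r"
    and galerkin_lim: "t \<in> {0..T} \<Longrightarrow> (\<lambda>n. galerkin (r n) \<kappa> t) \<longlonglongrightarrow> c \<kappa> t"
begin

lemma r_ge: "n \<le> r n" using seq_suble[OF r_mono] .

lemma c_zero: "c \<kappa> 0 = fourier_coeff u0 \<kappa>"
  using galerkin_lim[of 0 \<kappa>] T by (simp add: LIMSEQ_const_iff)

lemma c_hoelder:
  assumes "s \<in> {0..T}" "t \<in> {0..T}"
  shows "\<bar>c \<kappa> t - c \<kappa> s\<bar> \<le> sqrt (C_rate \<kappa> * \<bar>t - s\<bar>)"
proof (rule LIMSEQ_le_const2)
  show "(\<lambda>n. \<bar>galerkin (r n) \<kappa> t - galerkin (r n) \<kappa> s\<bar>) \<longlonglongrightarrow> \<bar>c \<kappa> t - c \<kappa> s\<bar>"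
    by (intro tendsto_intros galerkin_lim assms)
  show "\<exists>N. \<forall>n\<ge>N. \<bar>galerkin (r n) \<kappa> t - galerkin (r n) \<kappa> s\<bar> \<le> sqrt (C_rate \<kappa> * \<bar>t - s\<bar>)"
    using galerkin_hoelder_abs[OF assms] by blast
qed

lemma c_tendsto:
  assumes t: "t \<in> {0..T}"
  shows "(c \<kappa> \<longlongrightarrow> c \<kappa> t) (at t within {0..T})"
proof -
  have "((\<lambda>s. c \<kappa> s - c \<kappa> t) \<longlongrightarrow> 0) (at t within {0..T})"
  proof (rule Lim_null_comparison)
    show "\<forall>\<^sub>F s in at t within {0..T}. norm (c \<kappa> s - c \<kappa> t) \<le> sqrt (C_rate \<kappa> * \<bar>s - t\<bar>)"
      unfolding eventually_at_filter using c_hoelder[OF t] by (auto intro!: always_eventually)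
    have "((\<lambda>s. sqrt (C_rate \<kappa> * \<bar>s - t\<bar>)) \<longlongrightarrow> sqrt (C_rate \<kappa> * \<bar>t - t\<bar>)) (at t within {0..T})"
      by (intro tendsto_intros)
    then show "((\<lambda>s. sqrt (C_rate \<kappa> * \<bar>s - t\<bar>)) \<longlongrightarrow> 0) (at t within {0..T})" by simp
  qed
  then show ?thesis by (rule LIM_zero_cancel)
qed

lemma c_continuous: "continuous_on {0..T} (c \<kappa>)"
  unfolding continuous_on_def using c_tendsto by blast

lemma c_measurable [measurable]: "c \<kappa> \<in> borel_measurable time"
  by (rule continuous_imp_measurable_on_sets_lebesgue[OF c_continuous]) simp

lemma frozen_lim:
  assumes t: "t \<in> {0..T}" shows "(\<lambda>n. frozen (r n) t \<kappa>) \<longlonglongrightarrow> c \<kappa> t"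
proof -
  have "(\<lambda>n. galerkin (r n) \<kappa> t - frozen (r n) t \<kappa>) \<longlonglongrightarrow> 0"
  proof (rule Lim_null_comparison)
    show "\<forall>\<^sub>F n in sequentially. norm (galerkin (r n) \<kappa> t - frozen (r n) t \<kappa>) \<le> sqrt (C_rate \<kappa> * (T / (real n + 1)))"
    proof (rule always_eventually, rule allI)
      fix n
      have "tau (r n) \<le> T / (real (r n) + 1)" by (rule tau_props)
      also have "\<dots> \<le> T / (real n + 1)" using r_ge[of n] T by (intro divide_left_mono) auto
      finally have "C_rate \<kappa> * tau (r n) \<le> C_rate \<kappa> * (T / (real n + 1))" by (intro mult_left_mono C_rate_nonneg)
      with frozen_close[OF t, of "r n" \<kappa>] have "(galerkin (r n) \<kappa> t - frozen (r n) t \<kappa>)\<^sup>2 \<le> C_rate \<kappa> * (T / (real n + 1))" by linarith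
      then show "norm (galerkin (r n) \<kappa> t - frozen (r n) t \<kappa>) \<le> sqrt (C_rate \<kappa> * (T / (real n + 1)))"
        by (simp add: real_le_rsqrt)
    qed
    have "(\<lambda>n. C_rate \<kappa> * T * inverse (real (Suc n))) \<longlonglongrightarrow> C_rate \<kappa> * T * 0"
      by (intro tendsto_intros LIMSEQ_inverse_real_of_nat)
    then have "(\<lambda>n. sqrt (C_rate \<kappa> * T * inverse (real (Suc n)))) \<longlonglongrightarrow> sqrt (C_rate \<kappa> * T * 0)"
      by (rule tendsto_real_sqrt)
    then show "(\<lambda>n. sqrt (C_rate \<kappa> * (T / (real n + 1)))) \<longlonglongrightarrow> 0" by (simp add: divide_inverse add.commute mult.assoc)
  qed
  from tendsto_diff[OF galerkin_lim[OF t, of \<kappa>] this] show ?thesis by simp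
qed

definition wcoef :: "nat \<Rightarrow> real \<Rightarrow> int^'d \<Rightarrow> real" where
  "wcoef n t \<kappa> = (if \<kappa> \<in> freqs (r n) then frozen (r n) t \<kappa> else 0)"

definition galerkin_fn :: "nat \<Rightarrow> real \<Rightarrow> real^'d \<Rightarrow> real" where
  "galerkin_fn n t = fourier_sum (freqs (r n)) (frozen (r n) t)"

lemma fourier_coeff_galerkin_fn: "fourier_coeff (galerkin_fn n t) \<kappa> = wcoef n t \<kappa>"
  by (simp add: galerkin_fn_def wcoef_def fourier_coeff_fourier_sum)

lemma sq_galerkin_fn [simp]: "sq_integrable torus (galerkin_fn n t)" by (simp add: galerkin_fn_def)

lemma freqs_r_eventually: "\<forall>\<^sub>F n in sequentially. freqs m \<subseteq> freqs (r n)"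
  using eventually_ge_at_top[of m] by eventually_elim (intro freqs_mono order_trans[OF _ r_ge])

lemma wcoef_lim:
  assumes t: "t \<in> {0..T}" shows "(\<lambda>n. wcoef n t \<kappa>) \<longlonglongrightarrow> c \<kappa> t"
proof -
  obtain m where m: "\<kappa> \<in> freqs m" using mem_freqs_exists by blast
  have "\<forall>\<^sub>F n in sequentially. frozen (r n) t \<kappa> = wcoef n t \<kappa>"
    using freqs_r_eventually[of m] by eventually_elim (use m in \<open>auto simp: wcoef_def\<close>)
  from Lim_transform_eventually[OF frozen_lim[OF t] this] show ?thesis .
qed

lemma wcoef_sum_le:
  assumes "\<And>\<kappa>. 0 \<le> g \<kappa>"
  shows "(\<Sum>\<kappa>\<in>freqs m. g \<kappa> * (wcoef n t \<kappa>)\<^sup>2) \<le> (\<Sum>\<kappa>\<in>freqs (r n). g \<kappa> * (frozen (r n) t \<kappa>)\<^sup>2)"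
proof -
  have "(\<Sum>\<kappa>\<in>freqs m. g \<kappa> * (wcoef n t \<kappa>)\<^sup>2) = (\<Sum>\<kappa>\<in>freqs m \<inter> freqs (r n). g \<kappa> * (frozen (r n) t \<kappa>)\<^sup>2)"
    by (intro sum.mono_neutral_cong_right) (auto simp: wcoef_def)
  also have "\<dots> \<le> (\<Sum>\<kappa>\<in>freqs (r n). g \<kappa> * (frozen (r n) t \<kappa>)\<^sup>2)"
    using assms by (intro sum_mono2) auto
  finally show ?thesis .
qed

lemma wcoef_bound:
  assumes t: "t \<in> {0..T}"
  shows "(\<Sum>\<kappa>\<in>freqs m. (wcoef n t \<kappa>)\<^sup>2) \<le> C_apriori"
  using wcoef_sum_le[of "\<lambda>_. 1" n t m] frozen_bound[OF t, of "r n"] by (simp add: vnorm2_def)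

lemma wcoef_grad_le: "(\<Sum>\<kappa>\<in>freqs m. freq_norm_sq \<kappa> * (wcoef n t \<kappa>)\<^sup>2) \<le> vgrad2 (r n) (frozen (r n) t)"
  unfolding vgrad2_def by (rule wcoef_sum_le) simp

lemma c_bound:
  assumes t: "t \<in> {0..T}"
  shows "(\<Sum>\<kappa>\<in>freqs m. (c \<kappa> t)\<^sup>2) \<le> C_apriori"
proof (rule LIMSEQ_le_const2)
  show "(\<lambda>n. \<Sum>\<kappa>\<in>freqs m. (wcoef n t \<kappa>)\<^sup>2) \<longlonglongrightarrow> (\<Sum>\<kappa>\<in>freqs m. (c \<kappa> t)\<^sup>2)"
    by (intro tendsto_intros wcoef_lim t)
qed (use wcoef_bound[OF t] in blast)

lemma square_le_of_sum:
  assumes "\<And>m. (\<Sum>\<kappa>\<in>freqs m. (g \<kappa>)\<^sup>2) \<le> C" shows "\<bar>g \<kappa>\<bar> \<le> sqrt C" "(g \<kappa>)\<^sup>2 \<le> C"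
proof -
  obtain m where m: "\<kappa> \<in> freqs m" using mem_freqs_exists by blast
  have "(g \<kappa>)\<^sup>2 \<le> (\<Sum>\<kappa>\<in>freqs m. (g \<kappa>)\<^sup>2)" by (rule member_le_sum[OF m]) auto
  then show "(g \<kappa>)\<^sup>2 \<le> C" using assms[of m] by linarith
  then show "\<bar>g \<kappa>\<bar> \<le> sqrt C" by (simp add: real_le_rsqrt)
qed

lemma wcoef_measurable: "(\<lambda>t. wcoef n t \<kappa>) \<in> borel_measurable time"
proof -
  have "(\<lambda>t. frozen (r n) t \<kappa>) \<in> borel_measurable time"
    using frozen_measurable[of "\<lambda>v s. v \<kappa>" "r n"] by simp
  then show ?thesis by (cases "\<kappa> \<in> freqs (r n)") (simp_all add: wcoef_def)
qed

definition partial_gradient_energy :: "nat \<Rightarrow> real \<Rightarrow> real" where "partial_gradient_energy m t = (\<Sum>\<kappa>\<in>freqs m. freq_norm_sq \<kappa> * (c \<kappa> t)\<^sup>2)"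

lemma partial_gradient_energy_measurable [measurable]: "partial_gradient_energy m \<in> borel_measurable time"
  unfolding partial_gradient_energy_def[abs_def] by measurable

lemma partial_gradient_energy_mono: "m \<le> n \<Longrightarrow> partial_gradient_energy m t \<le> partial_gradient_energy n t"
  unfolding partial_gradient_energy_def by (intro sum_mono2 freqs_mono) auto

lemma partial_gradient_energy_nonneg: "0 \<le> partial_gradient_energy m t" by (simp add: partial_gradient_energy_def sum_nonneg)

lemma partial_gradient_energy_integral: "integrable time (partial_gradient_energy m)" "(LINT t|time. partial_gradient_energy m t) \<le> C_apriori / \<delta>"
proof -
  interpret finite_measure time by (rule finite_measure_time)
  let ?B = "(\<Sum>\<kappa>\<in>freqs m. freq_norm_sq (\<kappa> :: int^'d) * C_apriori)"
  let ?g = "\<lambda>n t. \<Sum>\<kappa>\<in>freqs m. freq_norm_sq \<kappa> * (wcoef n t \<kappa>)\<^sup>2"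
  have bd: "norm (?g n t) \<le> ?B" if "t \<in> {0..T}" for n t
  proof -
    have "?g n t \<le> ?B" by (intro sum_mono mult_left_mono square_le_of_sum(2) wcoef_bound[OF that]) auto
    then show ?thesis by (simp add: sum_nonneg)
  qed
  have mg: "?g n \<in> borel_measurable time" for n using wcoef_measurable by measurable
  have lim: "AE t in time. (\<lambda>n. ?g n t) \<longlonglongrightarrow> partial_gradient_energy m t"
    unfolding partial_gradient_energy_def by (intro AE_I2 tendsto_intros wcoef_lim) simp
  have bdAE: "AE t in time. norm (?g n t) \<le> ?B" for n using bd by (intro AE_I2) auto
  show "integrable time (partial_gradient_energy m)"
    by (rule integrable_dominated_convergence[OF partial_gradient_energy_measurable mg integrable_const lim bdAE])
  have "(\<lambda>n. LINT t|time. ?g n t) \<longlonglongrightarrow> (LINT t|time. partial_gradient_energy m t)"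
    by (rule integral_dominated_convergence[OF partial_gradient_energy_measurable mg integrable_const lim bdAE])
  moreover have "(LINT t|time. ?g n t) \<le> C_apriori / \<delta>" for n
  proof -
    have "(LINT t|time. ?g n t) \<le> (LINT t|time. vgrad2 (r n) (frozen (r n) t))"
    proof (rule integral_mono)
      show "integrable time (?g n)" by (rule integrable_const_bound[OF bdAE mg])
    qed (rule vgrad2_frozen(1), rule wcoef_grad_le)
    also have "\<dots> = integral {0..T} (\<lambda>t. vgrad2 (r n) (frozen (r n) t))"
      by (rule lebesgue_on_interval_integral(1)[OF vgrad2_frozen(1)]) auto
    finally show ?thesis using vgrad2_frozen(2)[of "r n"] by linarith
  qed
  ultimately show "(LINT t|time. partial_gradient_energy m t) \<le> C_apriori / \<delta>" using LIMSEQ_le_const2 by blast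
qed

lemma partial_gradient_energy_SUP: "(\<integral>\<^sup>+t. (SUP m. ennreal (partial_gradient_energy m t)) \<partial>time) \<le> ennreal (C_apriori / \<delta>)"
proof -
  have "(\<integral>\<^sup>+t. (SUP m. ennreal (partial_gradient_energy m t)) \<partial>time) = (SUP m. \<integral>\<^sup>+t. ennreal (partial_gradient_energy m t) \<partial>time)"
    by (rule nn_integral_monotone_convergence_SUP) (auto simp: incseq_def le_fun_def intro!: ennreal_leI partial_gradient_energy_mono)
  also have "\<dots> \<le> ennreal (C_apriori / \<delta>)"
    using partial_gradient_energy_integral partial_gradient_energy_nonneg by (intro SUP_least) (simp add: nn_integral_eq_integral ennreal_leI)
  finally show ?thesis .
qed

text \<open>The times at which the limit has a weak gradient.\<close>

definition finite_gradient :: "real \<Rightarrow> bool" where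
  "finite_gradient t \<longleftrightarrow> (\<exists>N::nat. \<forall>m. partial_gradient_energy m t \<le> real N)"

lemma finite_gradient_AE: "AE t in time. finite_gradient t"
proof -
  have "AE t in time. (SUP m. ennreal (partial_gradient_energy m t)) \<noteq> \<infinity>"
    using le_less_trans[OF partial_gradient_energy_SUP ennreal_less_top] by (intro nn_integral_PInf_AE) auto
  then show ?thesis
  proof eventually_elim
    case (elim t)
    then obtain z where z: "z \<ge> 0" "(SUP m. ennreal (partial_gradient_energy m t)) = ennreal z" by (cases "(SUP m. ennreal (partial_gradient_energy m t))") auto
    obtain N :: nat where N: "z \<le> real N" using real_arch_simple by blast
    have "partial_gradient_energy m t \<le> real N" for m
    proof -
      have "ennreal (partial_gradient_energy m t) \<le> ennreal z" unfolding z(2)[symmetric] by (rule SUP_upper) simp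
      then have "partial_gradient_energy m t \<le> z" using z(1) by simp
      then show ?thesis using N by linarith
    qed
    then show ?case by (auto simp: finite_gradient_def)
  qed
qed

lemma finite_gradient_measurable [measurable]: "Measurable.pred time finite_gradient"
  unfolding finite_gradient_def[abs_def] by measurable

text \<open>A function with the limiting coefficients at each time, chosen by the Riesz--Fischer theorem.\<close>

definition u :: "real \<Rightarrow> real^'d \<Rightarrow> real" where
  "u t = (SOME f. sq_integrable torus f \<and> (\<forall>\<kappa>. fourier_coeff f \<kappa> = c \<kappa> t))"

lemma u_props:
  assumes t: "t \<in> {0..T}" shows "sq_integrable torus (u t)" "fourier_coeff (u t) \<kappa> = c \<kappa> t"
proof -
  have "\<exists>f. sq_integrable torus f \<and> (\<forall>\<kappa>. fourier_coeff f \<kappa> = c \<kappa> t)"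
    using Riesz_Fischer[OF c_bound[OF t]] by metis
  then have "sq_integrable torus (u t) \<and> (\<forall>\<kappa>. fourier_coeff (u t) \<kappa> = c \<kappa> t)" unfolding u_def by (rule someI_ex)
  then show "sq_integrable torus (u t)" "fourier_coeff (u t) \<kappa> = c \<kappa> t" by auto
qed

lemma u_lnorm: assumes t: "t \<in> {0..T}" shows "(lnorm torus (u t))\<^sup>2 \<le> C_apriori"
  by (rule lnorm_le_of_fourier_coeff[OF u_props(1)[OF t]]) (simp add: u_props(2)[OF t] c_bound[OF t])

lemma u_fourier_measurable: "fourier_measurable time u"
  unfolding fourier_measurable_def
proof (intro conjI ballI allI)
  show "(\<lambda>t. fourier_coeff (u t) \<kappa>) \<in> borel_measurable time" for \<kappa>
    using c_measurable[of \<kappa>] by (subst measurable_cong[where g="c \<kappa>"]) (auto simp: u_props)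
qed (simp add: u_props)

lemma u_H1: assumes t: "t \<in> {0..T}" "finite_gradient t" shows "u t \<in> H1"
proof -
  obtain N :: nat where "\<And>m. partial_gradient_energy m t \<le> real N" using t(2) by (auto simp: finite_gradient_def)
  then show ?thesis
    by (intro H1_fourierI[OF u_props(1)[OF t(1)], of "real N"]) (simp add: u_props(2)[OF t(1)] partial_gradient_energy_def)
qed

definition Du :: "'d \<Rightarrow> real \<Rightarrow> real^'d \<Rightarrow> real" where
  "Du i t = (if finite_gradient t then (\<lambda>x. wgrad (u t) x $ i) else (\<lambda>x. 0))"

lemma Du_sq: assumes t: "t \<in> {0..T}" shows "sq_integrable torus (Du i t)"
  using wgrad_sq_integrable[OF u_H1[OF t]] by (auto simp: Du_def)

lemma fourier_coeff_Du: assumes t: "t \<in> {0..T}" shows "fourier_coeff (Du i t) \<kappa> = (if finite_gradient t then dcoef i (\<lambda>\<kappa>. c \<kappa> t) \<kappa> else 0)"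
  using fourier_coeff_wgrad[OF u_H1[OF t]] by (auto simp: Du_def dcoef_def u_props(2)[OF t])

lemma Du_fourier_measurable: "fourier_measurable time (Du i)"
  unfolding fourier_measurable_def
proof (intro conjI ballI allI)
  show "(\<lambda>t. fourier_coeff (Du i t) \<kappa>) \<in> borel_measurable time" for \<kappa>
    by (subst measurable_cong[where g="\<lambda>t. if finite_gradient t then dcoef i (\<lambda>\<kappa>. c \<kappa> t) \<kappa> else 0"])
       (simp_all add: fourier_coeff_Du, unfold dcoef_def, measurable)
qed (simp add: Du_sq)

definition gradient_energy :: "real \<Rightarrow> real" where "gradient_energy t = (\<Sum>i\<in>UNIV. (lnorm torus (Du i t))\<^sup>2)"

lemma partial_gradient_energy_lim: assumes t: "t \<in> {0..T}" "finite_gradient t" shows "(\<lambda>m. partial_gradient_energy m t) \<longlonglongrightarrow> gradient_energy t"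
proof -
  have "(L2_norm (wgrad (u t)))\<^sup>2 = gradient_energy t"
    unfolding L2_norm_vec[OF wgrad_L2[OF u_H1[OF t]]] gradient_energy_def Du_def using t by simp
  with H1_norm_tendsto(2)[OF u_H1[OF t]] show ?thesis by (simp add: partial_gradient_energy_def u_props(2)[OF t(1)])
qed

lemma partial_gradient_energy_le_gradient_energy: assumes t: "t \<in> {0..T}" "finite_gradient t" shows "partial_gradient_energy m t \<le> gradient_energy t"
  using incseq_le[OF _ partial_gradient_energy_lim[OF t]] partial_gradient_energy_mono by (simp add: incseq_def)

lemma gradient_energy_nonneg: "0 \<le> gradient_energy t" by (simp add: gradient_energy_def sum_nonneg)

text \<open>Fatou's lemma in the form of monotone convergence of the truncated gradient energies.\<close>

lemma gradient_energy_integral: "integrable time gradient_energy" "(LINT t|time. gradient_energy t) \<le> C_apriori / \<delta>"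
proof -
  have m: "gradient_energy \<in> borel_measurable time"
    unfolding gradient_energy_def[abs_def] using fourier_measurable_lnorm[OF Du_fourier_measurable] by measurable
  have "(\<integral>\<^sup>+t. ennreal (gradient_energy t) \<partial>time) \<le> (\<integral>\<^sup>+t. (SUP m. ennreal (partial_gradient_energy m t)) \<partial>time)"
  proof (rule nn_integral_mono)
    fix t assume "t \<in> space time"
    then have t: "t \<in> {0..T}" by simp
    show "ennreal (gradient_energy t) \<le> (SUP m. ennreal (partial_gradient_energy m t))"
    proof (cases "finite_gradient t")
      case True
      have "(\<lambda>m. ennreal (partial_gradient_energy m t)) \<longlonglongrightarrow> ennreal (gradient_energy t)" by (intro tendsto_ennrealI partial_gradient_energy_lim t True)
      then show ?thesis by (rule LIMSEQ_le_const2) (auto intro!: exI[of _ 0] SUP_upper)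
    next
      case False then show ?thesis by (simp add: gradient_energy_def Du_def)
    qed
  qed
  also note partial_gradient_energy_SUP
  finally have le: "(\<integral>\<^sup>+t. ennreal (gradient_energy t) \<partial>time) \<le> ennreal (C_apriori / \<delta>)" .
  show i: "integrable time gradient_energy"
    using le_less_trans[OF le] m gradient_energy_nonneg by (intro integrableI_nonneg) auto
  have "ennreal (LINT t|time. gradient_energy t) \<le> ennreal (C_apriori / \<delta>)"
    using le nn_integral_eq_integral[OF i] gradient_energy_nonneg by simp
  moreover have "0 \<le> C_apriori / \<delta>" using C_apriori_pos \<delta> by simp
  ultimately show "(LINT t|time. gradient_energy t) \<le> C_apriori / \<delta>" by simp
qed

definition galerkin_grad :: "nat \<Rightarrow> 'd \<Rightarrow> real \<Rightarrow> real^'d \<Rightarrow> real" where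
  "galerkin_grad n i t = fourier_sum (freqs (r n)) (dcoef i (frozen (r n) t))"

lemma sq_galerkin_grad [simp]: "sq_integrable torus (galerkin_grad n i t)" by (simp add: galerkin_grad_def)

lemma fourier_coeff_galerkin_grad: "fourier_coeff (galerkin_grad n i t) \<kappa> = dcoef i (wcoef n t) \<kappa>"
  by (simp add: galerkin_grad_def fourier_coeff_fourier_sum dcoef_def wcoef_def)

lemma galerkin_fn_fourier_measurable: "fourier_measurable time (galerkin_fn n)" "fourier_measurable time (galerkin_grad n i)"
  unfolding fourier_measurable_def fourier_coeff_galerkin_fn fourier_coeff_galerkin_grad dcoef_def using wcoef_measurable by auto

lemma galerkin_grad_norm: "(\<Sum>i\<in>UNIV. (lnorm torus (galerkin_grad n i t))\<^sup>2) = vgrad2 (r n) (frozen (r n) t)"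
  unfolding galerkin_grad_def lnorm_dcoef vgrad2_def ..

lemma gradient_time_bound:
  assumes "\<And>i. fourier_measurable time (g i)"
    and "integrable time (\<lambda>t. \<Sum>i\<in>(UNIV::'d set). (lnorm torus (g i t))\<^sup>2)" "(LINT t|time. (\<Sum>i\<in>(UNIV::'d set). (lnorm torus (g i t))\<^sup>2)) \<le> Z"
  shows "sq_integrable time (\<lambda>t. lnorm torus (g i t))" "lnorm time (\<lambda>t. lnorm torus (g i t)) \<le> sqrt Z"
proof -
  have m: "(\<lambda>t. lnorm torus (g i t)) \<in> borel_measurable time" by (rule fourier_measurable_lnorm[OF assms(1)])
  have le: "(lnorm torus (g i t))\<^sup>2 \<le> (\<Sum>i\<in>UNIV. (lnorm torus (g i t))\<^sup>2)" for t
    by (rule member_le_sum) auto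
  have i: "integrable time (\<lambda>t. (lnorm torus (g i t))\<^sup>2)"
    by (rule Bochner_Integration.integrable_bound[OF assms(2)]) (use m le in \<open>auto simp: sum_nonneg\<close>)
  then show "sq_integrable time (\<lambda>t. lnorm torus (g i t))" using m by (simp add: sq_integrable_def)
  have "(LINT t|time. (lnorm torus (g i t))\<^sup>2) \<le> Z"
    using integral_mono[OF i assms(2) le] assms(3) by linarith
  then show "lnorm time (\<lambda>t. lnorm torus (g i t)) \<le> sqrt Z" unfolding lnorm_def[of time] by (rule real_sqrt_le_mono)
qed

lemma galerkin_grad_time: "sq_integrable time (\<lambda>t. lnorm torus (galerkin_grad n i t))" "lnorm time (\<lambda>t. lnorm torus (galerkin_grad n i t)) \<le> sqrt (C_apriori / \<delta>)"
proof -
  have "(LINT t|time. vgrad2 (r n) (frozen (r n) t)) \<le> C_apriori / \<delta>"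
    using lebesgue_on_interval_integral(1)[OF vgrad2_frozen(1), of 0 T "r n"] vgrad2_frozen(2)[of "r n"] by simp
  then show "sq_integrable time (\<lambda>t. lnorm torus (galerkin_grad n i t))" "lnorm time (\<lambda>t. lnorm torus (galerkin_grad n i t)) \<le> sqrt (C_apriori / \<delta>)"
    using gradient_time_bound[of "galerkin_grad n" "C_apriori / \<delta>" i, OF galerkin_fn_fourier_measurable(2)] vgrad2_frozen(1)[of "r n"] unfolding galerkin_grad_norm by auto
qed

lemma Du_time: "sq_integrable time (\<lambda>t. lnorm torus (Du i t))" "lnorm time (\<lambda>t. lnorm torus (Du i t)) \<le> sqrt (C_apriori / \<delta>)"
  using gradient_time_bound[of Du "C_apriori / \<delta>" i, OF Du_fourier_measurable] gradient_energy_integral unfolding gradient_energy_def[abs_def] by auto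

abbreviation gap :: "nat \<Rightarrow> real \<Rightarrow> real" where
  "gap n t \<equiv> lnorm torus (\<lambda>x. galerkin_fn n t x - u t x)"

lemma gap_measurable: "gap n \<in> borel_measurable time"
  by (intro fourier_measurable_lnorm fourier_measurable_diff galerkin_fn_fourier_measurable u_fourier_measurable)

lemma gap_le:
  assumes t: "t \<in> {0..T}" "finite_gradient t" and m: "m > 0"
  shows "(gap n t)\<^sup>2 \<le> (\<Sum>\<kappa>\<in>freqs m. (wcoef n t \<kappa> - c \<kappa> t)\<^sup>2) + (2 * vgrad2 (r n) (frozen (r n) t) + 2 * gradient_energy t) / (real m)\<^sup>2"
proof -
  have f: "fourier_coeff (\<lambda>x. galerkin_fn n t x - u t x) \<kappa> = wcoef n t \<kappa> - c \<kappa> t" for \<kappa>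
    by (simp add: fourier_coeff_diff u_props[OF t(1)] fourier_coeff_galerkin_fn)
  have "(\<Sum>\<kappa>\<in>freqs N. freq_norm_sq \<kappa> * (fourier_coeff (\<lambda>x. galerkin_fn n t x - u t x) \<kappa>)\<^sup>2) \<le> 2 * vgrad2 (r n) (frozen (r n) t) + 2 * gradient_energy t" for N
  proof -
    have "(\<Sum>\<kappa>\<in>freqs N. freq_norm_sq \<kappa> * (fourier_coeff (\<lambda>x. galerkin_fn n t x - u t x) \<kappa>)\<^sup>2) \<le> (\<Sum>\<kappa>\<in>freqs N. 2 * (freq_norm_sq \<kappa> * (wcoef n t \<kappa>)\<^sup>2) + 2 * (freq_norm_sq \<kappa> * (c \<kappa> t)\<^sup>2))"
    proof (rule sum_mono)
      fix \<kappa>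
      have "0 \<le> (wcoef n t \<kappa> + c \<kappa> t)\<^sup>2" by simp
      then have "(wcoef n t \<kappa> - c \<kappa> t)\<^sup>2 \<le> 2 * (wcoef n t \<kappa>)\<^sup>2 + 2 * (c \<kappa> t)\<^sup>2"
        by (simp add: power2_sum power2_diff)
      then have "freq_norm_sq \<kappa> * (wcoef n t \<kappa> - c \<kappa> t)\<^sup>2 \<le> freq_norm_sq \<kappa> * (2 * (wcoef n t \<kappa>)\<^sup>2 + 2 * (c \<kappa> t)\<^sup>2)" by (intro mult_left_mono) auto
      then show "freq_norm_sq \<kappa> * (fourier_coeff (\<lambda>x. galerkin_fn n t x - u t x) \<kappa>)\<^sup>2 \<le> 2 * (freq_norm_sq \<kappa> * (wcoef n t \<kappa>)\<^sup>2) + 2 * (freq_norm_sq \<kappa> * (c \<kappa> t)\<^sup>2)"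
        unfolding f by (simp add: algebra_simps)
    qed
    also have "\<dots> = 2 * (\<Sum>\<kappa>\<in>freqs N. freq_norm_sq \<kappa> * (wcoef n t \<kappa>)\<^sup>2) + 2 * partial_gradient_energy N t"
      by (simp add: sum.distrib sum_distrib_left partial_gradient_energy_def)
    also have "\<dots> \<le> 2 * vgrad2 (r n) (frozen (r n) t) + 2 * gradient_energy t"
      using wcoef_grad_le[of n t N] partial_gradient_energy_le_gradient_energy[OF t, of N] by linarith
    finally show ?thesis .
  qed
  from lnorm_le_low_frequencies[OF sq_integrable_diff[OF sq_galerkin_fn u_props(1)[OF t(1)]] m this] show ?thesis unfolding f .
qed

lemma gap_sq: "sq_integrable time (gap n)"
proof (rule sq_integrable_of_bounded[OF finite_measure_time gap_measurable])
  fix t assume "t \<in> space time"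
  then have t: "t \<in> {0..T}" by simp
  have "(lnorm torus (galerkin_fn n t))\<^sup>2 \<le> C_apriori"
    by (rule lnorm_le_of_fourier_coeff[OF sq_galerkin_fn]) (simp add: fourier_coeff_galerkin_fn wcoef_bound[OF t])
  then have "lnorm torus (galerkin_fn n t) \<le> sqrt C_apriori" "lnorm torus (u t) \<le> sqrt C_apriori"
    using u_lnorm[OF t] by (auto intro!: real_le_rsqrt)
  then show "\<bar>gap n t\<bar> \<le> 2 * sqrt C_apriori"
    using lnorm_diff_le[OF sq_galerkin_fn[of n t] u_props(1)[OF t]] by simp
qed

text \<open>Low modes converge pointwise and boundedly; high modes are uniformly small because both
  families are bounded in L2(0,T;H1).\<close>

theorem gap_tendsto: "(\<lambda>n. lnorm time (gap n)) \<longlonglongrightarrow> 0"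
proof -
  interpret finite_measure time by (rule finite_measure_time)
  define low where "low m n = (LINT t|time. (\<Sum>\<kappa>\<in>freqs m. (wcoef n t \<kappa> - c \<kappa> t)\<^sup>2))" for m n
  let ?s = "\<lambda>m n t. (\<Sum>\<kappa>\<in>freqs m. (wcoef n t \<kappa> - c \<kappa> t)\<^sup>2)"
  have ms: "?s m n \<in> borel_measurable time" for m n using wcoef_measurable by measurable
  have bds: "AE t in time. norm (?s m n t) \<le> (\<Sum>\<kappa>\<in>(freqs m :: (int^'d) set). 4 * C_apriori)" for m n
  proof (rule AE_I2)
    fix t assume "t \<in> space time"
    then have t: "t \<in> {0..T}" by simp
    have "(wcoef n t \<kappa> - c \<kappa> t)\<^sup>2 \<le> 4 * C_apriori" for \<kappa>
    proof -
      have "0 \<le> (wcoef n t \<kappa> + c \<kappa> t)\<^sup>2" by simp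
      then have "(wcoef n t \<kappa> - c \<kappa> t)\<^sup>2 \<le> 2 * (wcoef n t \<kappa>)\<^sup>2 + 2 * (c \<kappa> t)\<^sup>2"
        by (simp add: power2_sum power2_diff)
      moreover note square_le_of_sum(2)[of "wcoef n t" C_apriori \<kappa>, OF wcoef_bound[OF t]]
        square_le_of_sum(2)[of "\<lambda>\<kappa>. c \<kappa> t" C_apriori \<kappa>, OF c_bound[OF t]]
      ultimately show ?thesis by linarith
    qed
    then have "?s m n t \<le> (\<Sum>\<kappa>\<in>(freqs m :: (int^'d) set). 4 * C_apriori)" by (rule sum_mono)
    then show "norm (?s m n t) \<le> (\<Sum>\<kappa>\<in>(freqs m :: (int^'d) set). 4 * C_apriori)" by (simp add: sum_nonneg)
  qed
  have low_lim: "(\<lambda>n. low m n) \<longlonglongrightarrow> 0" for m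
  proof -
    have "(\<lambda>n. low m n) \<longlonglongrightarrow> (LINT t|time. 0)"
      unfolding low_def
    proof (rule integral_dominated_convergence[OF _ ms integrable_const _ bds])
      show "AE t in time. (\<lambda>n. ?s m n t) \<longlonglongrightarrow> 0"
      proof (rule AE_I2)
        fix t assume "t \<in> space time"
        then have "(\<lambda>n. ?s m n t) \<longlonglongrightarrow> (\<Sum>\<kappa>\<in>freqs m. (c \<kappa> t - c \<kappa> t)\<^sup>2)" by (intro tendsto_intros wcoef_lim) simp
        then show "(\<lambda>n. ?s m n t) \<longlonglongrightarrow> 0" by simp
      qed
    qed simp
    then show ?thesis by simp
  qed
  have bound: "(lnorm time (gap n))\<^sup>2 \<le> low m n + 4 * (C_apriori / \<delta>) / (real m)\<^sup>2" if m: "m > 0" for m n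
  proof -
    let ?R = "\<lambda>t. ?s m n t + (2 * vgrad2 (r n) (frozen (r n) t) + 2 * gradient_energy t) / (real m)\<^sup>2"
    have is': "integrable time (?s m n)" by (rule integrable_const_bound[OF bds ms])
    have iR: "integrable time ?R" using is' vgrad2_frozen(1)[of "r n"] gradient_energy_integral(1) by simp
    have "(lnorm time (gap n))\<^sup>2 \<le> (LINT t|time. ?R t)"
      unfolding lnorm_power2[of time]
    proof (rule integral_mono_AE[OF sq_integrableD(2)[OF gap_sq] iR])
      show "AE t in time. (gap n t)\<^sup>2 \<le> ?R t"
        using finite_gradient_AE AE_space by eventually_elim (use gap_le[OF _ _ m] in auto)
    qed
    also have "\<dots> = low m n + (2 * (LINT t|time. vgrad2 (r n) (frozen (r n) t)) + 2 * (LINT t|time. gradient_energy t)) / (real m)\<^sup>2"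
      using is' vgrad2_frozen(1)[of "r n"] gradient_energy_integral(1) by (simp add: low_def)
    also have "\<dots> \<le> low m n + (2 * (C_apriori / \<delta>) + 2 * (C_apriori / \<delta>)) / (real m)\<^sup>2"
      using vgrad2_frozen(2)[of "r n"] lebesgue_on_interval_integral(1)[OF vgrad2_frozen(1)[of "r n"], of 0 T] gradient_energy_integral(2)
      by (intro add_left_mono divide_right_mono) auto
    finally show ?thesis by simp
  qed
  have "(\<lambda>n. (lnorm time (gap n))\<^sup>2) \<longlonglongrightarrow> 0"
  proof (rule LIMSEQ_I)
    fix e :: real assume e: "e > 0"
    have "(\<lambda>m. 4 * (C_apriori / \<delta>) * (inverse (real (Suc m)))\<^sup>2) \<longlonglongrightarrow> 4 * (C_apriori / \<delta>) * 0\<^sup>2"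
      by (intro tendsto_intros LIMSEQ_inverse_real_of_nat)
    then have "\<forall>\<^sub>F m in sequentially. 4 * (C_apriori / \<delta>) * (inverse (real (Suc m)))\<^sup>2 < e / 2"
      by (rule order_tendstoD(2)) (use e in simp)
    then obtain m where "4 * (C_apriori / \<delta>) * (inverse (real (Suc m)))\<^sup>2 < e / 2" by (auto simp: eventually_sequentially)
    then have m: "4 * (C_apriori / \<delta>) / (real (Suc m))\<^sup>2 < e / 2"
      by (simp only: divide_inverse[of _ "(real (Suc m))\<^sup>2"] power_inverse)
    have "\<forall>\<^sub>F n in sequentially. low (Suc m) n < e / 2"
      by (rule order_tendstoD(2)[OF low_lim]) (use e in simp)
    then obtain N where N: "\<And>n. n \<ge> N \<Longrightarrow> low (Suc m) n < e / 2" by (auto simp: eventually_sequentially)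
    show "\<exists>N. \<forall>n\<ge>N. norm ((lnorm time (gap n))\<^sup>2 - 0) < e"
    proof (intro exI[of _ N] allI impI)
      fix n assume "n \<ge> N"
      from N[OF this] bound[of "Suc m" n] m have "(lnorm time (gap n))\<^sup>2 < e" by linarith
      then show "norm ((lnorm time (gap n))\<^sup>2 - 0) < e" by simp
    qed
  qed
  from tendsto_real_sqrt[OF this] show ?thesis by (simp only: real_sqrt_abs abs_of_nonneg[OF lnorm_nonneg] real_sqrt_zero)
qed

end

section \<open>Passage to the limit in the equation\<close>

lemma fourier_measurable_nemytskii:
  fixes N :: "'p::{metric_space, second_countable_topology} \<Rightarrow> (real^'d \<Rightarrow> real) \<Rightarrow> (real^'d \<Rightarrow> real)"
  assumes X: "fourier_measurable M X" and q: "q \<in> borel_measurable M"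
    and sq: "\<And>p w. sq_integrable torus w \<Longrightarrow> sq_integrable torus (N p w)"
    and cont: "\<And>p w pn wn. pn \<longlonglongrightarrow> p \<Longrightarrow> sq_integrable torus w \<Longrightarrow> (\<And>n. sq_integrable torus (wn n)) \<Longrightarrow>
      (\<lambda>n. lnorm torus (\<lambda>x. wn n x - w x)) \<longlonglongrightarrow> 0 \<Longrightarrow> (\<lambda>n. lnorm torus (\<lambda>x. N (pn n) (wn n) x - N p w x)) \<longlonglongrightarrow> 0"
  shows "fourier_measurable M (\<lambda>t. N (q t) (X t))"
  unfolding fourier_measurable_def
proof (intro conjI ballI allI)
  show "sq_integrable torus (N (q t) (X t))" if "t \<in> space M" for t
    by (rule sq[OF fourier_measurableD(1)[OF X that]])
  show "(\<lambda>t. fourier_coeff (N (q t) (X t)) \<kappa>) \<in> borel_measurable M" for \<kappa>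
  proof (rule fourier_measurable_functional[OF X q, where F="\<lambda>p w. fourier_coeff (N p w) \<kappa>"])
    fix p :: 'p and w :: "real^'d \<Rightarrow> real" and pn wn
    assume a: "pn \<longlonglongrightarrow> p" "sq_integrable torus w" "\<And>n. sq_integrable torus (wn n)" "(\<lambda>n. lnorm torus (\<lambda>x. wn n x - w x)) \<longlonglongrightarrow> 0"
    have "(\<lambda>n. fourier_coeff (N (pn n) (wn n)) \<kappa> - fourier_coeff (N p w) \<kappa>) \<longlonglongrightarrow> 0"
    proof (rule Lim_null_comparison[OF _ cont[OF a]], rule always_eventually, rule allI)
      show "norm (fourier_coeff (N (pn n) (wn n)) \<kappa> - fourier_coeff (N p w) \<kappa>) \<le> lnorm torus (\<lambda>x. N (pn n) (wn n) x - N p w x)" for n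
        using abs_fourier_coeff_le[OF sq_integrable_diff[OF sq[OF a(3)] sq[OF a(2)]], of "pn n" n p \<kappa>]
        by (simp add: fourier_coeff_diff[OF sq[OF a(3)] sq[OF a(2)]])
    qed
    then show "(\<lambda>n. fourier_coeff (N (pn n) (wn n)) \<kappa>) \<longlonglongrightarrow> fourier_coeff (N p w) \<kappa>" by (rule LIM_zero_cancel)
  qed
qed

lemma abs_sum_fourier_coeff_le:
  assumes "finite F" "sq_integrable torus f" "sq_integrable torus g"
  shows "(\<Sum>\<kappa>\<in>F. \<bar>fourier_coeff f \<kappa> * fourier_coeff g \<kappa>\<bar>) \<le> lnorm torus f * lnorm torus g"
proof -
  have "(\<Sum>\<kappa>\<in>F. \<bar>fourier_coeff f \<kappa>\<bar> * \<bar>fourier_coeff g \<kappa>\<bar>) \<le> L2_set (fourier_coeff f) F * L2_set (fourier_coeff g) F" by (rule L2_set_mult_ineq)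
  also have "\<dots> \<le> lnorm torus f * lnorm torus g"
    unfolding L2_set_def using Bessel[OF assms(1,2)] Bessel[OF assms(1,3)]
    by (intro mult_mono real_le_lsqrt) (auto intro: sum_nonneg)
  finally show ?thesis by (simp add: abs_mult)
qed

lemma abs_sum_fourier_coeff_prod_le:
  assumes "finite F" "sq_integrable torus f" "sq_integrable torus g"
  shows "\<bar>\<Sum>\<kappa>\<in>F. fourier_coeff f \<kappa> * fourier_coeff g \<kappa>\<bar> \<le> lnorm torus f * lnorm torus g"
  using sum_abs[of "\<lambda>\<kappa>. fourier_coeff f \<kappa> * fourier_coeff g \<kappa>" F] abs_sum_fourier_coeff_le[OF assms] by linarith

text \<open>The difference of squares telescopes over a mesh into the integral of f against the sum of the
  two neighbouring mesh values of F; the mesh size tends to zero.\<close>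

lemma square_of_indefinite_integral:
  fixes f F :: "real \<Rightarrow> real"
  assumes f: "integrable (lebesgue_on {0..T}) f" and t: "0 \<le> t" "t \<le> T"
    and F: "\<And>s. s \<in> {0..T} \<Longrightarrow> F s = F 0 + integral {0..s} f"
  shows "(F t)\<^sup>2 = (F 0)\<^sup>2 + 2 * integral {0..t} (\<lambda>s. F s * f s)"
proof (cases "t = 0")
  case True then show ?thesis by simp
next
  case False
  then have tpos: "t > 0" using t by simp
  define \<tau> where "\<tau> N = t / real (Suc N)" for N
  have \<tau>: "\<tau> N > 0" "real (Suc N) * \<tau> N = t" for N using tpos by (auto simp: \<tau>_def)
  have fi: "f integrable_on {p..q}" if "0 \<le> p" "q \<le> T" for p q
    by (rule lebesgue_on_interval_integral(2)[OF f that])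
  have Fcont: "continuous_on {0..t} F"
  proof -
    have "continuous_on {0..t} (\<lambda>s. F 0 + integral {0..s} f)"
      using t by (intro continuous_intros indefinite_integral_continuous_1 fi) auto
    then show ?thesis
    proof (rule continuous_on_eq)
      fix s assume "s \<in> {0..t}"
      then have "s \<in> {0..T}" using t by simp
      then show "F 0 + integral {0..s} f = F s" by (rule F[symmetric])
    qed
  qed
  then have "bounded (F ` {0..t})" by (intro compact_imp_bounded compact_continuous_image) auto
  then obtain K where "\<forall>y\<in>F ` {0..t}. norm y \<le> K" unfolding bounded_iff by blast
  then have K: "\<bar>F s\<bar> \<le> K" if "s \<in> {0..t}" for s using that by simp
  define lo where "lo N s = real (cell (\<tau> N) s) * \<tau> N" for N s
  \<comment> \<open>The minimum keeps the right end point \<open>s = t\<close>, which opens a new cell, inside the interval.\<close>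
  define hi where "hi N s = min t ((real (cell (\<tau> N) s) + 1) * \<tau> N)" for N s
  have lohi: "lo N s \<in> {0..t}" "hi N s \<in> {0..t}" "\<bar>lo N s - s\<bar> \<le> \<tau> N" "\<bar>hi N s - s\<bar> \<le> \<tau> N" if s: "s \<in> {0..t}" for N s
  proof -
    have "lo N s \<le> s" "s < (real (cell (\<tau> N) s) + 1) * \<tau> N" "(real (cell (\<tau> N) s) + 1) * \<tau> N = lo N s + \<tau> N" "0 \<le> lo N s"
      unfolding lo_def using cell_bounds[OF \<tau>(1)[of N], of s] s \<tau>(1)[of N] by (auto simp: algebra_simps)
    then show "lo N s \<in> {0..t}" "hi N s \<in> {0..t}" "\<bar>lo N s - s\<bar> \<le> \<tau> N" "\<bar>hi N s - s\<bar> \<le> \<tau> N"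
      using s \<tau>(1)[of N] unfolding hi_def by auto
  qed
  define P where "P N s = f s * (F (lo N s) + F (hi N s))" for N s
  have Pint: "(P N has_integral (F t)\<^sup>2 - (F 0)\<^sup>2) {0..t}" for N
  proof -
    let ?G = "\<lambda>i s. f s * (F (real i * \<tau> N) + F (min t ((real i + 1) * \<tau> N)))"
    have cellint: "?G i integrable_on {real i * \<tau> N..(real i + 1) * \<tau> N}
        \<and> integral {real i * \<tau> N..(real i + 1) * \<tau> N} (?G i) = (F (real (Suc i) * \<tau> N))\<^sup>2 - (F (real i * \<tau> N))\<^sup>2" if i: "i < Suc N" for i
    proof -
      let ?p = "real i * \<tau> N" and ?q = "(real i + 1) * \<tau> N"
      have "real (Suc i) * \<tau> N \<le> real (Suc N) * \<tau> N" using i \<tau>(1)[of N] by (intro mult_right_mono) auto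
      then have q: "?q \<le> t" using \<tau>(2)[of N] by (simp add: add.commute)
      have p: "0 \<le> ?p" "?p \<le> ?q" using \<tau>(1)[of N] by (auto simp: algebra_simps)
      have pq: "f integrable_on {?p..?q}" "f integrable_on {0..?q}" using p q t by (auto intro!: fi)
      have "F ?p = F 0 + integral {0..?p} f" "F ?q = F 0 + integral {0..?q} f"
        by (rule F, use p q t in simp)+
      moreover have "integral {0..?p} f + integral {?p..?q} f = integral {0..?q} f"
        by (rule Henstock_Kurzweil_Integration.integral_combine[OF p pq(2)])
      ultimately have "F ?q - F ?p = integral {?p..?q} f" by linarith
      then have "integral {?p..?q} (?G i) = (F ?q - F ?p) * (F ?p + F ?q)"
        using q by (simp add: min_absorb2)
      moreover have "?G i integrable_on {?p..?q}" by (rule integrable_on_mult_left[OF pq(1)])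
      ultimately show ?thesis by (simp add: power2_eq_square algebra_simps)
    qed
    have "((\<lambda>s. ?G (cell (\<tau> N) s) s) has_integral (\<Sum>i<Suc N. integral {real i * \<tau> N..(real i + 1) * \<tau> N} (?G i))) {0..real (Suc N) * \<tau> N}"
      by (rule has_integral_cells[OF \<tau>(1), of "Suc N" ?G]) (use cellint in blast)
    moreover have "(\<Sum>i<Suc N. integral {real i * \<tau> N..(real i + 1) * \<tau> N} (?G i)) = (\<Sum>i<Suc N. (F (real (Suc i) * \<tau> N))\<^sup>2 - (F (real i * \<tau> N))\<^sup>2)"
      by (rule sum.cong) (use cellint in auto)
    moreover have "\<dots> = (F (real (Suc N) * \<tau> N))\<^sup>2 - (F (real 0 * \<tau> N))\<^sup>2"
      by (rule sum_lessThan_telescope)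
    ultimately show ?thesis unfolding \<tau>(2) P_def[abs_def] lo_def hi_def by simp
  qed
  have f1: "integrable (lebesgue_on {0..t}) f" by (rule integrable_lebesgue_on_subinterval[OF f order_refl t(2)])
  have absf: "(\<lambda>s. 2 * K * \<bar>f s\<bar>) integrable_on {0..t}"
    using integrable_on_lebesgue_on[of "{0..t}" "\<lambda>s. 2 * K * \<bar>f s\<bar>"] f1 by simp
  have "(\<lambda>N. integral {0..t} (P N)) \<longlonglongrightarrow> integral {0..t} (\<lambda>s. f s * (F s + F s))"
  proof (rule dominated_convergence(2)[OF _ absf])
    show "P N integrable_on {0..t}" for N using Pint by (auto simp: integrable_on_def)
    fix s assume s: "s \<in> {0..t}"
    show "norm (P N s) \<le> 2 * K * \<bar>f s\<bar>" for N
    proof -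
      have "\<bar>F (lo N s) + F (hi N s)\<bar> \<le> 2 * K" using K[OF lohi(1)[OF s, of N]] K[OF lohi(2)[OF s, of N]] by linarith
      then have "\<bar>f s\<bar> * \<bar>F (lo N s) + F (hi N s)\<bar> \<le> \<bar>f s\<bar> * (2 * K)" by (rule mult_left_mono) simp
      then show ?thesis by (simp add: P_def abs_mult mult_ac)
    qed
    have \<tau>0: "\<tau> \<longlonglongrightarrow> 0"
      using tendsto_mult[OF tendsto_const[of t] LIMSEQ_inverse_real_of_nat] by (simp add: \<tau>_def[abs_def] divide_inverse)
    have lim: "(\<lambda>N. F (g N)) \<longlonglongrightarrow> F s" if g: "\<And>N. g N \<in> {0..t}" "\<And>N. \<bar>g N - s\<bar> \<le> \<tau> N" for g
    proof (rule continuous_on_tendsto_compose[OF Fcont _ s])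
      have "(\<lambda>N. g N - s) \<longlonglongrightarrow> 0" by (rule Lim_null_comparison[OF _ \<tau>0]) (use g(2) in auto)
      then show "g \<longlonglongrightarrow> s" by (rule LIM_zero_cancel)
    qed (use g(1) in auto)
    show "(\<lambda>N. P N s) \<longlonglongrightarrow> f s * (F s + F s)"
      unfolding P_def by (intro tendsto_intros lim lohi s)
  qed
  then have "(\<lambda>N. (F t)\<^sup>2 - (F 0)\<^sup>2) \<longlonglongrightarrow> integral {0..t} (\<lambda>s. 2 * (F s * f s))"
    using integral_unique[OF Pint] by (simp add: algebra_simps)
  then have "(F t)\<^sup>2 - (F 0)\<^sup>2 = integral {0..t} (\<lambda>s. 2 * (F s * f s))" by (simp add: LIMSEQ_const_iff)
  then show ?thesis by simp
qed

context quasilinear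
begin

lemma lipschitz_sequence:
  assumes "(\<lambda>n. lnorm torus (\<lambda>x. wn n x - w x)) \<longlonglongrightarrow> 0" "\<And>n. y n \<le> C * lnorm torus (\<lambda>x. wn n x - w x)" "\<And>n. 0 \<le> y n"
  shows "y \<longlonglongrightarrow> 0"
proof (rule Lim_null_comparison)
  show "\<forall>\<^sub>F n in sequentially. norm (y n) \<le> C * lnorm torus (\<lambda>x. wn n x - w x)" using assms by auto
  show "(\<lambda>n. C * lnorm torus (\<lambda>x. wn n x - w x)) \<longlonglongrightarrow> 0" using tendsto_mult_left[OF assms(1), of C] by simp
qed

lemma a_hartley_lipschitz:
  assumes w: "sq_integrable torus w" and v: "sq_integrable torus v"
  shows "lnorm torus (\<lambda>x. a i j (w x) * hartley \<kappa> x - a i j (v x) * hartley \<kappa> x) \<le> 2 * L * lnorm torus (\<lambda>x. w x - v x)"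
proof -
  have "lnorm torus (\<lambda>x. a i j (w x) * hartley \<kappa> x - a i j (v x) * hartley \<kappa> x) \<le> lnorm torus (\<lambda>x. (2 * L) * (w x - v x))"
  proof (rule lnorm_mono)
    show "sq_integrable torus (\<lambda>x. (2 * L) * (w x - v x))" by (intro sq_integrable_cmult sq_integrable_diff w v)
    show "(\<lambda>x. a i j (w x) * hartley \<kappa> x - a i j (v x) * hartley \<kappa> x) \<in> borel_measurable torus"
      using a_measurable[OF w, of i j] a_measurable[OF v, of i j] by measurable
    have "\<bar>a i j (w x) * hartley \<kappa> x - a i j (v x) * hartley \<kappa> x\<bar> \<le> \<bar>2 * L * (w x - v x)\<bar>" for x
    proof -
      have "\<bar>(a i j (w x) - a i j (v x)) * hartley \<kappa> x\<bar> \<le> (L * \<bar>w x - v x\<bar>) * 2"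
        unfolding abs_mult by (intro mult_mono a_lip abs_hartley_le) (use L in auto)
      moreover have "a i j (w x) * hartley \<kappa> x - a i j (v x) * hartley \<kappa> x = (a i j (w x) - a i j (v x)) * hartley \<kappa> x"
        by (rule left_diff_distrib[symmetric])
      moreover have "\<bar>2 * L * (w x - v x)\<bar> = (L * \<bar>w x - v x\<bar>) * 2" using L by (simp add: abs_mult)
      ultimately show ?thesis by (simp only:)
    qed
    then show "AE x in torus. \<bar>a i j (w x) * hartley \<kappa> x - a i j (v x) * hartley \<kappa> x\<bar> \<le> \<bar>2 * L * (w x - v x)\<bar>" by simp
  qed
  then show ?thesis using L by (simp add: lnorm_cmult)
qed

lemma a_hartley_sq:
  assumes w: "sq_integrable torus w"
  shows "sq_integrable torus (\<lambda>x. a i j (w x) * hartley \<kappa> x)" "lnorm torus (\<lambda>x. a i j (w x) * hartley \<kappa> x) \<le> L"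
  using a_sq[OF w sq_integrable_hartley, of i j \<kappa>] by (auto simp: lnorm_hartley)

lemma b_lipschitz_lnorm:
  assumes "sq_integrable torus w" "sq_integrable torus v"
  shows "lnorm torus (\<lambda>x. b i (w x) - b i (v x)) \<le> L * lnorm torus (\<lambda>x. w x - v x)"
  by (rule nemytskii_lipschitz[OF b_lip assms])

lemma \<Theta>_lipschitz_lnorm:
  assumes "sq_integrable torus w" "sq_integrable torus v"
  shows "lnorm torus (\<lambda>x. \<Theta> p (w x) - \<Theta> p (v x)) \<le> (L * norm p) * lnorm torus (\<lambda>x. w x - v x)"
  by (rule nemytskii_lipschitz[OF \<Theta>_lip assms])

lemma fourier_measurable_b:
  fixes X :: "'a \<Rightarrow> real^'d \<Rightarrow> real"
  assumes X: "fourier_measurable M X" shows "fourier_measurable M (\<lambda>t x. b i (X t x))"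
proof (rule fourier_measurable_nemytskii[OF X, where q="\<lambda>_. 0 :: real" and N="\<lambda>p w x. b i (w x)"])
  fix p :: real and w :: "real^'d \<Rightarrow> real" and pn wn
  assume a: "sq_integrable torus w" "\<And>n. sq_integrable torus (wn n)" "(\<lambda>n. lnorm torus (\<lambda>x. wn n x - w x)) \<longlonglongrightarrow> 0"
  show "(\<lambda>n. lnorm torus (\<lambda>x. b i (wn n x) - b i (w x))) \<longlonglongrightarrow> 0"
    by (rule lipschitz_sequence[OF a(3) b_lipschitz_lnorm[OF a(2,1)]]) simp
qed (auto intro: b_sq)

lemma fourier_measurable_a_hartley:
  fixes X :: "'a \<Rightarrow> real^'d \<Rightarrow> real"
  assumes X: "fourier_measurable M X" shows "fourier_measurable M (\<lambda>t x. a i j (X t x) * hartley \<kappa> x)"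
proof (rule fourier_measurable_nemytskii[OF X, where q="\<lambda>_. 0 :: real" and N="\<lambda>p w x. a i j (w x) * hartley \<kappa> x"])
  fix p :: real and w :: "real^'d \<Rightarrow> real" and pn wn
  assume a: "sq_integrable torus w" "\<And>n. sq_integrable torus (wn n)" "(\<lambda>n. lnorm torus (\<lambda>x. wn n x - w x)) \<longlonglongrightarrow> 0"
  show "(\<lambda>n. lnorm torus (\<lambda>x. a i j (wn n x) * hartley \<kappa> x - a i j (w x) * hartley \<kappa> x)) \<longlonglongrightarrow> 0"
    by (rule lipschitz_sequence[OF a(3) a_hartley_lipschitz[OF a(2,1)]]) simp
qed (auto intro: a_hartley_sq)

lemma fourier_measurable_\<Theta>:
  fixes X :: "real \<Rightarrow> real^'d \<Rightarrow> real"
  assumes X: "fourier_measurable time X" shows "fourier_measurable time (\<lambda>t x. \<Theta> (h t) (X t x))"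
proof (rule fourier_measurable_nemytskii[OF X h_meas, where N="\<lambda>p w x. \<Theta> p (w x)"])
  fix p :: 'u and w :: "real^'d \<Rightarrow> real" and pn wn
  assume p: "pn \<longlonglongrightarrow> p" and w: "sq_integrable torus w" and wn: "\<And>n. sq_integrable torus (wn n)"
    and lim: "(\<lambda>n. lnorm torus (\<lambda>x. wn n x - w x)) \<longlonglongrightarrow> 0"
  show "(\<lambda>n. lnorm torus (\<lambda>x. \<Theta> (pn n) (wn n x) - \<Theta> p (w x))) \<longlonglongrightarrow> 0"
  proof (rule Lim_null_comparison)
    show "\<forall>\<^sub>F n in sequentially. norm (lnorm torus (\<lambda>x. \<Theta> (pn n) (wn n x) - \<Theta> p (w x)))
        \<le> (L * norm (pn n)) * lnorm torus (\<lambda>x. wn n x - w x) + (L * norm (pn n - p)) * (1 + lnorm torus w)"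
    proof (rule always_eventually, rule allI)
      fix n
      have "lnorm torus (\<lambda>x. \<Theta> (pn n) (wn n x) - \<Theta> p (w x))
          \<le> lnorm torus (\<lambda>x. \<Theta> (pn n) (wn n x) - \<Theta> (pn n) (w x)) + lnorm torus (\<lambda>x. \<Theta> (pn n) (w x) - \<Theta> p (w x))"
        by (intro lnorm_triangle \<Theta>_sq w wn)
      also have "lnorm torus (\<lambda>x. \<Theta> (pn n) (w x) - \<Theta> p (w x)) \<le> (L * norm (pn n - p)) * (1 + lnorm torus w)"
        unfolding \<Theta>_diff[symmetric] by (rule \<Theta>_sq(2)[OF w])
      finally show "norm (lnorm torus (\<lambda>x. \<Theta> (pn n) (wn n x) - \<Theta> p (w x)))
        \<le> (L * norm (pn n)) * lnorm torus (\<lambda>x. wn n x - w x) + (L * norm (pn n - p)) * (1 + lnorm torus w)"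
        using \<Theta>_lipschitz_lnorm[OF wn w, of "pn n" n] by simp
    qed
    have "(\<lambda>n. (L * norm (pn n)) * lnorm torus (\<lambda>x. wn n x - w x) + (L * norm (pn n - p)) * (1 + lnorm torus w))
        \<longlonglongrightarrow> (L * norm p) * 0 + (L * norm (p - p)) * (1 + lnorm torus w)"
      by (intro tendsto_intros p lim)
    then show "(\<lambda>n. (L * norm (pn n)) * lnorm torus (\<lambda>x. wn n x - w x) + (L * norm (pn n - p)) * (1 + lnorm torus w)) \<longlonglongrightarrow> 0" by simp
  qed
qed (auto intro: \<Theta>_sq)

lemma fourier_coeff_flux:
  assumes w: "sq_integrable torus w" and g: "\<And>j. sq_integrable torus (g j)"
  shows "fourier_coeff (flux w g i) \<kappa> = fourier_coeff (\<lambda>x. b i (w x)) \<kappa> - (\<Sum>j\<in>UNIV. ip (g j) (\<lambda>x. a i j (w x) * hartley \<kappa> x))"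
proof -
  have s: "sq_integrable torus (\<lambda>x. a i j (w x) * g j x)" for j by (intro a_sq w g)
  have "fourier_coeff (flux w g i) \<kappa> = fourier_coeff (\<lambda>x. b i (w x)) \<kappa> - (\<Sum>j\<in>UNIV. fourier_coeff (\<lambda>x. a i j (w x) * g j x) \<kappa>)"
    unfolding flux_def[abs_def] by (subst fourier_coeff_diff) (auto simp: fourier_coeff_sum s intro!: b_sq w sq_integrable_sum)
  then show ?thesis by (simp add: fourier_coeff_def mult_ac)
qed

end

context quasilinear_limit
begin

definition limit_rate :: "int^'d \<Rightarrow> real \<Rightarrow> real" where
  "limit_rate \<kappa> s = rate \<kappa> (u s) (\<lambda>i. Du i s) (h s)"

lemma flux_fourier_measurable: "fourier_measurable time (\<lambda>s. flux (u s) (\<lambda>j. Du j s) i)"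
  unfolding fourier_measurable_def
proof (intro conjI ballI allI)
  show "sq_integrable torus (flux (u s) (\<lambda>j. Du j s) i)" if "s \<in> space time" for s
    using that by (intro flux_sq u_props Du_sq) auto
  show "(\<lambda>s. fourier_coeff (flux (u s) (\<lambda>j. Du j s) i) \<kappa>) \<in> borel_measurable time" for \<kappa>
  proof (subst measurable_cong)
    show "fourier_coeff (flux (u s) (\<lambda>j. Du j s) i) \<kappa> = fourier_coeff (\<lambda>x. b i (u s x)) \<kappa> - (\<Sum>j\<in>UNIV. ip (Du j s) (\<lambda>x. a i j (u s x) * hartley \<kappa> x))"
      if "s \<in> space time" for s using that by (intro fourier_coeff_flux u_props Du_sq) auto
    show "(\<lambda>s. fourier_coeff (\<lambda>x. b i (u s x)) \<kappa> - (\<Sum>j\<in>UNIV. ip (Du j s) (\<lambda>x. a i j (u s x) * hartley \<kappa> x))) \<in> borel_measurable time"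
      by (intro borel_measurable_diff borel_measurable_sum fourier_measurable_ip fourier_measurable_a_hartley
          Du_fourier_measurable u_fourier_measurable fourier_measurableD(2)[OF fourier_measurable_b[OF u_fourier_measurable]])
  qed
qed

lemmas \<Theta>_fourier_measurable = fourier_measurable_\<Theta>[OF u_fourier_measurable]

lemma limit_rate_measurable: "limit_rate \<kappa> \<in> borel_measurable time"
  unfolding limit_rate_def[abs_def] rate_def
  using fourier_measurableD(2)[OF flux_fourier_measurable] fourier_measurableD(2)[OF \<Theta>_fourier_measurable]
  by measurable

lemma u_lnorm_le: "t \<in> {0..T} \<Longrightarrow> lnorm torus (u t) \<le> sqrt C_apriori"
  using u_lnorm by (simp add: real_le_rsqrt)

lemma norm_h_sq: "sq_integrable time (\<lambda>t. norm (h t))"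
  using h_meas h_sq by (simp add: sq_integrable_def)

lemma flux_time:
  "sq_integrable time (\<lambda>s. lnorm torus (flux (u s) (\<lambda>j. Du j s) i))"
proof (rule sq_integrable_bound)
  show "sq_integrable time (\<lambda>s. L * (1 + sqrt C_apriori + (\<Sum>j\<in>UNIV. lnorm torus (Du j s))))"
    by (intro sq_integrable_cmult sq_integrable_add sq_integrable_sum Du_time sq_integrable_of_bounded[OF finite_measure_time, where C="1 + sqrt C_apriori"])
       (auto simp: C_apriori_pos)
  show "(\<lambda>s. lnorm torus (flux (u s) (\<lambda>j. Du j s) i)) \<in> borel_measurable time"
    by (rule fourier_measurable_lnorm[OF flux_fourier_measurable])
  show "AE s in time. \<bar>lnorm torus (flux (u s) (\<lambda>j. Du j s) i)\<bar> \<le> \<bar>L * (1 + sqrt C_apriori + (\<Sum>j\<in>UNIV. lnorm torus (Du j s)))\<bar>"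
  proof (rule AE_I2)
    fix s assume "s \<in> space time"
    then have s: "s \<in> {0..T}" by simp
    have "lnorm torus (flux (u s) (\<lambda>j. Du j s) i) \<le> L * (1 + lnorm torus (u s) + (\<Sum>j\<in>UNIV. lnorm torus (Du j s)))"
      by (intro flux_sq u_props Du_sq s)
    also have "\<dots> \<le> L * (1 + sqrt C_apriori + (\<Sum>j\<in>UNIV. lnorm torus (Du j s)))"
      using u_lnorm_le[OF s] L by (intro mult_left_mono) auto
    finally show "\<bar>lnorm torus (flux (u s) (\<lambda>j. Du j s) i)\<bar> \<le> \<bar>L * (1 + sqrt C_apriori + (\<Sum>j\<in>UNIV. lnorm torus (Du j s)))\<bar>"
      by simp
  qed
qed

lemma \<Theta>_time: "sq_integrable time (\<lambda>s. lnorm torus (\<lambda>x. \<Theta> (h s) (u s x)))"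
proof (rule sq_integrable_bound)
  show "sq_integrable time (\<lambda>s. L * (1 + sqrt C_apriori) * norm (h s))" by (intro sq_integrable_cmult norm_h_sq)
  show "(\<lambda>s. lnorm torus (\<lambda>x. \<Theta> (h s) (u s x))) \<in> borel_measurable time"
    by (rule fourier_measurable_lnorm[OF \<Theta>_fourier_measurable])
  show "AE s in time. \<bar>lnorm torus (\<lambda>x. \<Theta> (h s) (u s x))\<bar> \<le> \<bar>L * (1 + sqrt C_apriori) * norm (h s)\<bar>"
  proof (rule AE_I2)
    fix s assume "s \<in> space time"
    then have s: "s \<in> {0..T}" by simp
    have "lnorm torus (\<lambda>x. \<Theta> (h s) (u s x)) \<le> L * norm (h s) * (1 + lnorm torus (u s))"
      by (intro \<Theta>_sq u_props s)
    also have "\<dots> \<le> L * norm (h s) * (1 + sqrt C_apriori)"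
      using u_lnorm_le[OF s] L by (intro mult_left_mono) auto
    finally show "\<bar>lnorm torus (\<lambda>x. \<Theta> (h s) (u s x))\<bar> \<le> \<bar>L * (1 + sqrt C_apriori) * norm (h s)\<bar>"
      by (simp add: mult_ac)
  qed
qed

lemma limit_rate_integrable: "integrable time (limit_rate \<kappa>)"
proof (rule Bochner_Integration.integrable_bound)
  let ?B = "\<lambda>s. (\<Sum>i\<in>UNIV. \<bar>freq \<kappa> i\<bar> * lnorm torus (flux (u s) (\<lambda>j. Du j s) i)) + lnorm torus (\<lambda>x. \<Theta> (h s) (u s x))"
  show "integrable time ?B"
    by (intro Bochner_Integration.integrable_add Bochner_Integration.integrable_sum integrable_mult_right
        sq_integrable_imp_integrable[OF finite_measure_time] flux_time \<Theta>_time)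
  show "AE s in time. norm (limit_rate \<kappa> s) \<le> norm (?B s)"
  proof (rule AE_I2)
    fix s assume "s \<in> space time"
    then have s: "s \<in> {0..T}" by simp
    have f: "\<bar>fourier_coeff (flux (u s) (\<lambda>j. Du j s) i) (- \<kappa>)\<bar> \<le> lnorm torus (flux (u s) (\<lambda>j. Du j s) i)" for i
      by (intro abs_fourier_coeff_le flux_sq u_props Du_sq s)
    have "\<bar>limit_rate \<kappa> s\<bar> \<le> (\<Sum>i\<in>UNIV. \<bar>freq \<kappa> i * fourier_coeff (flux (u s) (\<lambda>j. Du j s) i) (- \<kappa>)\<bar>) + \<bar>fourier_coeff (\<lambda>x. \<Theta> (h s) (u s x)) \<kappa>\<bar>"
      unfolding limit_rate_def rate_def by (intro order_trans[OF abs_triangle_ineq] add_mono sum_abs) simp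
    also have "\<dots> \<le> ?B s"
      unfolding abs_mult by (intro add_mono sum_mono mult_left_mono f abs_fourier_coeff_le \<Theta>_sq u_props s) auto
    finally show "norm (limit_rate \<kappa> s) \<le> norm (?B s)" by simp
  qed
qed (rule limit_rate_measurable)

text \<open>The weak factor is the gradient, and the strong factor is the coefficient times the Hartley function.\<close>

lemma diffusion_L1:
  "(\<lambda>n. LINT s|time. \<bar>ip (galerkin_grad n j s) (\<lambda>x. a i j (galerkin_fn n s x) * hartley \<kappa> x) - ip (Du j s) (\<lambda>x. a i j (u s x) * hartley \<kappa> x)\<bar>) \<longlonglongrightarrow> 0"
proof (rule weak_strong_convergence[where C="sqrt (C_apriori / \<delta>)" and D=L and \<beta>="\<lambda>\<mu>. \<bar>freq \<mu> j\<bar> * sqrt C_apriori"])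
  let ?Z = "\<lambda>n s. lnorm torus (\<lambda>x. a i j (galerkin_fn n s x) * hartley \<kappa> x - a i j (u s x) * hartley \<kappa> x)"
  have le: "?Z n s \<le> 2 * L * gap n s" if "s \<in> {0..T}" for n s
    by (intro a_hartley_lipschitz sq_galerkin_fn u_props that)
  have m: "?Z n \<in> borel_measurable time" for n
    by (intro fourier_measurable_lnorm fourier_measurable_diff fourier_measurable_a_hartley galerkin_fn_fourier_measurable u_fourier_measurable)
  have sg: "sq_integrable time (\<lambda>s. 2 * L * gap n s)" for n by (intro sq_integrable_cmult gap_sq)
  have leAE: "AE s in time. \<bar>?Z n s\<bar> \<le> \<bar>2 * L * gap n s\<bar>" for n
  proof (rule AE_I2)
    fix s assume "s \<in> space time"
    then show "\<bar>?Z n s\<bar> \<le> \<bar>2 * L * gap n s\<bar>" using le[of s n] by simp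
  qed
  show "sq_integrable time (?Z n)" for n by (rule sq_integrable_bound[OF sg m leAE])
  show "(\<lambda>n. lnorm time (?Z n)) \<longlonglongrightarrow> 0"
  proof (rule Lim_null_comparison)
    show "\<forall>\<^sub>F n in sequentially. norm (lnorm time (?Z n)) \<le> 2 * L * lnorm time (gap n)"
    proof (rule always_eventually, rule allI)
      fix n
      show "norm (lnorm time (?Z n)) \<le> 2 * L * lnorm time (gap n)"
        using lnorm_mono[OF sg m leAE] L by (simp add: lnorm_cmult)
    qed
    show "(\<lambda>n. 2 * L * lnorm time (gap n)) \<longlonglongrightarrow> 0" using tendsto_mult_left[OF gap_tendsto, of "2 * L"] by simp
  qed
  show "AE s in time. (\<lambda>n. fourier_coeff (galerkin_grad n j s) \<mu>) \<longlonglongrightarrow> fourier_coeff (Du j s) \<mu>" for \<mu>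
    using finite_gradient_AE AE_space
  proof eventually_elim
    case (elim s)
    then show ?case unfolding fourier_coeff_galerkin_grad by (simp add: fourier_coeff_Du dcoef_def) (intro tendsto_intros wcoef_lim, simp)
  qed
  show "\<bar>fourier_coeff (galerkin_grad n j s) \<mu>\<bar> \<le> \<bar>freq \<mu> j\<bar> * sqrt C_apriori" if "s \<in> space time" for n s \<mu>
    unfolding fourier_coeff_galerkin_grad dcoef_def abs_mult
    using square_le_of_sum(1)[of "wcoef n s" C_apriori "- \<mu>", OF wcoef_bound] that by (simp add: mult_left_mono)
  show "\<bar>fourier_coeff (Du j s) \<mu>\<bar> \<le> \<bar>freq \<mu> j\<bar> * sqrt C_apriori" if "s \<in> space time" for s \<mu>
    using square_le_of_sum(1)[of "\<lambda>\<kappa>. c \<kappa> s" C_apriori "- \<mu>", OF c_bound] that C_apriori_pos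
    by (simp add: fourier_coeff_Du dcoef_def abs_mult mult_left_mono)
  show "lnorm torus (\<lambda>x. a i j (u s x) * hartley \<kappa> x) \<le> L" if "s \<in> space time" for s
    using that by (intro a_hartley_sq u_props) auto
qed (intro finite_measure_time galerkin_fn_fourier_measurable Du_fourier_measurable fourier_measurable_a_hartley u_fourier_measurable galerkin_grad_time Du_time)+

lemma gap_L1:
  assumes y: "sq_integrable time y"
  shows "(\<lambda>n. LINT s|time. \<bar>y s\<bar> * gap n s) \<longlonglongrightarrow> 0"
proof (rule Lim_null_comparison)
  show "\<forall>\<^sub>F n in sequentially. norm (LINT s|time. \<bar>y s\<bar> * gap n s) \<le> lnorm time y * lnorm time (gap n)"
  proof (rule always_eventually, rule allI)
    show "norm (LINT s|time. \<bar>y s\<bar> * gap n s) \<le> lnorm time y * lnorm time (gap n)" for n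
      using Cauchy_Schwarz_lnorm[OF sq_integrable_abs[OF y] gap_sq[of n]] by simp
  qed
  show "(\<lambda>n. lnorm time y * lnorm time (gap n)) \<longlonglongrightarrow> 0" using tendsto_mult_left[OF gap_tendsto, of "lnorm time y"] by simp
qed

lemma rate_L1: "(\<lambda>n. LINT s|time. \<bar>galerkin_rate (r n) \<kappa> (frozen (r n) s) s - limit_rate \<kappa> s\<bar>) \<longlonglongrightarrow> 0"
proof -
  define d where "d n i j s = \<bar>ip (galerkin_grad n j s) (\<lambda>x. a i j (galerkin_fn n s x) * hartley (- \<kappa>) x) - ip (Du j s) (\<lambda>x. a i j (u s x) * hartley (- \<kappa>) x)\<bar>" for n i j s
  define R where "R n s = (\<Sum>i\<in>UNIV. \<bar>freq \<kappa> i\<bar> * (L * gap n s + (\<Sum>j\<in>UNIV. d n i j s))) + L * (\<bar>norm (h s)\<bar> * gap n s)" for n s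
  have one: "sq_integrable time (\<lambda>s. 1)" by (rule sq_integrable_of_bounded[OF finite_measure_time, where C=1]) auto
  have i1: "integrable time (\<lambda>s. gap n s)" for n
    by (rule sq_integrable_imp_integrable[OF finite_measure_time gap_sq])
  have i2: "integrable time (\<lambda>s. \<bar>norm (h s)\<bar> * gap n s)" for n
    using sq_integrable_mult[OF norm_h_sq gap_sq[of n]] by simp
  have l1: "(\<lambda>n. LINT s|time. gap n s) \<longlonglongrightarrow> 0" using gap_L1[OF one] by simp
  have iip: "integrable time (\<lambda>s. ip (g s) (\<lambda>x. a i j (w s x) * hartley \<mu> x))"
    if g: "fourier_measurable time g" "sq_integrable time (\<lambda>s. lnorm torus (g s))" and w: "fourier_measurable time w"
    for g w :: "real \<Rightarrow> real^'d \<Rightarrow> real" and i j \<mu>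
  proof (rule Bochner_Integration.integrable_bound)
    show "integrable time (\<lambda>s. L * lnorm torus (g s))"
      by (intro integrable_mult_right sq_integrable_imp_integrable[OF finite_measure_time g(2)])
    show "(\<lambda>s. ip (g s) (\<lambda>x. a i j (w s x) * hartley \<mu> x)) \<in> borel_measurable time"
      by (intro fourier_measurable_ip g fourier_measurable_a_hartley w)
    show "AE s in time. norm (ip (g s) (\<lambda>x. a i j (w s x) * hartley \<mu> x)) \<le> norm (L * lnorm torus (g s))"
    proof (rule AE_I2)
      fix s assume s: "s \<in> space time"
      note a = a_hartley_sq[OF fourier_measurableD(1)[OF w s], of i j \<mu>]
      have "\<bar>ip (g s) (\<lambda>x. a i j (w s x) * hartley \<mu> x)\<bar> \<le> lnorm torus (g s) * lnorm torus (\<lambda>x. a i j (w s x) * hartley \<mu> x)"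
        by (rule Cauchy_Schwarz_lnorm[OF fourier_measurableD(1)[OF g(1) s] a(1)])
      also have "\<dots> \<le> lnorm torus (g s) * L" by (intro mult_left_mono a) simp
      finally show "norm (ip (g s) (\<lambda>x. a i j (w s x) * hartley \<mu> x)) \<le> norm (L * lnorm torus (g s))" using L by (simp add: mult.commute)
    qed
  qed
  have id: "integrable time (d n i j)" for n i j
    unfolding d_def[abs_def] by (intro integrable_abs Bochner_Integration.integrable_diff iip galerkin_fn_fourier_measurable galerkin_grad_time Du_fourier_measurable Du_time u_fourier_measurable)
  have iR: "integrable time (R n)" for n
    unfolding R_def[abs_def] by (intro Bochner_Integration.integrable_add Bochner_Integration.integrable_sum integrable_mult_right i1 i2 id)
  have ev: "\<forall>\<^sub>F n in sequentially. norm (LINT s|time. \<bar>galerkin_rate (r n) \<kappa> (frozen (r n) s) s - limit_rate \<kappa> s\<bar>) \<le> (LINT s|time. R n s)"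
  proof (rule always_eventually, rule allI)
    fix n
    have "(LINT s|time. \<bar>galerkin_rate (r n) \<kappa> (frozen (r n) s) s - limit_rate \<kappa> s\<bar>) \<le> (LINT s|time. R n s)"
    proof (rule integral_mono[OF _ iR])
      show "integrable time (\<lambda>s. \<bar>galerkin_rate (r n) \<kappa> (frozen (r n) s) s - limit_rate \<kappa> s\<bar>)"
        by (intro integrable_abs Bochner_Integration.integrable_diff frozen_rate_integrable limit_rate_integrable)
      fix s assume "s \<in> space time"
      then have s: "s \<in> {0..T}" by simp
      note us = u_props(1)[OF s] and Ds = Du_sq[OF s]
      have g: "galerkin_rate (r n) \<kappa> (frozen (r n) s) s = rate \<kappa> (galerkin_fn n s) (\<lambda>i. galerkin_grad n i s) (h s)"
        by (simp add: galerkin_rate_def galerkin_fn_def galerkin_grad_def)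
      have fl: "\<bar>fourier_coeff (flux (galerkin_fn n s) (\<lambda>i. galerkin_grad n i s) i) (- \<kappa>) - fourier_coeff (flux (u s) (\<lambda>i. Du i s) i) (- \<kappa>)\<bar> \<le> L * gap n s + (\<Sum>j\<in>UNIV. d n i j s)" for i
      proof -
        have "\<bar>fourier_coeff (\<lambda>x. b i (galerkin_fn n s x)) (- \<kappa>) - fourier_coeff (\<lambda>x. b i (u s x)) (- \<kappa>)\<bar> \<le> L * gap n s"
          unfolding fourier_coeff_diff[OF b_sq(1)[OF sq_galerkin_fn] b_sq(1)[OF us], symmetric]
          by (rule order_trans[OF abs_fourier_coeff_le b_lipschitz_lnorm]) (intro sq_integrable_diff b_sq us sq_galerkin_fn)+
        moreover have "\<bar>(\<Sum>j\<in>UNIV. ip (galerkin_grad n j s) (\<lambda>x. a i j (galerkin_fn n s x) * hartley (- \<kappa>) x)) - (\<Sum>j\<in>UNIV. ip (Du j s) (\<lambda>x. a i j (u s x) * hartley (- \<kappa>) x))\<bar> \<le> (\<Sum>j\<in>UNIV. d n i j s)"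
          unfolding sum_subtractf[symmetric] d_def by (rule sum_abs)
        ultimately show ?thesis
          unfolding fourier_coeff_flux[OF sq_galerkin_fn sq_galerkin_grad] fourier_coeff_flux[OF us Ds] by linarith
      qed
      have th: "\<bar>fourier_coeff (\<lambda>x. \<Theta> (h s) (galerkin_fn n s x)) \<kappa> - fourier_coeff (\<lambda>x. \<Theta> (h s) (u s x)) \<kappa>\<bar> \<le> L * (\<bar>norm (h s)\<bar> * gap n s)"
        unfolding fourier_coeff_diff[OF \<Theta>_sq(1)[OF sq_galerkin_fn] \<Theta>_sq(1)[OF us], symmetric]
        using order_trans[OF abs_fourier_coeff_le[OF sq_integrable_diff[OF \<Theta>_sq(1)[OF sq_galerkin_fn] \<Theta>_sq(1)[OF us]]] \<Theta>_lipschitz_lnorm[OF sq_galerkin_fn us]]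
        by (simp add: mult_ac)
      have eq: "galerkin_rate (r n) \<kappa> (frozen (r n) s) s - limit_rate \<kappa> s
          = (\<Sum>i\<in>UNIV. freq \<kappa> i * (fourier_coeff (flux (galerkin_fn n s) (\<lambda>i. galerkin_grad n i s) i) (- \<kappa>) - fourier_coeff (flux (u s) (\<lambda>i. Du i s) i) (- \<kappa>)))
            + (fourier_coeff (\<lambda>x. \<Theta> (h s) (galerkin_fn n s x)) \<kappa> - fourier_coeff (\<lambda>x. \<Theta> (h s) (u s x)) \<kappa>)"
        unfolding g limit_rate_def rate_def by (simp add: right_diff_distrib sum_subtractf)
      have "\<bar>galerkin_rate (r n) \<kappa> (frozen (r n) s) s - limit_rate \<kappa> s\<bar> \<le> (\<Sum>i\<in>UNIV. \<bar>freq \<kappa> i * (fourier_coeff (flux (galerkin_fn n s) (\<lambda>i. galerkin_grad n i s) i) (- \<kappa>) - fourier_coeff (flux (u s) (\<lambda>i. Du i s) i) (- \<kappa>))\<bar>) + L * (\<bar>norm (h s)\<bar> * gap n s)"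
        unfolding eq using th by (intro order_trans[OF abs_triangle_ineq] add_mono sum_abs)
      also have "\<dots> \<le> R n s"
        unfolding R_def abs_mult[of "freq \<kappa> _"] by (intro add_mono sum_mono mult_left_mono fl order_refl) auto
      finally show "\<bar>galerkin_rate (r n) \<kappa> (frozen (r n) s) s - limit_rate \<kappa> s\<bar> \<le> R n s" .
    qed
    then show "norm (LINT s|time. \<bar>galerkin_rate (r n) \<kappa> (frozen (r n) s) s - limit_rate \<kappa> s\<bar>) \<le> (LINT s|time. R n s)" by simp
  qed
  have intR: "(LINT s|time. R n s) = (\<Sum>i\<in>UNIV. \<bar>freq \<kappa> i\<bar> * (L * (LINT s|time. gap n s) + (\<Sum>j\<in>UNIV. LINT s|time. d n i j s)))
      + L * (LINT s|time. \<bar>norm (h s)\<bar> * gap n s)" for n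
  proof -
    have I: "integrable time (\<lambda>s. \<Sum>j\<in>UNIV. d n i j s)" "integrable time (\<lambda>s. L * gap n s)" for i
      by (rule Bochner_Integration.integrable_sum[OF id], rule integrable_mult_right[OF i1])
    have A: "integrable time (\<lambda>s. \<bar>freq \<kappa> i\<bar> * (L * gap n s + (\<Sum>j\<in>UNIV. d n i j s)))" for i
      by (rule integrable_mult_right[OF Bochner_Integration.integrable_add[OF I(2,1)]])
    have B: "(LINT s|time. L * gap n s + (\<Sum>j\<in>UNIV. d n i j s)) = L * (LINT s|time. gap n s) + (\<Sum>j\<in>UNIV. LINT s|time. d n i j s)" for i
      unfolding Bochner_Integration.integral_add[OF I(2,1)] Bochner_Integration.integral_sum[OF id] integral_mult_right_zero ..
    show ?thesis
      unfolding R_def Bochner_Integration.integral_add[OF Bochner_Integration.integrable_sum[OF A] integrable_mult_right[OF i2]]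
        Bochner_Integration.integral_sum[OF A] integral_mult_right_zero B ..
  qed
  have dL: "(\<lambda>n. LINT s|time. d n i j s) \<longlonglongrightarrow> 0" for i j
    unfolding d_def by (rule diffusion_L1)
  have "(\<lambda>n. (\<Sum>i\<in>UNIV. \<bar>freq \<kappa> i\<bar> * (L * (LINT s|time. gap n s) + (\<Sum>j\<in>UNIV. LINT s|time. d n i j s)))
      + L * (LINT s|time. \<bar>norm (h s)\<bar> * gap n s)) \<longlonglongrightarrow> (\<Sum>i\<in>(UNIV::'d set). \<bar>freq \<kappa> i\<bar> * (L * 0 + (\<Sum>j\<in>(UNIV::'d set). 0))) + L * 0"
    by (intro tendsto_intros l1 gap_L1 dL norm_h_sq)
  then have "(\<lambda>n. LINT s|time. R n s) \<longlonglongrightarrow> 0" unfolding intR by simp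
  with ev show ?thesis by (rule Lim_null_comparison)
qed

text \<open>The rates converge in L1(0,T), so the integral identity of the interpolants passes to the limit.\<close>

theorem c_equation:
  assumes t: "t \<in> {0..T}"
  shows "c \<kappa> t = fourier_coeff u0 \<kappa> + integral {0..t} (limit_rate \<kappa>)"
proof -
  let ?g = "\<lambda>n s. galerkin_rate (r n) \<kappa> (frozen (r n) s) s"
  have gi: "integrable time (?g n)" for n by (rule frozen_rate_integrable)
  have hk: "f integrable_on {0..t}" "f integrable_on {0..T}" if "integrable time f" for f :: "real \<Rightarrow> real"
    using lebesgue_on_interval_integral(2)[OF that] t by auto
  have "(\<lambda>n. integral {0..t} (?g n) - integral {0..t} (limit_rate \<kappa>)) \<longlonglongrightarrow> 0"
  proof (rule Lim_null_comparison[OF _ rate_L1[of \<kappa>]], rule always_eventually, rule allI)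
    fix n
    have ab: "integrable time (\<lambda>s. \<bar>?g n s - limit_rate \<kappa> s\<bar>)"
      by (intro integrable_abs Bochner_Integration.integrable_diff gi limit_rate_integrable)
    have eq: "integral {0..t} (?g n) - integral {0..t} (limit_rate \<kappa>) = integral {0..t} (\<lambda>s. ?g n s - limit_rate \<kappa> s)"
      by (rule Henstock_Kurzweil_Integration.integral_diff[symmetric]) (intro hk gi limit_rate_integrable)+
    have "norm (integral {0..t} (?g n) - integral {0..t} (limit_rate \<kappa>)) \<le> integral {0..t} (\<lambda>s. \<bar>?g n s - limit_rate \<kappa> s\<bar>)"
      unfolding eq by (rule integral_norm_bound_integral[OF hk(1)[OF Bochner_Integration.integrable_diff[OF gi limit_rate_integrable]] hk(1)[OF ab]]) simp
    also have "\<dots> \<le> integral {0..T} (\<lambda>s. \<bar>?g n s - limit_rate \<kappa> s\<bar>)"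
      using t by (intro integral_subset_le hk ab) auto
    also have "\<dots> = (LINT s|time. \<bar>?g n s - limit_rate \<kappa> s\<bar>)"
      by (rule lebesgue_on_interval_integral(1)[OF ab, symmetric]) auto
    finally show "norm (integral {0..t} (?g n) - integral {0..t} (limit_rate \<kappa>)) \<le> (LINT s|time. \<bar>?g n s - limit_rate \<kappa> s\<bar>)" .
  qed
  from tendsto_add[OF tendsto_const LIM_zero_cancel[OF this]]
  have "(\<lambda>n. fourier_coeff u0 \<kappa> + integral {0..t} (?g n)) \<longlonglongrightarrow> fourier_coeff u0 \<kappa> + integral {0..t} (limit_rate \<kappa>)" .
  with galerkin_lim[OF t, of \<kappa>] show ?thesis
    unfolding galerkin_def by (rule LIMSEQ_unique)
qed

end

section \<open>Continuity in time and measurability with values in H1\<close>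

context quasilinear_limit
begin

text \<open>A bound for the sum over all modes of the absolute power, from the Cauchy--Schwarz inequality in the
  sequence space and Bessel's inequality.\<close>

definition power_density :: "real \<Rightarrow> real" where
  "power_density s = (\<Sum>i\<in>UNIV. lnorm torus (Du i s) * lnorm torus (flux (u s) (\<lambda>j. Du j s) i))
     + lnorm torus (u s) * lnorm torus (\<lambda>x. \<Theta> (h s) (u s x))"

lemma u_time: "sq_integrable time (\<lambda>t. lnorm torus (u t))"
  by (rule sq_integrable_of_bounded[OF finite_measure_time fourier_measurable_lnorm[OF u_fourier_measurable], where C="sqrt C_apriori"])
     (simp add: u_lnorm_le)

lemma power_density_integrable: "integrable time power_density"
  unfolding power_density_def[abs_def]
  by (intro Bochner_Integration.integrable_add Bochner_Integration.integrable_sum sq_integrable_mult Du_time flux_time u_time \<Theta>_time)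

lemma sum_abs_c_limit_rate_le:
  assumes s: "s \<in> {0..T}" "finite_gradient s"
  shows "(\<Sum>\<kappa>\<in>freqs N. \<bar>c \<kappa> s * limit_rate \<kappa> s\<bar>) \<le> power_density s"
proof -
  let ?f = "\<lambda>i. flux (u s) (\<lambda>j. Du j s) i"
  let ?th = "\<lambda>x. \<Theta> (h s) (u s x)"
  have fs: "sq_integrable torus (?f i)" for i by (intro flux_sq u_props Du_sq s)
  have ts: "sq_integrable torus ?th" by (intro \<Theta>_sq u_props s)
  define g where "g i \<kappa> = c \<kappa> s * (freq \<kappa> i * fourier_coeff (?f i) (- \<kappa>))" for i \<kappa>
  define q where "q \<kappa> = fourier_coeff (u s) \<kappa> * fourier_coeff ?th \<kappa>" for \<kappa>
  have g_le: "(\<Sum>\<kappa>\<in>freqs N. \<bar>g i \<kappa>\<bar>) \<le> lnorm torus (Du i s) * lnorm torus (?f i)" for i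
  proof -
    have "\<bar>g i \<kappa>\<bar> = \<bar>fourier_coeff (Du i s) (- \<kappa>) * fourier_coeff (?f i) (- \<kappa>)\<bar>" for \<kappa>
      using s by (simp add: g_def fourier_coeff_Du dcoef_def abs_mult mult_ac)
    then have "(\<Sum>\<kappa>\<in>freqs N. \<bar>g i \<kappa>\<bar>) = (\<Sum>\<kappa>\<in>freqs N. \<bar>fourier_coeff (Du i s) (- \<kappa>) * fourier_coeff (?f i) (- \<kappa>)\<bar>)"
      by (simp only:)
    also have "\<dots> = (\<Sum>\<kappa>\<in>freqs N. \<bar>fourier_coeff (Du i s) \<kappa> * fourier_coeff (?f i) \<kappa>\<bar>)"
      by (rule sum_freqs_uminus[of "\<lambda>\<kappa>. \<bar>fourier_coeff (Du i s) \<kappa> * fourier_coeff (?f i) \<kappa>\<bar>" N])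
    also have "\<dots> \<le> lnorm torus (Du i s) * lnorm torus (?f i)"
      by (rule abs_sum_fourier_coeff_le[OF finite_freqs Du_sq[OF s(1)] fs])
    finally show ?thesis .
  qed
  have q_le: "(\<Sum>\<kappa>\<in>freqs N. \<bar>q \<kappa>\<bar>) \<le> lnorm torus (u s) * lnorm torus ?th"
    unfolding q_def by (rule abs_sum_fourier_coeff_le[OF finite_freqs u_props(1)[OF s(1)] ts])
  have "\<bar>c \<kappa> s * limit_rate \<kappa> s\<bar> \<le> (\<Sum>i\<in>UNIV. \<bar>g i \<kappa>\<bar>) + \<bar>q \<kappa>\<bar>" for \<kappa>
  proof -
    have "c \<kappa> s * limit_rate \<kappa> s = (\<Sum>i\<in>UNIV. g i \<kappa>) + q \<kappa>"
      unfolding limit_rate_def rate_def g_def q_def u_props(2)[OF s(1)] by (simp only: distrib_left sum_distrib_left)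
    then show ?thesis using sum_abs[of "\<lambda>i. g i \<kappa>" UNIV] abs_triangle_ineq[of "\<Sum>i\<in>UNIV. g i \<kappa>" "q \<kappa>"] by linarith
  qed
  then have "(\<Sum>\<kappa>\<in>freqs N. \<bar>c \<kappa> s * limit_rate \<kappa> s\<bar>) \<le> (\<Sum>\<kappa>\<in>freqs N. (\<Sum>i\<in>UNIV. \<bar>g i \<kappa>\<bar>) + \<bar>q \<kappa>\<bar>)"
    by (rule sum_mono)
  also have "\<dots> = (\<Sum>\<kappa>\<in>freqs N. \<Sum>i\<in>UNIV. \<bar>g i \<kappa>\<bar>) + (\<Sum>\<kappa>\<in>freqs N. \<bar>q \<kappa>\<bar>)" by (rule sum.distrib)
  also have "(\<Sum>\<kappa>\<in>freqs N. \<Sum>i\<in>UNIV. \<bar>g i \<kappa>\<bar>) = (\<Sum>i\<in>UNIV. \<Sum>\<kappa>\<in>freqs N. \<bar>g i \<kappa>\<bar>)" by (rule sum.swap)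
  also have "\<dots> + (\<Sum>\<kappa>\<in>freqs N. \<bar>q \<kappa>\<bar>) \<le> power_density s"
    unfolding power_density_def by (intro add_mono sum_mono g_le q_le)
  finally show ?thesis .
qed

lemma c_abs_le: "t \<in> {0..T} \<Longrightarrow> \<bar>c \<kappa> t\<bar> \<le> sqrt C_apriori"
  using square_le_of_sum(1)[of "\<lambda>\<kappa>. c \<kappa> t" C_apriori \<kappa>, OF c_bound] .

lemma c_limit_rate_integrable: "integrable time (\<lambda>s. c \<kappa> s * limit_rate \<kappa> s)"
proof (rule Bochner_Integration.integrable_bound)
  show "integrable time (\<lambda>s. sqrt C_apriori * limit_rate \<kappa> s)" by (intro integrable_mult_right limit_rate_integrable)
  show "(\<lambda>s. c \<kappa> s * limit_rate \<kappa> s) \<in> borel_measurable time" using limit_rate_measurable by measurable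
  show "AE s in time. norm (c \<kappa> s * limit_rate \<kappa> s) \<le> norm (sqrt C_apriori * limit_rate \<kappa> s)"
  proof (rule AE_I2)
    fix s assume "s \<in> space time"
    then have "\<bar>c \<kappa> s\<bar> * \<bar>limit_rate \<kappa> s\<bar> \<le> sqrt C_apriori * \<bar>limit_rate \<kappa> s\<bar>" by (intro mult_right_mono c_abs_le) auto
    then show "norm (c \<kappa> s * limit_rate \<kappa> s) \<le> norm (sqrt C_apriori * limit_rate \<kappa> s)" using C_apriori_pos by (simp add: abs_mult)
  qed
qed

definition work :: "int^'d \<Rightarrow> real" where
  "work \<kappa> = (LINT s|time. \<bar>c \<kappa> s * limit_rate \<kappa> s\<bar>)"

lemma work_nonneg: "0 \<le> work \<kappa>" by (simp add: work_def)

lemma sum_work_le: "(\<Sum>\<kappa>\<in>freqs N. work \<kappa>) \<le> (LINT s|time. power_density s)"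
proof -
  have i: "integrable time (\<lambda>s. \<bar>c \<kappa> s * limit_rate \<kappa> s\<bar>)" for \<kappa> by (intro integrable_abs c_limit_rate_integrable)
  have "(\<Sum>\<kappa>\<in>freqs N. work \<kappa>) = (LINT s|time. (\<Sum>\<kappa>\<in>freqs N. \<bar>c \<kappa> s * limit_rate \<kappa> s\<bar>))"
    unfolding work_def by (rule Bochner_Integration.integral_sum[OF i, symmetric])
  also have "\<dots> \<le> (LINT s|time. power_density s)"
  proof (rule integral_mono_AE[OF Bochner_Integration.integrable_sum[OF i] power_density_integrable])
    show "AE s in time. (\<Sum>\<kappa>\<in>freqs N. \<bar>c \<kappa> s * limit_rate \<kappa> s\<bar>) \<le> power_density s"
      using finite_gradient_AE AE_space by eventually_elim (rule sum_abs_c_limit_rate_le, auto)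
  qed
  finally show ?thesis .
qed

lemma c_square_le:
  assumes t: "t \<in> {0..T}"
  shows "(c \<kappa> t)\<^sup>2 \<le> (fourier_coeff u0 \<kappa>)\<^sup>2 + 2 * work \<kappa>"
proof -
  have "(c \<kappa> t)\<^sup>2 = (c \<kappa> 0)\<^sup>2 + 2 * integral {0..t} (\<lambda>s. c \<kappa> s * limit_rate \<kappa> s)"
  proof (rule square_of_indefinite_integral[OF limit_rate_integrable])
    show "0 \<le> t" "t \<le> T" using t by auto
    show "c \<kappa> s = c \<kappa> 0 + integral {0..s} (limit_rate \<kappa>)" if "s \<in> {0..T}" for s
      unfolding c_zero by (rule c_equation[OF that])
  qed
  moreover have "integral {0..t} (\<lambda>s. c \<kappa> s * limit_rate \<kappa> s) \<le> work \<kappa>"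
  proof -
    note i = c_limit_rate_integrable[of \<kappa>] integrable_abs[OF c_limit_rate_integrable[of \<kappa>]]
    have "integral {0..t} (\<lambda>s. c \<kappa> s * limit_rate \<kappa> s) \<le> integral {0..t} (\<lambda>s. \<bar>c \<kappa> s * limit_rate \<kappa> s\<bar>)"
      using t by (intro integral_le lebesgue_on_interval_integral(2)[OF i(1)] lebesgue_on_interval_integral(2)[OF i(2)]) auto
    also have "\<dots> \<le> integral {0..T} (\<lambda>s. \<bar>c \<kappa> s * limit_rate \<kappa> s\<bar>)"
      using t by (intro integral_subset_le lebesgue_on_interval_integral(2)[OF i(2)]) auto
    also have "\<dots> = work \<kappa>"
      unfolding work_def by (rule lebesgue_on_interval_integral(1)[OF i(2), symmetric]) auto
    finally show ?thesis .
  qed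
  ultimately show ?thesis unfolding c_zero by linarith
qed

text \<open>The energy carried by high frequencies is small uniformly in time: it is at most the initial
  energy there plus twice the work done on those modes, and the total work is finite.\<close>

lemma uniform_tail:
  assumes e: "\<epsilon> > 0"
  obtains m where "\<And>N t. t \<in> {0..T} \<Longrightarrow> (\<Sum>\<kappa>\<in>freqs N - freqs m. (c \<kappa> t)\<^sup>2) \<le> \<epsilon>"
proof -
  define J where "J N = (\<Sum>\<kappa>\<in>freqs N. (fourier_coeff u0 \<kappa>)\<^sup>2 + 2 * work \<kappa>)" for N
  have pos: "0 \<le> (fourier_coeff u0 \<kappa>)\<^sup>2 + 2 * work \<kappa>" for \<kappa> using work_nonneg[of \<kappa>] by simp
  have Jle: "J N \<le> (lnorm torus u0)\<^sup>2 + 2 * (LINT s|time. power_density s)" for N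
    using Bessel[OF finite_freqs u0, of N] sum_work_le[of N] by (simp add: J_def sum.distrib sum_distrib_left[symmetric])
  have Jmono: "J m \<le> J n" if "m \<le> n" for m n
    unfolding J_def by (intro sum_mono2 freqs_mono that pos) auto
  have J0: "0 \<le> J N" for N unfolding J_def by (intro sum_nonneg pos)
  have "convergent J"
    by (intro Bseq_mono_convergent incseq_imp_monoseq BseqI'[of _ "(lnorm torus u0)\<^sup>2 + 2 * (LINT s|time. power_density s)"])
       (auto simp: incseq_def Jmono Jle J0)
  then have "Cauchy J" by (rule convergent_Cauchy)
  then obtain m where m: "\<And>p q. p \<ge> m \<Longrightarrow> q \<ge> m \<Longrightarrow> norm (J p - J q) < \<epsilon>" using CauchyD[of J \<epsilon>] e by blast
  have "(\<Sum>\<kappa>\<in>freqs N - freqs m. (c \<kappa> t)\<^sup>2) \<le> \<epsilon>" if t: "t \<in> {0..T}" for N t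
  proof (cases "m \<le> N")
    case True
    have "(\<Sum>\<kappa>\<in>freqs N - freqs m. (c \<kappa> t)\<^sup>2) \<le> (\<Sum>\<kappa>\<in>freqs N - freqs m. (fourier_coeff u0 \<kappa>)\<^sup>2 + 2 * work \<kappa>)"
      by (intro sum_mono c_square_le t)
    also have "\<dots> = J N - J m"
      unfolding J_def by (rule sum_diff[OF finite_freqs freqs_mono[OF True]])
    also have "\<dots> \<le> \<epsilon>" using m[OF True order_refl] by simp
    finally show ?thesis .
  next
    case False
    then have empty: "freqs N - freqs m = ({} :: (int^'d) set)" using freqs_mono[of N m, where 'a='d] by auto
    show ?thesis unfolding empty using e by simp
  qed
  then show ?thesis by (rule that)
qed

lemma square_diff_le: "(x - y)\<^sup>2 \<le> 2 * x\<^sup>2 + 2 * y\<^sup>2" for x y :: real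
proof -
  have "0 \<le> (x + y)\<^sup>2" by simp
  then show ?thesis by (simp add: power2_sum power2_diff)
qed

text \<open>Finitely many modes are continuous and the remaining ones are uniformly small.\<close>

theorem u_continuous:
  assumes t: "t \<in> {0..T}"
  shows "((\<lambda>s. lnorm torus (\<lambda>x. u s x - u t x)) \<longlongrightarrow> 0) (at t within {0..T})"
proof (rule tendstoI)
  fix e :: real assume e: "e > 0"
  obtain m where m: "\<And>N t. t \<in> {0..T} \<Longrightarrow> (\<Sum>\<kappa>\<in>freqs N - freqs m. (c \<kappa> t)\<^sup>2) \<le> e\<^sup>2 / 16"
    using uniform_tail[of "e\<^sup>2 / 16"] e by auto
  have "((\<lambda>s. \<Sum>\<kappa>\<in>freqs m. (c \<kappa> s - c \<kappa> t)\<^sup>2) \<longlongrightarrow> (\<Sum>\<kappa>\<in>freqs m. (c \<kappa> t - c \<kappa> t)\<^sup>2)) (at t within {0..T})"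
    by (intro tendsto_sum tendsto_power tendsto_diff tendsto_const c_tendsto t)
  then have "\<forall>\<^sub>F s in at t within {0..T}. (\<Sum>\<kappa>\<in>freqs m. (c \<kappa> s - c \<kappa> t)\<^sup>2) < e\<^sup>2 / 4"
    by (rule order_tendstoD(2)) (use e in simp)
  moreover have "\<forall>\<^sub>F s in at t within {0..T}. s \<in> {0..T}" by (simp add: eventually_at_filter)
  ultimately show "\<forall>\<^sub>F s in at t within {0..T}. dist (lnorm torus (\<lambda>x. u s x - u t x)) 0 < e"
  proof eventually_elim
    case (elim s)
    then have s: "s \<in> {0..T}" by blast
    have fd: "fourier_coeff (\<lambda>x. u s x - u t x) \<kappa> = c \<kappa> s - c \<kappa> t" for \<kappa>
      by (simp add: fourier_coeff_diff u_props[OF s] u_props[OF t])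
    have "(lnorm torus (\<lambda>x. u s x - u t x))\<^sup>2 \<le> e\<^sup>2 / 4 + e\<^sup>2 / 4"
    proof (rule lnorm_le_of_fourier_coeff[OF sq_integrable_diff[OF u_props(1)[OF s] u_props(1)[OF t]]], unfold fd)
      fix N
      have "(\<Sum>\<kappa>\<in>freqs N. (c \<kappa> s - c \<kappa> t)\<^sup>2) \<le> (\<Sum>\<kappa>\<in>freqs m \<union> (freqs N - freqs m). (c \<kappa> s - c \<kappa> t)\<^sup>2)"
        by (intro sum_mono2) auto
      also have "\<dots> = (\<Sum>\<kappa>\<in>freqs m. (c \<kappa> s - c \<kappa> t)\<^sup>2) + (\<Sum>\<kappa>\<in>freqs N - freqs m. (c \<kappa> s - c \<kappa> t)\<^sup>2)"
        by (rule sum.union_disjoint) auto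
      also have "\<dots> \<le> e\<^sup>2 / 4 + (\<Sum>\<kappa>\<in>freqs N - freqs m. 2 * (c \<kappa> s)\<^sup>2 + 2 * (c \<kappa> t)\<^sup>2)"
        using elim by (intro add_mono sum_mono square_diff_le) auto
      also have "\<dots> = e\<^sup>2 / 4 + (2 * (\<Sum>\<kappa>\<in>freqs N - freqs m. (c \<kappa> s)\<^sup>2) + 2 * (\<Sum>\<kappa>\<in>freqs N - freqs m. (c \<kappa> t)\<^sup>2))"
        by (simp add: sum.distrib sum_distrib_left)
      also have "\<dots> \<le> e\<^sup>2 / 4 + e\<^sup>2 / 4" using m[OF s, of N] m[OF t, of N] by simp
      finally show "(\<Sum>\<kappa>\<in>freqs N. (c \<kappa> s - c \<kappa> t)\<^sup>2) \<le> e\<^sup>2 / 4 + e\<^sup>2 / 4" .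
    qed
    also have "\<dots> < e\<^sup>2" using e by simp
    finally have "lnorm torus (\<lambda>x. u s x - u t x) < e" using e by (simp add: power2_less_imp_less)
    then show "dist (lnorm torus (\<lambda>x. u s x - u t x)) 0 < e" by (simp add: dist_real_def)
  qed
qed

lemma u_C_H: "u \<in> C_H T"
  unfolding C_H_def L2_norm_real using u_continuous by (simp add: L2_real_iff u_props)

lemma bad_negligible: "negligible {t \<in> {0..T}. \<not> finite_gradient t}"
proof -
  have "AE t in lebesgue. t \<in> {0..T} \<longrightarrow> finite_gradient t" using finite_gradient_AE by (subst (asm) AE_restrict_space_iff) auto
  then obtain N where N: "{t \<in> space lebesgue. \<not> (t \<in> {0..T} \<longrightarrow> finite_gradient t)} \<subseteq> N" "emeasure lebesgue N = 0" "N \<in> sets lebesgue"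
    by (rule AE_E)
  then have "negligible N" by (simp add: negligible_iff_null_sets null_sets_def)
  then show ?thesis by (rule negligible_subset) (use N(1) in auto)
qed

text \<open>The times at which the limit lacks a weak gradient are negligible, so they affect no time integral.\<close>

lemma spike_finite_gradient:
  fixes f g :: "real \<Rightarrow> real"
  assumes f: "integrable time f" and eq: "\<And>t. t \<in> {0..T} \<Longrightarrow> finite_gradient t \<Longrightarrow> g t = f t"
  shows "integrable time g" "t \<in> {0..T} \<Longrightarrow> (LINT s|lebesgue_on {0..t}. g s) = integral {0..t} f"
proof -
  have "f absolutely_integrable_on {0..T}" using f by (simp add: set_integrable_def integrable_restrict_space)
  then have "g absolutely_integrable_on {0..T}"
    by (rule absolutely_integrable_spike[OF _ bad_negligible]) (use eq in auto)
  then show g: "integrable time g" by (simp add: set_integrable_def integrable_restrict_space)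
  assume t: "t \<in> {0..T}"
  have "(LINT s|lebesgue_on {0..t}. g s) = integral {0..t} g"
    by (rule lebesgue_on_interval_integral(1)[OF g]) (use t in auto)
  also have "\<dots> = integral {0..t} f"
    by (rule integral_spike[OF bad_negligible]) (use eq t in auto)
  finally show "(LINT s|lebesgue_on {0..t}. g s) = integral {0..t} f" .
qed

lemma H1_norm_u:
  assumes t: "t \<in> {0..T}" "finite_gradient t" shows "(H1_norm (u t))\<^sup>2 = (lnorm torus (u t))\<^sup>2 + gradient_energy t"
proof -
  have "(L2_norm (wgrad (u t)))\<^sup>2 = gradient_energy t"
    using H1_norm_tendsto(2)[OF u_H1[OF t]] partial_gradient_energy_lim[OF t] LIMSEQ_unique
    by (fastforce simp: partial_gradient_energy_def u_props(2)[OF t(1)])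
  moreover have "(H1_norm (u t))\<^sup>2 = (lnorm torus (u t))\<^sup>2 + (L2_norm (wgrad (u t)))\<^sup>2"
    by (simp add: H1_norm_def L2_norm_real)
  ultimately show ?thesis by (simp only:)
qed

lemma H1_norm_u_integrable: "integrable time (\<lambda>t. (H1_norm (u t))\<^sup>2)"
  by (rule spike_finite_gradient(1)[OF Bochner_Integration.integrable_add[OF sq_integrableD(2)[OF u_time] gradient_energy_integral(1)] H1_norm_u])

text \<open>Sampling the truncated Fourier series at a mesh that is fine enough for the finitely many
  modes involved gives simple functions with values in H1.\<close>

lemma u_strongly_measurable: "strongly_measurable_H1 T u"
proof -
  \<comment> \<open>A mesh so fine that the Hoelder bounds of the modes in \<open>freqs m\<close>, weighted as in the H1 norm, sum to at most \<open>T / (m + 1)\<close>.\<close>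
  define mass where "mass m = (\<Sum>\<kappa>\<in>(freqs m :: (int^'d) set). (1 + freq_norm_sq \<kappa>) * C_rate \<kappa>)" for m
  have mass0: "0 \<le> mass m" for m unfolding mass_def by (intro sum_nonneg mult_nonneg_nonneg C_rate_nonneg) auto
  define \<tau> where "\<tau> m = T / (real (Suc m) * (mass m + 1))" for m
  have \<tau>: "\<tau> m > 0" "mass m * \<tau> m \<le> T * inverse (real (Suc m))" for m
  proof -
    show "\<tau> m > 0" using T mass0[of m] by (simp add: \<tau>_def)
    have "mass m / (mass m + 1) \<le> 1" using mass0[of m] by simp
    then have "T * inverse (real (Suc m)) * (mass m / (mass m + 1)) \<le> T * inverse (real (Suc m)) * 1"
      using T by (intro mult_left_mono) auto
    then show "mass m * \<tau> m \<le> T * inverse (real (Suc m))" by (simp add: \<tau>_def divide_inverse mult_ac)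
  qed
  define smp where "smp m j = fourier_sum (freqs m) (\<lambda>\<kappa>. c \<kappa> (real j * \<tau> m))" for m j
  define s where "s m t = smp m (cell (\<tau> m) t)" for m t
  have smpH1: "smp m j \<in> H1" for m j
  proof (rule H1_fourierI)
    show "sq_integrable torus (smp m j)" by (simp add: smp_def)
    show "(\<Sum>\<kappa>\<in>freqs N. freq_norm_sq \<kappa> * (fourier_coeff (smp m j) \<kappa>)\<^sup>2) \<le> (\<Sum>\<kappa>\<in>freqs m. freq_norm_sq \<kappa> * (c \<kappa> (real j * \<tau> m))\<^sup>2)" for N
    proof -
      have "(\<Sum>\<kappa>\<in>freqs N. freq_norm_sq \<kappa> * (fourier_coeff (smp m j) \<kappa>)\<^sup>2) = (\<Sum>\<kappa>\<in>freqs N \<inter> freqs m. freq_norm_sq \<kappa> * (c \<kappa> (real j * \<tau> m))\<^sup>2)"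
        by (intro sum.mono_neutral_cong_right) (auto simp: smp_def fourier_coeff_fourier_sum)
      also have "\<dots> \<le> (\<Sum>\<kappa>\<in>freqs m. freq_norm_sq \<kappa> * (c \<kappa> (real j * \<tau> m))\<^sup>2)" by (intro sum_mono2) auto
      finally show ?thesis .
    qed
  qed
  have simple: "simple_function time (s m)" for m
  proof -
    have "simple_function time (cell (\<tau> m))"
      unfolding simple_function_def
    proof (intro conjI ballI)
      have "cell (\<tau> m) ` space time \<subseteq> {..nat \<lceil>T / \<tau> m\<rceil>}"
      proof (rule image_subsetI)
        fix t assume "t \<in> space time"
        then have "t / \<tau> m \<le> T / \<tau> m" using \<tau>(1)[of m] by (intro divide_right_mono) auto
        then have "\<lfloor>t / \<tau> m\<rfloor> \<le> \<lceil>T / \<tau> m\<rceil>" by linarith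
        then show "cell (\<tau> m) t \<in> {..nat \<lceil>T / \<tau> m\<rceil>}" by (simp add: cell_def nat_mono)
      qed
      then show "finite (cell (\<tau> m) ` space time)" by (rule finite_subset) simp
      show "cell (\<tau> m) -` {j} \<inter> space time \<in> sets time" for j by (rule measurable_sets[OF cell_measurable]) simp
    qed
    then show ?thesis unfolding s_def[abs_def] by (rule simple_function_compose1)
  qed
  have conv: "(\<lambda>m. H1_norm (\<lambda>x. s m t x - u t x)) \<longlonglongrightarrow> 0" if t: "t \<in> {0..T}" "finite_gradient t" for t
  proof -
    define S where "S N = (\<Sum>\<kappa>\<in>freqs N. (1 + freq_norm_sq \<kappa>) * (c \<kappa> t)\<^sup>2)" for N
    have Slim: "S \<longlonglongrightarrow> (H1_norm (u t))\<^sup>2"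
      using H1_norm_tendsto(1)[OF u_H1[OF t]] by (simp add: S_def[abs_def] u_props(2)[OF t(1)])
    have Smono: "incseq S"
    proof (rule incseq_SucI)
      show "S N \<le> S (Suc N)" for N
        unfolding S_def by (intro sum_mono2 finite_freqs freqs_mono mult_nonneg_nonneg) auto
    qed
    have bound: "(H1_norm (\<lambda>x. s m t x - u t x))\<^sup>2 \<le> T * inverse (real (Suc m)) + ((H1_norm (u t))\<^sup>2 - S m)" for m
    proof -
      define t' where "t' = real (cell (\<tau> m) t) * \<tau> m"
      have t': "t' \<in> {0..T}" "\<bar>t' - t\<bar> \<le> \<tau> m"
        using cell_bounds[OF \<tau>(1)[of m], of t] t(1) \<tau>(1)[of m] unfolding t'_def by (auto simp: algebra_simps)
      let ?f = "\<lambda>x. s m t x - u t x"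
      have sf: "sq_integrable torus ?f" by (simp add: s_def smp_def sq_integrable_diff u_props[OF t(1)])
      have fcf: "fourier_coeff ?f \<kappa> = (if \<kappa> \<in> freqs m then c \<kappa> t' else 0) - c \<kappa> t" for \<kappa>
        by (simp add: s_def smp_def fourier_coeff_diff u_props[OF t(1)] fourier_coeff_fourier_sum t'_def)
      have low: "(\<Sum>\<kappa>\<in>freqs m. (1 + freq_norm_sq \<kappa>) * (fourier_coeff ?f \<kappa>)\<^sup>2) \<le> T * inverse (real (Suc m))"
      proof -
        have "(1 + freq_norm_sq \<kappa>) * (fourier_coeff ?f \<kappa>)\<^sup>2 \<le> ((1 + freq_norm_sq \<kappa>) * C_rate \<kappa>) * \<tau> m" if k: "\<kappa> \<in> freqs m" for \<kappa>
        proof -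
          have "\<bar>c \<kappa> t' - c \<kappa> t\<bar>\<^sup>2 \<le> (sqrt (C_rate \<kappa> * \<bar>t' - t\<bar>))\<^sup>2"
            by (rule power_mono[OF c_hoelder[OF t(1) t'(1)]]) simp
          also have "\<dots> = C_rate \<kappa> * \<bar>t' - t\<bar>" by (simp add: C_rate_nonneg)
          also have "\<dots> \<le> C_rate \<kappa> * \<tau> m" by (intro mult_left_mono t'(2) C_rate_nonneg)
          finally have "(1 + freq_norm_sq \<kappa>) * (c \<kappa> t' - c \<kappa> t)\<^sup>2 \<le> (1 + freq_norm_sq \<kappa>) * (C_rate \<kappa> * \<tau> m)"
            by (intro mult_left_mono) auto
          then show ?thesis using k by (simp add: fcf mult.assoc)
        qed
        then have "(\<Sum>\<kappa>\<in>freqs m. (1 + freq_norm_sq \<kappa>) * (fourier_coeff ?f \<kappa>)\<^sup>2) \<le> mass m * \<tau> m"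
          unfolding mass_def sum_distrib_right by (rule sum_mono)
        then show ?thesis using \<tau>(2)[of m] by linarith
      qed
      have all: "(\<Sum>\<kappa>\<in>freqs N. (1 + freq_norm_sq \<kappa>) * (fourier_coeff ?f \<kappa>)\<^sup>2) \<le> T * inverse (real (Suc m)) + ((H1_norm (u t))\<^sup>2 - S m)" for N
      proof -
        define M where "M = max m N"
        have M: "m \<le> M" "N \<le> M" by (auto simp: M_def)
        define g where "g \<kappa> = (1 + freq_norm_sq \<kappa>) * (fourier_coeff ?f \<kappa>)\<^sup>2" for \<kappa>
        have "(\<Sum>\<kappa>\<in>freqs N. g \<kappa>) \<le> (\<Sum>\<kappa>\<in>freqs M. g \<kappa>)"
          unfolding g_def by (intro sum_mono2 finite_freqs freqs_mono M mult_nonneg_nonneg) auto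
        moreover have "(\<Sum>\<kappa>\<in>freqs M. g \<kappa>) = (\<Sum>\<kappa>\<in>freqs M - freqs m. g \<kappa>) + (\<Sum>\<kappa>\<in>freqs m. g \<kappa>)"
          by (rule sum.subset_diff[OF freqs_mono[OF M(1)] finite_freqs])
        moreover have "(\<Sum>\<kappa>\<in>freqs M - freqs m. g \<kappa>) = (\<Sum>\<kappa>\<in>freqs M - freqs m. (1 + freq_norm_sq \<kappa>) * (c \<kappa> t)\<^sup>2)"
          by (rule sum.cong) (auto simp: g_def fcf)
        moreover have "\<dots> = S M - S m"
          unfolding S_def by (rule sum_diff[OF finite_freqs freqs_mono[OF M(1)]])
        moreover have "S M \<le> (H1_norm (u t))\<^sup>2"
          by (rule incseq_le[OF Smono Slim])
        ultimately show ?thesis using low unfolding g_def by linarith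
      qed
      have fH1: "?f \<in> H1"
      proof (rule H1_fourierI[OF sf])
        fix N
        have "(\<Sum>\<kappa>\<in>freqs N. freq_norm_sq \<kappa> * (fourier_coeff ?f \<kappa>)\<^sup>2) \<le> (\<Sum>\<kappa>\<in>freqs N. (1 + freq_norm_sq \<kappa>) * (fourier_coeff ?f \<kappa>)\<^sup>2)"
          by (intro sum_mono mult_right_mono) auto
        then show "(\<Sum>\<kappa>\<in>freqs N. freq_norm_sq \<kappa> * (fourier_coeff ?f \<kappa>)\<^sup>2) \<le> T * inverse (real (Suc m)) + ((H1_norm (u t))\<^sup>2 - S m)"
          using all[of N] by linarith
      qed
      show ?thesis by (rule LIMSEQ_le_const2[OF H1_norm_tendsto(1)[OF fH1]]) (use all in blast)
    qed
    have "(\<lambda>m. T * inverse (real (Suc m)) + ((H1_norm (u t))\<^sup>2 - S m)) \<longlonglongrightarrow> T * 0 + ((H1_norm (u t))\<^sup>2 - (H1_norm (u t))\<^sup>2)"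
      by (intro tendsto_add tendsto_mult tendsto_diff tendsto_const LIMSEQ_inverse_real_of_nat Slim)
    then have lim0: "(\<lambda>m. T * inverse (real (Suc m)) + ((H1_norm (u t))\<^sup>2 - S m)) \<longlonglongrightarrow> 0" by simp
    have "(\<lambda>m. (H1_norm (\<lambda>x. s m t x - u t x))\<^sup>2) \<longlonglongrightarrow> 0"
    proof (rule Lim_null_comparison[OF _ lim0], rule always_eventually, rule allI)
      show "norm ((H1_norm (\<lambda>x. s m t x - u t x))\<^sup>2) \<le> T * inverse (real (Suc m)) + ((H1_norm (u t))\<^sup>2 - S m)" for m
        using bound[of m] by (simp only: real_norm_def abs_power2)
    qed
    from tendsto_real_sqrt[OF this] show ?thesis by (simp add: H1_norm_def)
  qed
  have "AE t in time. (\<lambda>m. H1_norm (\<lambda>x. s m t x - u t x)) \<longlonglongrightarrow> 0"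
    using finite_gradient_AE AE_space by eventually_elim (rule conv, auto)
  then show ?thesis
    unfolding strongly_measurable_H1_def using simple smpH1 by (intro exI[of _ s]) (auto simp: s_def)
qed

lemma u_L2_H1: "u \<in> L2_H1 T"
proof -
  have "AE t in time. u t \<in> H1" using finite_gradient_AE AE_space by eventually_elim (rule u_H1, auto)
  then show ?thesis unfolding L2_H1_def using u_strongly_measurable H1_norm_u_integrable by simp
qed

lemma ip_time_integrable:
  assumes X: "fourier_measurable time X" "sq_integrable time (\<lambda>s. lnorm torus (X s))" and f: "sq_integrable torus f"
  shows "integrable time (\<lambda>s. ip (X s) f)"
proof (rule Bochner_Integration.integrable_bound)
  show "integrable time (\<lambda>s. lnorm torus f * lnorm torus (X s))"
    by (intro integrable_mult_right sq_integrable_imp_integrable[OF finite_measure_time X(2)])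
  show "(\<lambda>s. ip (X s) f) \<in> borel_measurable time"
    by (rule fourier_measurable_ip[OF X(1) fourier_measurable_const[OF f]])
  show "AE s in time. norm (ip (X s) f) \<le> norm (lnorm torus f * lnorm torus (X s))"
  proof (rule AE_I2)
    fix s assume "s \<in> space time"
    from Cauchy_Schwarz_lnorm[OF fourier_measurableD(1)[OF X(1) this] f]
    show "norm (ip (X s) f) \<le> norm (lnorm torus f * lnorm torus (X s))" by (simp add: mult.commute)
  qed
qed

lemma b_time: "sq_integrable time (\<lambda>s. lnorm torus (\<lambda>x. b i (u s x)))"
proof (rule sq_integrable_of_bounded[OF finite_measure_time fourier_measurable_lnorm[OF fourier_measurable_b[OF u_fourier_measurable]]])
  fix s assume "s \<in> space time"
  then have s: "s \<in> {0..T}" by simp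
  have "lnorm torus (\<lambda>x. b i (u s x)) \<le> L * (1 + lnorm torus (u s))" by (rule b_sq(2)[OF u_props(1)[OF s]])
  also have "\<dots> \<le> L * (1 + sqrt C_apriori)" using u_lnorm_le[OF s] L by (intro mult_left_mono) auto
  finally show "\<bar>lnorm torus (\<lambda>x. b i (u s x))\<bar> \<le> L * (1 + sqrt C_apriori)" by simp
qed

definition flux_term :: "(real^'d \<Rightarrow> real) \<Rightarrow> real \<Rightarrow> real" where
  "flux_term \<phi> s = (\<Sum>i\<in>UNIV. ip (flux (u s) (\<lambda>j. Du j s) i) (\<lambda>x. grad \<phi> x $ i))"

definition drift_term :: "(real^'d \<Rightarrow> real) \<Rightarrow> real \<Rightarrow> real" where
  "drift_term \<phi> s = (\<Sum>i\<in>UNIV. ip (\<lambda>x. b i (u s x)) (\<lambda>x. grad \<phi> x $ i))"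

definition diffusion_term :: "(real^'d \<Rightarrow> real) \<Rightarrow> real \<Rightarrow> real" where
  "diffusion_term \<phi> s = drift_term \<phi> s - flux_term \<phi> s"

definition noise_term :: "(real^'d \<Rightarrow> real) \<Rightarrow> real \<Rightarrow> real" where
  "noise_term \<phi> s = ip (\<lambda>x. \<Theta> (h s) (u s x)) \<phi>"

lemma diffusion_term_eq:
  assumes \<phi>: "\<phi> \<in> Cinf_torus" and s: "s \<in> {0..T}"
  shows "diffusion_term \<phi> s = (\<Sum>i\<in>UNIV. ip (\<lambda>x. \<Sum>j\<in>UNIV. a i j (u s x) * Du j s x) (\<lambda>x. grad \<phi> x $ i))"
proof -
  note gs = Cinf_torus_sq_integrable(2)[OF \<phi>]
  have as: "sq_integrable torus (\<lambda>x. \<Sum>j\<in>UNIV. a i j (u s x) * Du j s x)" for i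
    by (intro sq_integrable_sum a_sq u_props Du_sq s)
  have bs: "sq_integrable torus (\<lambda>x. b i (u s x))" for i by (intro b_sq u_props s)
  have "ip (flux (u s) (\<lambda>j. Du j s) i) (\<lambda>x. grad \<phi> x $ i)
      = ip (\<lambda>x. b i (u s x)) (\<lambda>x. grad \<phi> x $ i) - ip (\<lambda>x. \<Sum>j\<in>UNIV. a i j (u s x) * Du j s x) (\<lambda>x. grad \<phi> x $ i)" for i
    unfolding flux_def left_diff_distrib
    by (rule Bochner_Integration.integral_diff[OF sq_integrable_mult[OF bs gs] sq_integrable_mult[OF as gs]])
  then show ?thesis unfolding diffusion_term_def drift_term_def flux_term_def by (simp add: sum_subtractf)
qed

lemma term_integrable:
  assumes \<phi>: "\<phi> \<in> Cinf_torus"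
  shows "integrable time (flux_term \<phi>)" "integrable time (drift_term \<phi>)" "integrable time (noise_term \<phi>)"
    "integrable time (diffusion_term \<phi>)"
proof -
  note s = Cinf_torus_sq_integrable[OF \<phi>]
  show f: "integrable time (flux_term \<phi>)" unfolding flux_term_def[abs_def]
    by (intro Bochner_Integration.integrable_sum ip_time_integrable flux_fourier_measurable flux_time s)
  show d: "integrable time (drift_term \<phi>)" unfolding drift_term_def[abs_def]
    by (intro Bochner_Integration.integrable_sum ip_time_integrable fourier_measurable_b u_fourier_measurable b_time s)
  show "integrable time (noise_term \<phi>)" unfolding noise_term_def[abs_def]
    by (intro ip_time_integrable \<Theta>_fourier_measurable \<Theta>_time s)
  show "integrable time (diffusion_term \<phi>)" unfolding diffusion_term_def[abs_def]
    by (rule Bochner_Integration.integrable_diff[OF d f])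
qed

text \<open>The equations for the single modes combine to the weak formulation, because the Fourier series
  of a smooth test function and of its gradient converge in L2.\<close>

theorem weak_formulation:
  assumes \<phi>: "\<phi> \<in> Cinf_torus" and t: "t \<in> {0..T}"
  shows "ip (u t) \<phi> - ip u0 \<phi> - integral {0..t} (drift_term \<phi>)
    = - integral {0..t} (diffusion_term \<phi>) + integral {0..t} (noise_term \<phi>)"
proof -
  note s\<phi> = Cinf_torus_sq_integrable(1)[OF \<phi>] and sg = Cinf_torus_sq_integrable(2)[OF \<phi>]
  have hk: "f integrable_on {0..t}" if "integrable time f" for f :: "real \<Rightarrow> real"
    using lebesgue_on_interval_integral(2)[OF that order_refl, of t] t by simp
  define E where "E m s = (\<Sum>\<kappa>\<in>freqs m. fourier_coeff \<phi> \<kappa> * limit_rate \<kappa> s)" for m s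
  have E_eq: "E m s = (\<Sum>i\<in>UNIV. \<Sum>\<kappa>\<in>freqs m. fourier_coeff (flux (u s) (\<lambda>j. Du j s) i) \<kappa> * fourier_coeff (\<lambda>x. grad \<phi> x $ i) \<kappa>)
      + (\<Sum>\<kappa>\<in>freqs m. fourier_coeff (\<lambda>x. \<Theta> (h s) (u s x)) \<kappa> * fourier_coeff \<phi> \<kappa>)" for m s
  proof -
    let ?f = "\<lambda>i. fourier_coeff (flux (u s) (\<lambda>j. Du j s) i)"
    have "(\<Sum>\<kappa>\<in>freqs m. fourier_coeff \<phi> \<kappa> * (freq \<kappa> i * ?f i (- \<kappa>))) = (\<Sum>\<kappa>\<in>freqs m. ?f i \<kappa> * fourier_coeff (\<lambda>x. grad \<phi> x $ i) \<kappa>)" for i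
      using sum_freqs_uminus[of "\<lambda>\<kappa>. ?f i \<kappa> * fourier_coeff (\<lambda>x. grad \<phi> x $ i) \<kappa>" m] by (simp add: fourier_coeff_grad[OF \<phi>] mult_ac)
    moreover have "E m s = (\<Sum>i\<in>UNIV. \<Sum>\<kappa>\<in>freqs m. fourier_coeff \<phi> \<kappa> * (freq \<kappa> i * ?f i (- \<kappa>))) + (\<Sum>\<kappa>\<in>freqs m. fourier_coeff \<phi> \<kappa> * fourier_coeff (\<lambda>x. \<Theta> (h s) (u s x)) \<kappa>)"
      unfolding E_def limit_rate_def rate_def distrib_left sum_distrib_left sum.distrib by (subst sum.swap) (rule refl)
    ultimately show ?thesis by (simp add: mult.commute)
  qed
  have Ei: "integrable time (E m)" for m
    unfolding E_def[abs_def] by (intro Bochner_Integration.integrable_sum integrable_mult_right limit_rate_integrable)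
  define K where "K s = (\<Sum>i\<in>UNIV. lnorm torus (flux (u s) (\<lambda>j. Du j s) i) * lnorm torus (\<lambda>x. grad \<phi> x $ i))
      + lnorm torus (\<lambda>x. \<Theta> (h s) (u s x)) * lnorm torus \<phi>" for s
  have Ki: "integrable time K"
    unfolding K_def[abs_def]
    by (intro Bochner_Integration.integrable_add Bochner_Integration.integrable_sum integrable_mult_left
        sq_integrable_imp_integrable[OF finite_measure_time] flux_time \<Theta>_time)
  have E_le: "norm (E m s) \<le> K s" if s: "s \<in> {0..T}" for m s
  proof -
    define A where "A i = (\<Sum>\<kappa>\<in>freqs m. fourier_coeff (flux (u s) (\<lambda>j. Du j s) i) \<kappa> * fourier_coeff (\<lambda>x. grad \<phi> x $ i) \<kappa>)" for i
    define A' where "A' i = lnorm torus (flux (u s) (\<lambda>j. Du j s) i) * lnorm torus (\<lambda>x. grad \<phi> x $ i)" for i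
    define B where "B = (\<Sum>\<kappa>\<in>freqs m. fourier_coeff (\<lambda>x. \<Theta> (h s) (u s x)) \<kappa> * fourier_coeff \<phi> \<kappa>)"
    have "\<bar>A i\<bar> \<le> A' i" for i
      unfolding A_def A'_def by (intro abs_sum_fourier_coeff_prod_le finite_freqs flux_sq u_props Du_sq s sg)
    then have "(\<Sum>i\<in>UNIV. \<bar>A i\<bar>) \<le> (\<Sum>i\<in>UNIV. A' i)" by (rule sum_mono)
    then have 1: "\<bar>\<Sum>i\<in>UNIV. A i\<bar> \<le> (\<Sum>i\<in>UNIV. A' i)" using sum_abs[of A UNIV] by linarith
    have 2: "\<bar>B\<bar> \<le> lnorm torus (\<lambda>x. \<Theta> (h s) (u s x)) * lnorm torus \<phi>"
      unfolding B_def by (intro abs_sum_fourier_coeff_prod_le finite_freqs \<Theta>_sq u_props s s\<phi>)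
    have 3: "E m s = (\<Sum>i\<in>UNIV. A i) + B" unfolding A_def B_def by (rule E_eq)
    have 4: "K s = (\<Sum>i\<in>UNIV. A' i) + lnorm torus (\<lambda>x. \<Theta> (h s) (u s x)) * lnorm torus \<phi>"
      unfolding A'_def by (rule K_def)
    show ?thesis using 1 2 unfolding 3 4 real_norm_def by linarith
  qed
  have "(\<lambda>m. integral {0..t} (E m)) \<longlonglongrightarrow> integral {0..t} (\<lambda>s. flux_term \<phi> s + noise_term \<phi> s)"
  proof (rule dominated_convergence(2)[where f=E and h=K])
    show "E m integrable_on {0..t}" for m by (rule hk[OF Ei])
    show "K integrable_on {0..t}" by (rule hk[OF Ki])
    fix s assume "s \<in> {0..t}"
    with t have s: "s \<in> {0..T}" by simp
    have fs: "sq_integrable torus (flux (u s) (\<lambda>j. Du j s) i)" for i by (intro flux_sq u_props Du_sq s)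
    have ts: "sq_integrable torus (\<lambda>x. \<Theta> (h s) (u s x))" by (intro \<Theta>_sq u_props s)
    show "norm (E m s) \<le> K s" for m by (rule E_le[OF s])
    show "(\<lambda>m. E m s) \<longlonglongrightarrow> flux_term \<phi> s + noise_term \<phi> s"
      unfolding E_eq flux_term_def noise_term_def
      by (intro tendsto_add tendsto_sum Parseval fs ts sg s\<phi>)
  qed
  moreover have "integral {0..t} (E m) = (\<Sum>\<kappa>\<in>freqs m. fourier_coeff (u t) \<kappa> * fourier_coeff \<phi> \<kappa>) - (\<Sum>\<kappa>\<in>freqs m. fourier_coeff u0 \<kappa> * fourier_coeff \<phi> \<kappa>)" for m
  proof -
    have "integral {0..t} (E m) = (\<Sum>\<kappa>\<in>freqs m. fourier_coeff \<phi> \<kappa> * integral {0..t} (limit_rate \<kappa>))"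
      unfolding E_def[abs_def]
      by (subst Henstock_Kurzweil_Integration.integral_sum) (auto intro!: integrable_on_mult_right hk limit_rate_integrable)
    also have "\<dots> = (\<Sum>\<kappa>\<in>freqs m. fourier_coeff \<phi> \<kappa> * (c \<kappa> t - fourier_coeff u0 \<kappa>))"
      using c_equation[OF t] by simp
    finally show ?thesis by (simp add: u_props(2)[OF t] sum_subtractf[symmetric] algebra_simps)
  qed
  ultimately have "(\<lambda>m. (\<Sum>\<kappa>\<in>freqs m. fourier_coeff (u t) \<kappa> * fourier_coeff \<phi> \<kappa>) - (\<Sum>\<kappa>\<in>freqs m. fourier_coeff u0 \<kappa> * fourier_coeff \<phi> \<kappa>))
      \<longlonglongrightarrow> integral {0..t} (\<lambda>s. flux_term \<phi> s + noise_term \<phi> s)" by simp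
  moreover have "(\<lambda>m. (\<Sum>\<kappa>\<in>freqs m. fourier_coeff (u t) \<kappa> * fourier_coeff \<phi> \<kappa>) - (\<Sum>\<kappa>\<in>freqs m. fourier_coeff u0 \<kappa> * fourier_coeff \<phi> \<kappa>)) \<longlonglongrightarrow> ip (u t) \<phi> - ip u0 \<phi>"
    by (intro tendsto_diff Parseval u_props(1)[OF t] u0 s\<phi>)
  ultimately have e1: "integral {0..t} (\<lambda>s. flux_term \<phi> s + noise_term \<phi> s) = ip (u t) \<phi> - ip u0 \<phi>" by (rule LIMSEQ_unique)
  have e2: "integral {0..t} (\<lambda>s. flux_term \<phi> s + noise_term \<phi> s) = integral {0..t} (flux_term \<phi>) + integral {0..t} (noise_term \<phi>)"
    by (intro Henstock_Kurzweil_Integration.integral_add hk term_integrable \<phi>)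
  have e3: "integral {0..t} (diffusion_term \<phi>) = integral {0..t} (drift_term \<phi>) - integral {0..t} (flux_term \<phi>)"
    unfolding diffusion_term_def[abs_def] by (intro Henstock_Kurzweil_Integration.integral_diff hk term_integrable \<phi>)
  from e1 e2 e3 show ?thesis by linarith
qed

end

section \<open>Existence of a solution\<close>

lemma quasilinear_of_hypothesis_H:
  fixes B :: "real \<Rightarrow> real^'d" and A :: "real \<Rightarrow> real^'d^'d"
    and e :: "'k::countable \<Rightarrow> 'u::{real_inner, banach, second_countable_topology}"
  assumes T: "T > 0" and on: "orthonormal_basis e" and u0: "u0 \<in> L2" and H: "hypothesis_H B A \<sigma>" and h: "h \<in> L2_U T"
  obtains \<delta> L where "quasilinear T \<delta> L (\<lambda>i y. B y $ i) (\<lambda>i j y. A y $ i $ j) (noise_density e \<sigma>) h u0"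
proof -
  obtain KB where KB: "KB-lipschitz_on UNIV B" using H by (auto simp: hypothesis_H_def C1_lip_def)
  obtain KA where KA: "KA-lipschitz_on UNIV A" using H by (auto simp: hypothesis_H_def C1_lip_def)
  obtain \<delta> where \<delta>: "\<delta> > 0" "\<And>y \<xi>. \<delta> * (norm \<xi>)\<^sup>2 \<le> \<xi> \<bullet> (A y *v \<xi>)" using H by (auto simp: hypothesis_H_def)
  obtain CA where CA: "\<And>y. norm (A y) \<le> CA" using H by (auto simp: hypothesis_H_def bounded_iff)
  obtain C where C: "C > 0"
    and grow: "\<And>y. (\<lambda>k. (\<sigma> k y)\<^sup>2) summable_on UNIV" "\<And>y. (\<Sum>\<^sub>\<infinity>k. (\<sigma> k y)\<^sup>2) \<le> C * (1 + y\<^sup>2)"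
    and lip: "\<And>y z. (\<lambda>k. (\<sigma> k y - \<sigma> k z)\<^sup>2) summable_on UNIV" "\<And>y z. (\<Sum>\<^sub>\<infinity>k. (\<sigma> k y - \<sigma> k z)\<^sup>2) \<le> C * (y - z)\<^sup>2"
    using H unfolding hypothesis_H_def by blast
  have ee: "\<And>j k. e j \<bullet> e k = (if j = k then 1 else 0)" using on by (simp add: orthonormal_basis_def)
  note nd = noise_density_bounds[of e C \<sigma>, OF ee C grow lip]
  have KB0: "KB \<ge> 0" and KA0: "KA \<ge> 0" using lipschitz_on_nonneg[OF KB] lipschitz_on_nonneg[OF KA] by auto
  have CA0: "CA \<ge> 0" using CA[of 0] norm_ge_zero[of "A 0"] by linarith
  define L where "L = 1 + KB + norm (B 0) + KA + CA + sqrt C"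
  have Lge: "1 \<le> L" "KB + norm (B 0) \<le> L" "KB \<le> L" "KA \<le> L" "CA \<le> L" "sqrt C \<le> L" "0 \<le> L"
    using KB0 KA0 CA0 C norm_ge_zero[of "B 0"] real_sqrt_ge_zero[of C] unfolding L_def by linarith+
  have Bl: "\<bar>B y $ i - B z $ i\<bar> \<le> KB * \<bar>y - z\<bar>" for i y z
    using component_le_norm_cart[of "B y - B z" i] lipschitz_onD[OF KB, of y z] by (simp add: dist_norm)
  have Al: "\<bar>A y $ i $ j - A z $ i $ j\<bar> \<le> KA * \<bar>y - z\<bar>" for i j y z
    using component_le_norm_cart[of "(A y - A z) $ i" j]
      Finite_Cartesian_Product.norm_nth_le[of "A y - A z" i] lipschitz_onD[OF KA, of y z] by (simp add: dist_norm)
  have "quasilinear T \<delta> L (\<lambda>i y. B y $ i) (\<lambda>i j y. A y $ i $ j) (noise_density e \<sigma>) h u0"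
  proof
    show "T > 0" "\<delta> > 0" "1 \<le> L" by fact+
    fix i j :: 'd and y z :: real and p q :: 'u and \<xi> :: "'d \<Rightarrow> real"
    show "\<bar>B y $ i - B z $ i\<bar> \<le> L * \<bar>y - z\<bar>"
      using Bl[of y i z] mult_right_mono[OF Lge(3), of "\<bar>y - z\<bar>"] by linarith
    show "\<bar>A y $ i $ j - A z $ i $ j\<bar> \<le> L * \<bar>y - z\<bar>"
      using Al[of y i j z] mult_right_mono[OF Lge(4), of "\<bar>y - z\<bar>"] by linarith
    show "\<bar>B y $ i\<bar> \<le> L * (1 + \<bar>y\<bar>)"
    proof -
      have "\<bar>B y $ i\<bar> \<le> norm (B 0) + KB * \<bar>y\<bar>" using Bl[of y i 0] component_le_norm_cart[of "B 0" i] by simp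
      also have "\<dots> \<le> L * 1 + L * \<bar>y\<bar>" using Lge KB0 by (intro add_mono mult_right_mono) auto
      finally show ?thesis by (simp add: distrib_left)
    qed
    show "\<bar>A y $ i $ j\<bar> \<le> L"
      using component_le_norm_cart[of "A y $ i" j] Finite_Cartesian_Product.norm_nth_le[of "A y" i] CA[of y] Lge(5) by linarith
    have n2: "(norm (\<chi> i. \<xi> i))\<^sup>2 = (\<Sum>i\<in>UNIV. (\<xi> i)\<^sup>2)" by (simp add: norm_power2_vec)
    have "(\<chi> i. \<xi> i) \<bullet> (A y *v (\<chi> i. \<xi> i)) = (\<Sum>i\<in>UNIV. \<Sum>j\<in>UNIV. A y $ i $ j * \<xi> j * \<xi> i)"
      by (simp add: inner_vec_def matrix_vector_mult_def sum_distrib_left mult_ac)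
    with \<delta>(2)[of "\<chi> i. \<xi> i" y] show "\<delta> * (\<Sum>i\<in>UNIV. (\<xi> i)\<^sup>2) \<le> (\<Sum>i\<in>UNIV. \<Sum>j\<in>UNIV. A y $ i $ j * \<xi> j * \<xi> i)"
      unfolding n2 by simp
    show "noise_density e \<sigma> (p - q) y = noise_density e \<sigma> p y - noise_density e \<sigma> q y" by (rule nd(1))
    have Lp: "sqrt C * norm p \<le> L * norm p" using Lge(6) by (intro mult_right_mono) auto
    show "\<bar>noise_density e \<sigma> p y\<bar> \<le> L * norm p * (1 + \<bar>y\<bar>)"
      using nd(2)[of p y] mult_right_mono[OF Lp, of "1 + \<bar>y\<bar>"] by linarith
    show "\<bar>noise_density e \<sigma> p y - noise_density e \<sigma> p z\<bar> \<le> L * norm p * \<bar>y - z\<bar>"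
      using nd(3)[of p y z] mult_right_mono[OF Lp, of "\<bar>y - z\<bar>"] by linarith
    show "h \<in> borel_measurable (lebesgue_on {0..T})" "integrable (lebesgue_on {0..T}) (\<lambda>t. (norm (h t))\<^sup>2)"
      using h by (auto simp: L2_U_def)
    show "sq_integrable torus u0" using u0 by (simp add: L2_real_iff)
  qed
  then show ?thesis by (rule that)
qed

theorem theorem4p2:
  fixes T :: real
    and B :: "real \<Rightarrow> real^'d"
    and A :: "real \<Rightarrow> real^'d^'d"
    and e :: "'k::countable \<Rightarrow> 'u::{real_inner, banach, second_countable_topology}"
    and \<sigma> :: "'k \<Rightarrow> real \<Rightarrow> real"
    and u0 :: "real^'d \<Rightarrow> real"
  assumes "T > 0"
    and "orthonormal_basis e"
    and "u0 \<in> L2"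
    and "hypothesis_H B A \<sigma>"
  shows "\<forall>h\<in>L2_U T. \<exists>u. is_solution T B A e \<sigma> u0 h u \<and>
           (SUP t\<in>{0..T}. ennreal ((L2_norm (u t))\<^sup>2))
             + (\<integral>\<^sup>+t. ennreal ((H1_norm (u t))\<^sup>2) \<partial>lebesgue_on {0..T}) < \<infinity>"
proof
  fix h :: "real \<Rightarrow> 'u" assume h: "h \<in> L2_U T"
  obtain \<delta> L where Q: "quasilinear T \<delta> L (\<lambda>i y. B y $ i) (\<lambda>i j y. A y $ i $ j) (noise_density e \<sigma>) h u0"
    using quasilinear_of_hypothesis_H[OF assms h] .
  interpret quasilinear T \<delta> L "\<lambda>i y. B y $ i" "\<lambda>i j y. A y $ i $ j" "noise_density e \<sigma>" h u0 by (rule Q)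
  obtain r c where r: "strict_mono (r :: nat \<Rightarrow> nat)" "\<And>\<kappa> t. t \<in> {0..T} \<Longrightarrow> (\<lambda>n. galerkin (r n) \<kappa> t) \<longlonglongrightarrow> c \<kappa> t"
    using galerkin_subsequence by blast
  interpret quasilinear_limit T \<delta> L "\<lambda>i y. B y $ i" "\<lambda>i j y. A y $ i $ j" "noise_density e \<sigma>" h u0 r c
    by unfold_locales (use r in auto)
  have sol: "is_solution T B A e \<sigma> u0 h u"
    unfolding is_solution_def
  proof (intro conjI ballI)
    show "u \<in> C_H T \<inter> L2_H1 T" using u_C_H u_L2_H1 by blast
    fix \<phi> :: "real^'d \<Rightarrow> real" and t assume \<phi>: "\<phi> \<in> Cinf_torus" and t: "t \<in> {0..T}"
    have gL2: "grad \<phi> \<in> L2" using Cinf_torus_sq_integrable(2)[OF \<phi>] by (simp add: L2_vec_iff)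
    have "L2_inner (\<lambda>x. B (u s x)) (grad \<phi>) = drift_term \<phi> s" if s: "s \<in> {0..T}" for s
    proof -
      have "(\<lambda>x. B (u s x)) \<in> L2" using b_sq(1)[OF u_props(1)[OF s]] by (simp add: L2_vec_iff)
      then show ?thesis unfolding drift_term_def by (rule L2_inner_vec[OF _ gL2])
    qed
    then have drift: "(LINT s|lebesgue_on {0..t}. L2_inner (\<lambda>x. B (u s x)) (grad \<phi>)) = integral {0..t} (drift_term \<phi>)"
      by (intro spike_finite_gradient(2)[OF term_integrable(2)[OF \<phi>] _ t])
    have "L2_inner (\<lambda>x. A (u s x) *v wgrad (u s) x) (grad \<phi>) = diffusion_term \<phi> s" if s: "s \<in> {0..T}" "finite_gradient s" for s
    proof -
      have c: "(A (u s x) *v wgrad (u s) x) $ i = (\<Sum>j\<in>UNIV. A (u s x) $ i $ j * Du j s x)" for x i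
        using s(2) by (simp add: matrix_vector_mult_def Du_def)
      have "sq_integrable torus (\<lambda>x. \<Sum>j\<in>UNIV. A (u s x) $ i $ j * Du j s x)" for i
        by (intro sq_integrable_sum a_sq u_props Du_sq s)
      then have "(\<lambda>x. A (u s x) *v wgrad (u s) x) \<in> L2" unfolding L2_vec_iff c by blast
      from L2_inner_vec[OF this gL2] show ?thesis unfolding c diffusion_term_eq[OF \<phi> s(1)] .
    qed
    then have diffusion: "(LINT s|lebesgue_on {0..t}. L2_inner (\<lambda>x. A (u s x) *v wgrad (u s) x) (grad \<phi>)) = integral {0..t} (diffusion_term \<phi>)"
      by (intro spike_finite_gradient(2)[OF term_integrable(4)[OF \<phi>] _ t])
    have "L2_inner (noise_op e \<sigma> (u s) (h s)) \<phi> = noise_term \<phi> s" for s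
      unfolding noise_op_eq L2_inner_real noise_term_def ..
    then have noise: "(LINT s|lebesgue_on {0..t}. L2_inner (noise_op e \<sigma> (u s) (h s)) \<phi>) = integral {0..t} (noise_term \<phi>)"
      by (intro spike_finite_gradient(2)[OF term_integrable(3)[OF \<phi>] _ t])
    show "L2_inner (u t) \<phi> - L2_inner u0 \<phi> - (LINT s|lebesgue_on {0..t}. L2_inner (\<lambda>x. B (u s x)) (grad \<phi>))
        = - (LINT s|lebesgue_on {0..t}. L2_inner (\<lambda>x. A (u s x) *v wgrad (u s) x) (grad \<phi>))
          + (LINT s|lebesgue_on {0..t}. L2_inner (noise_op e \<sigma> (u s) (h s)) \<phi>)"
      unfolding drift diffusion noise unfolding L2_inner_real by (rule weak_formulation[OF \<phi> t])
  qed
  have "(SUP t\<in>{0..T}. ennreal ((L2_norm (u t))\<^sup>2)) \<le> ennreal C_apriori"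
    using u_lnorm by (intro SUP_least) (simp add: L2_norm_real ennreal_leI)
  then have "(SUP t\<in>{0..T}. ennreal ((L2_norm (u t))\<^sup>2)) < \<infinity>" by (rule le_less_trans) simp
  moreover have "(\<integral>\<^sup>+t. ennreal ((H1_norm (u t))\<^sup>2) \<partial>lebesgue_on {0..T}) < \<infinity>"
    using nn_integral_eq_integral[OF H1_norm_u_integrable] by simp
  ultimately have "(SUP t\<in>{0..T}. ennreal ((L2_norm (u t))\<^sup>2)) + (\<integral>\<^sup>+t. ennreal ((H1_norm (u t))\<^sup>2) \<partial>lebesgue_on {0..T}) < \<infinity>"
    by simp
  with sol show "\<exists>u. is_solution T B A e \<sigma> u0 h u \<and>
           (SUP t\<in>{0..T}. ennreal ((L2_norm (u t))\<^sup>2))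
             + (\<integral>\<^sup>+t. ennreal ((H1_norm (u t))\<^sup>2) \<partial>lebesgue_on {0..T}) < \<infinity>" by blast
qed

end
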